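(* In each of the following collections of Riemannian manifolds and orbifolds, no two distinct members are $0$-isospectral: (1) the Klein bottle $K$, the cylinder $C$, the Möbius strip $B$, and the four pillow $\mathcal{O}$; (2) for each integer $m>1$: the flat orbifolds $\mathcal{O}_k=\langle\tau_k\rangle\backslash(\mathbb{Z}^{2m}\backslash\mathbb{R}^{2m})$ for odd $k$ with $1\le k\le 2m-3$, together with the products of the cubical torus $\mathbb{Z}^{2m-2}\backslash\mathbb{R}^{2m-2}$ with $K$, with $C$, and with $B$; (3) for each integer $m>1$: the spherical orbifolds $\langle\sigma_k\rangle\backslash S^{2m}$ for even $k$ with $2\le k\le 2m-2$, together with the projective space $\langle-\mathrm{Id}\rangle\backslash S^{2m}$ and the hemisphere of $S^{2m}$.
   Context: Two compact Riemannian manifolds or orbifolds are $0$-isospectral if the Laplacians acting on functions have the same spectrum with multiplicities. For an orbifold $\langle\tau\rangle\backslash M$, with $M$ closed and $\tau$ an isometric involution, this is the spectrum of the Laplacian of $M$ on $\tau$-invariant smooth functions; for manifolds with boundary it is the spectrum with absolute boundary conditions, i.e. the Neumann spectrum. Quotients by involutions whose fixed point set has codimension one are viewed as manifolds with boundary; the Neumann spectrum coincides with the orbifold $0$-spectrum. Let $T=\mathbb{Z}^2\backslash\mathbb{R}^2$. Then $K$, $C$, $B$, $\mathcal{O}$ are the quotients of $T$ by the involutions induced by the following isometries of $\mathbb{R}^2$: for $K$, the composition of translation by $(\frac12,0)$ with the reflection $R(x,y)=(x,-y)$; for $C$, the reflection $R$; for $B$, the reflection across the line $x=y$; for $\mathcal{O}$,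 the map $-\mathrm{Id}$. For odd $k$ with $1\le k\le 2m-3$, $\tau_k$ is the involution of the cubical torus $\mathbb{Z}^{2m}\backslash\mathbb{R}^{2m}$ induced by the diagonal $2m\times 2m$ matrix $\mathrm{diag}(-1,\dots,-1,1,\dots,1)$ with $2m-k$ entries $-1$ and $k$ entries $1$. For even $k$ with $2\le k\le 2m-2$, $\sigma_k$ is the involution of the unit sphere $S^{2m}\subset\mathbb{R}^{2m+1}$ given by the diagonal $(2m+1)\times(2m+1)$ matrix $\mathrm{diag}(-1,\dots,-1,1,\dots,1)$ with $2m+1-k$ entries $-1$ and $k$ entries $1$. The hemisphere is the quotient of $S^{2m}$ by the reflection across an equatorial sphere. *)

theory Defs
  imports "HOL-Analysis.Analysis" "HOL-Library.Function_Algebras"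
begin

section \<open>Smooth functions and the Laplacian on a submanifold of Euclidean space\<close>

text \<open>Both covering manifolds needed here, \<open>\<real>\<^sup>n\<close> (as the set \<^term>\<open>UNIV\<close>) and the unit sphere,
  are closed embedded submanifolds of a Euclidean space with the induced metric. A function
  on \<open>M\<close> is a function on the ambient space of which only the values on \<open>M\<close> matter.\<close>

primrec Ck_on :: "nat \<Rightarrow> 'a::euclidean_space set \<Rightarrow> ('a \<Rightarrow> real) \<Rightarrow> bool" where
  "Ck_on 0 U f \<longleftrightarrow> continuous_on U f"
| "Ck_on (Suc k) U f \<longleftrightarrow>
     f differentiable_on U \<and> (\<forall>v. Ck_on k U (\<lambda>x. frechet_derivative f (at x) v))"

definition smooth_on_submanifold :: "'a::euclidean_space set \<Rightarrow> ('a \<Rightarrow> real) \<Rightarrow> bool" where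
  "smooth_on_submanifold M f \<longleftrightarrow>
     (\<exists>U F. open U \<and> M \<subseteq> U \<and> (\<forall>k. Ck_on k U F) \<and> (\<forall>x\<in>M. F x = f x))"

definition tangent_space :: "'a::euclidean_space set \<Rightarrow> 'a \<Rightarrow> 'a set" where
  "tangent_space M p =
     {v. \<exists>c::real \<Rightarrow> 'a. c 0 = p \<and> range c \<subseteq> M \<and> (c has_vector_derivative v) (at 0)}"

definition orthonormal_frame :: "'a::euclidean_space set \<Rightarrow> 'a \<Rightarrow> 'a set" where
  "orthonormal_frame M p =
     (SOME B. B \<subseteq> tangent_space M p \<and> pairwise orthogonal B \<and> (\<forall>b\<in>B. norm b = 1)
        \<and> span B = tangent_space M p)"

text \<open>A derivative relative to \<open>M\<close> (\<^term>\<open>at p within M\<close>) is determined only on vectors tangent to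
  \<open>M\<close>, and it is only evaluated there. Neither operator depends on the chosen frame. In the
  divergence, the inner product with a tangent vector realises the Levi-Civita connection as the
  tangential part of the ambient derivative.\<close>

definition grad :: "'a::euclidean_space set \<Rightarrow> ('a \<Rightarrow> real) \<Rightarrow> 'a \<Rightarrow> 'a" where
  "grad M f p =
     (\<Sum>e\<in>orthonormal_frame M p. frechet_derivative f (at p within M) e *\<^sub>R e)"

definition diverg :: "'a::euclidean_space set \<Rightarrow> ('a \<Rightarrow> 'a) \<Rightarrow> 'a \<Rightarrow> real" where
  "diverg M X p =
     (\<Sum>e\<in>orthonormal_frame M p. frechet_derivative X (at p within M) e \<bullet> e)"

definition laplacian :: "'a::euclidean_space set \<Rightarrow> ('a \<Rightarrow> real) \<Rightarrow> 'a \<Rightarrow> real" where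
  "laplacian M f p = - diverg M (grad M f) p"


section \<open>Quotients and their spectra\<close>

text \<open>The pair \<open>(M, G)\<close> presents the Riemannian manifold or orbifold \<open>\<langle>G\<rangle>\<setminus>M\<close>, where \<open>G\<close> is a set of
  isometries of \<open>M\<close> generating a properly discontinuous group. Functions on the quotient are the
  \<open>G\<close>-invariant functions on \<open>M\<close>, and the projection being a local isometry (off the singular set)
  its Laplacian is that of \<open>M\<close>. If the quotient is viewed as a manifold with boundary (a generator
  being a reflection), this is the Laplacian with Neumann boundary conditions.\<close>

type_synonym 'a quotient_presentation = "'a set \<times> ('a \<Rightarrow> 'a) set"

definition quotient_by ::
    "'a quotient_presentation \<Rightarrow> ('a \<Rightarrow> 'a) \<Rightarrow> 'a quotient_presentation" where
  "quotient_by Q \<tau> = (fst Q, insert \<tau> (snd Q))"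

definition riemannian_product ::
    "'a quotient_presentation \<Rightarrow> 'b quotient_presentation \<Rightarrow> ('a \<times> 'b) quotient_presentation" where
  "riemannian_product P Q =
     (fst P \<times> fst Q, (\<lambda>g. map_prod g id) ` snd P \<union> (\<lambda>h. map_prod id h) ` snd Q)"

text \<open>Functions are normalised to vanish off \<open>M\<close>, so that they are determined by their values
  on \<open>M\<close>.\<close>

definition eigenspace ::
    "'a::euclidean_space quotient_presentation \<Rightarrow> real \<Rightarrow> ('a \<Rightarrow> real) set" where
  "eigenspace Q \<mu> =
     {f. smooth_on_submanifold (fst Q) f \<and> (\<forall>x. x \<notin> fst Q \<longrightarrow> f x = 0)
         \<and> (\<forall>g\<in>snd Q. \<forall>x\<in>fst Q. f (g x) = f x)
         \<and> (\<forall>p\<in>fst Q. laplacian (fst Q) f p = \<mu> * f p)}"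

interpretation real_fun: vector_space "\<lambda>(c::real) (f::'a \<Rightarrow> real) x. c * f x"
  by unfold_locales (auto simp: fun_eq_iff algebra_simps)

text \<open>The quotients are compact, so all eigenspaces are finite-dimensional, the spectrum consists
  of (real) eigenvalues, and the multiplicity function (zero off the spectrum) encodes the spectrum
  with multiplicities.\<close>

definition multiplicity_0 :: "'a::euclidean_space quotient_presentation \<Rightarrow> real \<Rightarrow> nat" where
  "multiplicity_0 Q \<mu> = real_fun.dim (eigenspace Q \<mu>)"

definition isospectral_0 ::
    "'a::euclidean_space quotient_presentation \<Rightarrow> 'b::euclidean_space quotient_presentation \<Rightarrow> bool" where
  "isospectral_0 P Q \<longleftrightarrow> (\<forall>\<mu>. multiplicity_0 P \<mu> = multiplicity_0 Q \<mu>)"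


section \<open>The manifolds and orbifolds\<close>

definition cubical_torus :: "(real ^ 'n) quotient_presentation" where
  "cubical_torus = (UNIV, {\<lambda>x. x + z | z. \<forall>i. z $ i \<in> \<int>})"

definition round_sphere :: "(real ^ 'n) quotient_presentation" where
  "round_sphere = (sphere 0 1, {})"

definition klein_bottle :: "(real ^ 2) quotient_presentation" where
  "klein_bottle = quotient_by cubical_torus (\<lambda>v. vector [v $ 1 + 1 / 2, - (v $ 2)])"

definition cylinder :: "(real ^ 2) quotient_presentation" where
  "cylinder = quotient_by cubical_torus (\<lambda>v. vector [v $ 1, - (v $ 2)])"

definition moebius_strip :: "(real ^ 2) quotient_presentation" where
  "moebius_strip = quotient_by cubical_torus (\<lambda>v. vector [v $ 2, v $ 1])"

definition four_pillow :: "(real ^ 2) quotient_presentation" where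
  "four_pillow = quotient_by cubical_torus (\<lambda>v. - v)"

text \<open>The matrix \<open>diag(-1,\<dots>,-1,1,\<dots>,1)\<close> whose first \<open>r\<close> diagonal entries, in the order of the
  index type, are \<open>-1\<close>.\<close>

definition sign_matrix :: "nat \<Rightarrow> ((real, 'n) vec, 'n::{finite,linorder}) vec" where
  "sign_matrix r =
     (\<chi> i j. if i = j then (if card {l. l < i} < r then - 1 else 1) else 0)"

definition flat_orbifold :: "nat \<Rightarrow> (real, 'n::{finite,linorder}) vec quotient_presentation" where
  "flat_orbifold k = quotient_by cubical_torus (\<lambda>x. sign_matrix (CARD('n) - k) *v x)"

definition spherical_orbifold :: "nat \<Rightarrow> (real, 'n::{finite,linorder}) vec quotient_presentation" where
  "spherical_orbifold k = quotient_by round_sphere (\<lambda>x. sign_matrix (CARD('n) - k) *v x)"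

definition projective_space :: "(real ^ 'n) quotient_presentation" where
  "projective_space = quotient_by round_sphere (\<lambda>x. - x)"

text \<open>The hemisphere bounded by the equatorial sphere orthogonal to the unit vector \<open>u\<close>.\<close>

definition hemisphere :: "real ^ 'n \<Rightarrow> (real ^ 'n) quotient_presentation" where
  "hemisphere u = quotient_by round_sphere (\<lambda>x. x - (2 * (x \<bullet> u)) *\<^sub>R u)"

end

theory Submission
  imports Defs
begin

text \<open>Each comparison is decided by a single multiplicity. On a flat quotient of the torus, real
  Fourier analysis turns the eigenspace for \<open>4 \<pi>\<^sup>2 r\<close> into the invariants of a signed permutation of the
  lattice vectors of squared length \<open>r\<close>, so that the multiplicity is found by counting orbits. The level
  \<open>r = 1\<close> separates all pairs except the Moebius strip and the pillow, and the orbifold with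
  \<open>k = 2 m - 3\<close> and the product with the Klein bottle; these two pairs differ at \<open>r = 2\<close>.
  On a quotient of the sphere in \<open>\<real>\<^sup>n\<close> by a linear
  involution \<open>\<sigma>\<close>, the first eigenvalue \<open>n - 1\<close> suffices: extended homogeneously of degree 1, an
  eigenfunction becomes harmonic off the origin, its first derivatives are harmonic of degree 0, hence
  constant, and the multiplicity is the dimension of the fixed space of \<open>\<sigma>\<close>.\<close>


section \<open>Smooth functions and directional derivatives\<close>

text \<open>The hard half of every multiplicity is the upper bound: an arbitrary smooth invariant
  solution of the eigenvalue equation has to be placed in a known finite-dimensional space. On the
  torus this is completeness of the trigonometric functions, by Stone-Weierstrass; on the sphere it
  is a Liouville-type statement for harmonic functions of degree 0 off the origin, by the divergence
  theorem on a large box. Both rest on \<open>integral_dir_deriv_box\<close>: opposite faces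
  contribute equally, by periodicity in one case and because a cutoff vanishes there in the other.
  The exceptional pairs are forced by the count at r = 1 in dimension n: an involution reversing j
  axes leaves 2n - j dimensions, a swap of two axes 2n - 2, a glide reflection 2n - 3. So the swap
  ties with j = 2, which is the pillow when n = 2, and the glide with j = 3, which is k = 2m - 3
  when n = 2m. On the sphere, degree 1 is the right extension because it turns the eigenvalue n - 1
  into Laplace's equation, whose constant coefficients let derivatives of solutions be solutions
  again.\<close>

abbreviation dir_deriv :: "('a::real_normed_vector \<Rightarrow> 'b::real_normed_vector) \<Rightarrow> 'a \<Rightarrow> 'a \<Rightarrow> 'b" where
  "dir_deriv f v \<equiv> \<lambda>x. frechet_derivative f (at x) v"

text \<open>Both derivatives are choices from the same predicate, so they agree even where neither
  function is differentiable.\<close>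

lemma frechet_derivative_cong_open:
  assumes "open U" "x \<in> U" "\<And>y. y \<in> U \<Longrightarrow> f y = g y"
  shows "frechet_derivative f (at x) = frechet_derivative g (at x)"
proof -
  have "(f has_derivative D) (at x) \<longleftrightarrow> (g has_derivative D) (at x)" for D
    using has_derivative_transform_within_open[OF _ assms(1,2), of f D UNIV g]
      has_derivative_transform_within_open[OF _ assms(1,2), of g D UNIV f] assms(3) by metis
  then show ?thesis unfolding frechet_derivative_def by simp
qed

lemma frechet_derivative_eq:
  "(f has_derivative D) (at x) \<Longrightarrow> frechet_derivative f (at x) = D"
  by (metis frechet_derivative_at)

lemma Ck_on_cong:
  assumes "open U" "\<And>x. x \<in> U \<Longrightarrow> f x = g x"
  shows "Ck_on k U f \<longleftrightarrow> Ck_on k U g"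
  using assms(2)
proof (induction k arbitrary: f g)
  case 0
  then show ?case by (simp cong: continuous_on_cong)
next
  case (Suc k)
  have "f differentiable_on U" if "g differentiable_on U" "\<And>x. x \<in> U \<Longrightarrow> f x = g x" for f g :: "'a \<Rightarrow> real"
    using that unfolding differentiable_on_def
    by (auto intro: differentiable_transform_within[where d = 1])
  then have "f differentiable_on U \<longleftrightarrow> g differentiable_on U"
    using Suc.prems by auto
  moreover have "Ck_on k U (dir_deriv f v) \<longleftrightarrow> Ck_on k U (dir_deriv g v)" for v
    by (rule Suc.IH) (simp add: frechet_derivative_cong_open[OF assms(1) _ Suc.prems])
  ultimately show ?case by simp
qed

lemma Ck_on_Suc_D: "Ck_on (Suc k) U f \<Longrightarrow> Ck_on k U f"
proof (induction k arbitrary: f)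
  case 0
  then show ?case by (simp add: differentiable_imp_continuous_on)
next
  case (Suc k)
  have "f differentiable_on U" "Ck_on (Suc k) U (dir_deriv f v)" for v
    using Suc.prems Ck_on.simps(2)[of "Suc k" U f] by blast+
  then have "Ck_on k U (dir_deriv f v)" for v using Suc.IH by blast
  with \<open>f differentiable_on U\<close> show ?case by simp
qed

lemma Ck_on_continuous: "Ck_on k U f \<Longrightarrow> continuous_on U f"
  by (cases k) (auto simp: differentiable_imp_continuous_on)

lemma Ck_on_has_derivative:
  assumes "Ck_on (Suc k) U f" "open U" "x \<in> U"
  shows "(f has_derivative frechet_derivative f (at x)) (at x)"
  using assms differentiable_on_eq_differentiable_at[OF assms(2), of f] frechet_derivative_works[of f "at x"]
  by auto

text \<open>\<open>Ck_on\<close> speaks of the chosen derivative, closure proofs produce an explicit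
  formula \<open>D\<close>. This rule mediates once and for all; openness of \<open>U\<close> makes
  the derivative unique and lets the formula replace it throughout \<open>U\<close>.\<close>

lemma Ck_on_SucI:
  assumes U: "open U"
    and D: "\<And>x. x \<in> U \<Longrightarrow> (f has_derivative (\<lambda>v. D v x)) (at x)"
    and C: "\<And>v. Ck_on k U (D v)"
  shows "Ck_on (Suc k) U f"
proof -
  have "f differentiable_on U"
    using D by (meson differentiable_at_imp_differentiable_on differentiable_def)
  moreover have "Ck_on k U (dir_deriv f v)" for v
    using C[of v] Ck_on_cong[OF U, of "dir_deriv f v" "D v" k] by (metis frechet_derivative_eq[OF D])
  ultimately show ?thesis by simp
qed

lemma Ck_on_const: "open U \<Longrightarrow> Ck_on k U (\<lambda>x. c)"
proof (induction k arbitrary: c)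
  case (Suc k)
  show ?case by (rule Ck_on_SucI[where D = "\<lambda>v x. 0"]) (use Suc in auto)
qed simp

lemma Ck_on_inner: "open U \<Longrightarrow> Ck_on k U (\<lambda>x. x \<bullet> a)"
proof (cases k)
  case (Suc k)
  assume U: "open U"
  show ?thesis unfolding Suc
    by (rule Ck_on_SucI[where D = "\<lambda>v x. v \<bullet> a"])
      (use U in \<open>auto intro!: Ck_on_const derivative_eq_intros\<close>)
qed (auto intro!: continuous_intros)

lemma Ck_on_add:
  assumes "open U" "Ck_on k U f" "Ck_on k U g"
  shows "Ck_on k U (\<lambda>x. f x + g x)"
  using assms(2,3)
proof (induction k arbitrary: f g)
  case (Suc k)
  show ?case
  proof (rule Ck_on_SucI[where D = "\<lambda>v x. dir_deriv f v x + dir_deriv g v x"])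
    fix x assume "x \<in> U"
    then show "((\<lambda>x. f x + g x) has_derivative (\<lambda>v. dir_deriv f v x + dir_deriv g v x)) (at x)"
      using Suc.prems assms(1) by (auto intro!: derivative_intros Ck_on_has_derivative)
  qed (use Suc assms(1) in auto)
qed (auto intro!: continuous_intros)

lemma Ck_on_mult:
  assumes "open U" "Ck_on k U f" "Ck_on k U g"
  shows "Ck_on k U (\<lambda>x. f x * g x)"
  using assms(2,3)
proof (induction k arbitrary: f g)
  case (Suc k)
  show ?case
  proof (rule Ck_on_SucI[where D = "\<lambda>v x. f x * dir_deriv g v x + dir_deriv f v x * g x"])
    fix x assume "x \<in> U"
    then show "((\<lambda>x. f x * g x) has_derivative (\<lambda>v. f x * dir_deriv g v x + dir_deriv f v x * g x)) (at x)"
      using Suc.prems assms(1) by (auto intro!: has_derivative_mult Ck_on_has_derivative)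
  next
    fix v
    have "Ck_on k U (dir_deriv f v)" "Ck_on k U (dir_deriv g v)" "Ck_on k U f" "Ck_on k U g"
      using Suc.prems Ck_on_Suc_D by auto
    then show "Ck_on k U (\<lambda>x. f x * dir_deriv g v x + dir_deriv f v x * g x)"
      using Suc.IH by (intro Ck_on_add assms(1)) auto
  qed fact
qed (auto intro!: continuous_intros)

lemma Ck_on_sum:
  assumes "open U" "\<And>i. i \<in> I \<Longrightarrow> Ck_on k U (f i)"
  shows "Ck_on k U (\<lambda>x. \<Sum>i\<in>I. f i x)"
  using assms(2)
proof (induction I rule: infinite_finite_induct)
  case (insert i I)
  then show ?case using Ck_on_add[OF assms(1), of k "f i" "\<lambda>x. \<Sum>i\<in>I. f i x"] by simp
qed (auto intro: Ck_on_const assms(1))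

text \<open>\<open>Ck_on\<close> covers real-valued functions only, so smoothness of
  \<open>N\<close> is expressed through its components. By the chain rule each derivative is a sum
  of products with a derivative of \<open>G\<close> as the new outer function; hence the induction
  keeps \<open>N\<close> and varies \<open>G\<close>.\<close>

lemma Ck_on_compose:
  fixes N :: "'b::euclidean_space \<Rightarrow> 'a::euclidean_space"
  assumes U: "open U" and V: "open V" and N: "\<And>b. b \<in> Basis \<Longrightarrow> Ck_on k V (\<lambda>x. N x \<bullet> b)"
    and NV: "N ` V \<subseteq> U" and G: "Ck_on k U G"
  shows "Ck_on k V (\<lambda>x. G (N x))"
  using N G
proof (induction k arbitrary: G)
  case 0
  have "continuous_on V N" 
    using 0 by (subst continuous_on_componentwise) auto
  then show ?case using 0 NV by (auto intro: continuous_on_compose2)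
next
  case (Suc k)
  define D where "D v x = (\<Sum>b\<in>Basis. dir_deriv (\<lambda>x. N x \<bullet> b) v x * dir_deriv G b (N x))" for v x
  show ?case
  proof (rule Ck_on_SucI[where D = D])
    fix x assume x: "x \<in> V"
    have "(N has_derivative (\<lambda>v. \<Sum>b\<in>Basis. dir_deriv (\<lambda>x. N x \<bullet> b) v x *\<^sub>R b)) (at x)"
    proof (subst has_derivative_componentwise_within, intro ballI)
      fix b :: 'a assume b: "b \<in> Basis"
      have "((\<lambda>x. N x \<bullet> b) has_derivative (\<lambda>v. dir_deriv (\<lambda>x. N x \<bullet> b) v x)) (at x)"
        by (rule Ck_on_has_derivative[OF Suc.prems(1)]) (use b V x in auto)
      then show "((\<lambda>x. N x \<bullet> b) has_derivative
           (\<lambda>xa. (\<Sum>b\<in>Basis. dir_deriv (\<lambda>x. N x \<bullet> b) xa x *\<^sub>R b) \<bullet> b)) (at x)"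
        using b by simp
    qed
    moreover have "(G has_derivative frechet_derivative G (at (N x))) (at (N x))"
      by (rule Ck_on_has_derivative[OF Suc.prems(2)]) (use U NV x in auto)
    ultimately have "((\<lambda>x. G (N x)) has_derivative (\<lambda>v. frechet_derivative G (at (N x))
       (\<Sum>b\<in>Basis. dir_deriv (\<lambda>x. N x \<bullet> b) v x *\<^sub>R b))) (at x)"
      by (rule has_derivative_compose)
    moreover have "linear (frechet_derivative G (at (N x)))"
      using \<open>(G has_derivative _) _\<close> has_derivative_linear by blast
    ultimately show "((\<lambda>x. G (N x)) has_derivative (\<lambda>v. D v x)) (at x)"
      by (simp add: D_def linear_sum linear_scale)
  next
    fix v
    have "Ck_on k U (dir_deriv G b)" for b using Suc.prems(2) by simp
    then have "Ck_on k V (\<lambda>x. dir_deriv G b (N x))" for b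
      using Suc.IH Ck_on_Suc_D[OF Suc.prems(1)] by blast
    moreover have "Ck_on k V (dir_deriv (\<lambda>x. N x \<bullet> b) v)" if "b \<in> Basis" for b
      using Suc.prems(1)[OF that] by simp
    ultimately show "Ck_on k V (D v)"
      unfolding D_def by (intro Ck_on_sum Ck_on_mult V)
  qed fact
qed

text \<open>The exponent is an arbitrary real because each differentiation lowers it by 2; the
  induction has to range over all exponents.\<close>

lemma Ck_on_norm_powr: "Ck_on k (- {0::'a::euclidean_space}) (\<lambda>x. norm x powr r)"
proof (induction k arbitrary: r)
  case 0
  show ?case
    by (simp, intro continuous_on_powr continuous_on_norm continuous_on_id continuous_on_const) auto
next
  case (Suc k)
  show ?case
  proof (rule Ck_on_SucI[where D = "\<lambda>v x. r * ((x \<bullet> v) * norm x powr (r - 2))"])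
    fix x :: 'a assume x: "x \<in> - {0}"
    have "((\<lambda>x. norm x powr r) has_derivative (\<lambda>v. norm x powr r * (0 * ln (norm x) + (v \<bullet> sgn x) * r / norm x))) (at x)"
      by (rule has_derivative_powr[OF has_derivative_norm has_derivative_const]) (use x in auto)
    moreover have "norm x powr r * (0 * ln (norm x) + (v \<bullet> sgn x) * r / norm x) = r * ((x \<bullet> v) * norm x powr (r - 2))" for v
      using x by (simp add: sgn_div_norm powr_diff field_simps power2_eq_square inner_commute)
    ultimately show "((\<lambda>x. norm x powr r) has_derivative (\<lambda>v. r * ((x \<bullet> v) * norm x powr (r - 2)))) (at x)"
      by simp
  next
    fix v show "Ck_on k (-{0}) (\<lambda>x::'a. r * ((x \<bullet> v) * norm x powr (r - 2)))"
      by (intro Ck_on_mult Ck_on_const Ck_on_inner Suc) auto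
  qed auto
qed

text \<open>Differentiating \<open>\<phi>(t) = \<integral> h(x + t b) dx\<close>, which is constant for small \<open>t \<ge> 0\<close> because the slab
  leaving the box is replaced by the slab entering it.\<close>

lemma integral_dir_deriv_box:
  fixes h k :: "'a::euclidean_space \<Rightarrow> real"
  assumes b: "b \<in> Basis" and d: "0 < \<delta>" "\<delta> \<le> (c - a) \<bullet> b"
    and hd: "\<And>x. ((\<lambda>t. h (x + t *\<^sub>R b)) has_field_derivative k x) (at 0)"
    and hc: "continuous_on UNIV h" and kc: "continuous_on UNIV k"
    and per: "\<And>x. x \<in> cbox a c \<Longrightarrow> x \<bullet> b \<le> a \<bullet> b + \<delta> \<Longrightarrow> h (x + ((c - a) \<bullet> b) *\<^sub>R b) = h x"
  shows "integral (cbox a c) k = 0"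
proof -
  define L where "L = (c - a) \<bullet> b"
  define \<phi> where "\<phi> t = integral (cbox a c) (\<lambda>x. h (x + t *\<^sub>R b))" for t
  have hi: "h integrable_on cbox u w" for u w
    by (rule integrable_continuous) (rule continuous_on_subset[OF hc], simp)
  have hti: "(\<lambda>x. h (x + t)) integrable_on cbox u w" for t u w
    by (rule integrable_continuous) (auto intro!: continuous_on_compose2[OF hc] continuous_intros)
  have shift: "integral (cbox u w) (\<lambda>x. h (x + t)) = integral (cbox (u + t) (w + t)) h" for t u w
    using integral_shift_cbox[of "u + t" t "w + t" h] by simp
  have bb: "b \<bullet> b = 1" and nb: "\<And>i. i \<in> Basis - {b} \<Longrightarrow> b \<bullet> i = 0"
    using b by (auto simp: inner_Basis)
  have mem: "x \<in> cbox (u + s *\<^sub>R b) (w + s' *\<^sub>R b) \<longleftrightarrow> u \<bullet> b + s \<le> x \<bullet> b \<and> x \<bullet> b \<le> w \<bullet> b + s' \<and>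
      (\<forall>i\<in>Basis - {b}. u \<bullet> i \<le> x \<bullet> i \<and> x \<bullet> i \<le> w \<bullet> i)" for x u w s s'
  proof -
    have "(\<forall>i\<in>Basis - {b}. (u + s *\<^sub>R b) \<bullet> i \<le> x \<bullet> i \<and> x \<bullet> i \<le> (w + s' *\<^sub>R b) \<bullet> i)
      \<longleftrightarrow> (\<forall>i\<in>Basis - {b}. u \<bullet> i \<le> x \<bullet> i \<and> x \<bullet> i \<le> w \<bullet> i)"
      by (intro ball_cong refl) (simp only: inner_add_left inner_scaleR_left nb mult_zero_right add_0_right)
    moreover have "x \<in> cbox p q \<longleftrightarrow> p \<bullet> b \<le> x \<bullet> b \<and> x \<bullet> b \<le> q \<bullet> b \<and>
        (\<forall>i\<in>Basis - {b}. p \<bullet> i \<le> x \<bullet> i \<and> x \<bullet> i \<le> q \<bullet> i)" for p q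
      using b by (auto simp: mem_box)
    ultimately show ?thesis by (simp only: inner_add_left inner_scaleR_left bb mult_1_right)
  qed
  have \<phi>: "\<phi> t = \<phi> 0" if t: "0 \<le> t" "t \<le> \<delta>" for t
  proof -
    have tL: "t \<le> L" using t d L_def by simp
    \<comment> \<open>The translated box is the overlap \<open>box1\<close> plus the entering slab
      \<open>box2\<close>; the original box is the leaving slab \<open>box3\<close> plus the same
      overlap \<open>box4\<close>. The entering slab is the leaving one moved by \<open>L\<close>
      along \<open>b\<close>, where \<open>per\<close> applies.\<close>
    have box1: "cbox (a + t *\<^sub>R b) (c + t *\<^sub>R b) \<inter> {x. x \<bullet> b \<le> c \<bullet> b} = cbox (a + t *\<^sub>R b) (c + 0 *\<^sub>R b)"
      unfolding set_eq_iff Int_iff mem_Collect_eq mem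
      using t by auto
    have box2: "cbox (a + t *\<^sub>R b) (c + t *\<^sub>R b) \<inter> {x. x \<bullet> b \<ge> c \<bullet> b} = cbox (a + L *\<^sub>R b) (c + t *\<^sub>R b)"
      unfolding set_eq_iff Int_iff mem_Collect_eq mem L_def inner_diff_left
      using tL[unfolded L_def inner_diff_left] by auto
    have box3: "cbox (a + 0 *\<^sub>R b) (c + 0 *\<^sub>R b) \<inter> {x. x \<bullet> b \<le> a \<bullet> b + t} = cbox (a + 0 *\<^sub>R b) (c + (t - L) *\<^sub>R b)"
      unfolding set_eq_iff Int_iff mem_Collect_eq mem L_def inner_diff_left
      using tL[unfolded L_def inner_diff_left] by auto
    have box4: "cbox (a + 0 *\<^sub>R b) (c + 0 *\<^sub>R b) \<inter> {x. x \<bullet> b \<ge> a \<bullet> b + t} = cbox (a + t *\<^sub>R b) (c + 0 *\<^sub>R b)"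
      unfolding set_eq_iff Int_iff mem_Collect_eq mem
      using t by auto
    note box = box1[simplified] box2 box3[simplified] box4[simplified]
    have cL: "c + t *\<^sub>R b = c + (t - L) *\<^sub>R b + L *\<^sub>R b"
      by (simp add: algebra_simps)
    have "\<phi> t = integral (cbox (a + t *\<^sub>R b) (c + t *\<^sub>R b)) h"
      unfolding \<phi>_def by (rule shift)
    also have "\<dots> = integral (cbox (a + t *\<^sub>R b) c) h + integral (cbox (a + L *\<^sub>R b) (c + (t - L) *\<^sub>R b + L *\<^sub>R b)) h"
      using integral_split[OF hi b, of "a + t *\<^sub>R b" "c + t *\<^sub>R b" "c \<bullet> b"] unfolding cL[symmetric] box(1,2) .
    also have "integral (cbox (a + L *\<^sub>R b) (c + (t - L) *\<^sub>R b + L *\<^sub>R b)) h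
       = integral (cbox a (c + (t - L) *\<^sub>R b)) (\<lambda>x. h (x + L *\<^sub>R b))"
      by (rule shift[symmetric])
    also have "\<dots> = integral (cbox a (c + (t - L) *\<^sub>R b)) h"
    proof (rule integral_cong)
      fix x assume "x \<in> cbox a (c + (t - L) *\<^sub>R b)"
      then have "x \<in> cbox a c" "x \<bullet> b \<le> a \<bullet> b + \<delta>" using t unfolding box(3)[symmetric] by auto
      then show "h (x + L *\<^sub>R b) = h x" using per by (simp add: L_def)
    qed
    also have "integral (cbox (a + t *\<^sub>R b) c) h + \<dots> = \<phi> 0"
      using integral_split[OF hi b, of a c "a \<bullet> b + t"] by (simp add: box \<phi>_def)
    finally show ?thesis .
  qed
  \<comment> \<open>The one-sided derivative of \<phi> at 0 is computed twice: differentiation under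
    the integral gives the integral of \<open>k\<close>, constancy gives 0.\<close>
  have "(\<phi> has_field_derivative integral (cbox a c) (\<lambda>x. k (x + 0 *\<^sub>R b))) (at 0 within {0..\<delta>})"
    unfolding \<phi>_def
  proof (rule leibniz_rule_field_derivative)
    fix t :: real and x :: 'a
    have "((\<lambda>s. h ((x + t *\<^sub>R b) + (s - t) *\<^sub>R b)) has_field_derivative k (x + t *\<^sub>R b) * 1) (at t)"
      by (rule DERIV_chain2[where f = "\<lambda>t'. h ((x + t *\<^sub>R b) + t' *\<^sub>R b)" and g = "\<lambda>s. s - t"])
        (use hd[of "x + t *\<^sub>R b"] in \<open>auto intro!: derivative_eq_intros\<close>)
    then show "((\<lambda>t. h (x + t *\<^sub>R b)) has_field_derivative k (x + t *\<^sub>R b)) (at t within {0..\<delta>})"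
      by (simp add: algebra_simps has_field_derivative_at_within)
  next
    show "continuous_on ({0..\<delta>} \<times> cbox a c) (\<lambda>(x, t). k (t + x *\<^sub>R b))"
      unfolding split_def by (auto intro!: continuous_on_compose2[OF kc] continuous_intros)
  qed (use d hti in auto)
  moreover have "(\<phi> has_field_derivative 0) (at 0 within {0..\<delta>})"
  proof (rule has_field_derivative_transform_within[OF DERIV_const zero_less_one])
    show "\<phi> 0 = \<phi> t" if "t \<in> {0..\<delta>}" "dist t 0 < 1" for t
      using \<phi>[of t] that by simp
  qed (use d in simp)
  ultimately have "integral (cbox a c) (\<lambda>x. k (x + 0 *\<^sub>R b)) = 0"
    using d by (intro vector_derivative_unique_within[of 0 "{0..\<delta>}" \<phi>])
      (simp_all add: at_within_Icc_at_right has_real_derivative_iff_has_vector_derivative)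
  then show ?thesis by simp
qed

section \<open>The Laplacian of a submanifold\<close>

text \<open>When \<open>M\<close> has smaller dimension, the derivative within \<open>M\<close> is
  not unique and \<open>frechet_derivative\<close> returns some choice. Along a curve in
  \<open>M\<close> with velocity \<open>v\<close>, every choice gives the derivative of the same
  function of one variable, and that one is unique.\<close>

lemma frechet_derivative_within_tangent:
  fixes F g :: "'a::euclidean_space \<Rightarrow> 'b::euclidean_space"
  assumes p: "p \<in> M" and F: "(F has_derivative F') (at p)" and eq: "\<And>q. q \<in> M \<Longrightarrow> g q = F q"
    and v: "v \<in> tangent_space M p"
  shows "frechet_derivative g (at p within M) v = F' v"
proof -
  obtain c where c: "c 0 = p" "range c \<subseteq> M" "(c has_vector_derivative v) (at 0)"
    using v by (auto simp: tangent_space_def)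
  have gF: "(g has_derivative F') (at p within M)"
    using has_derivative_transform[OF p eq has_derivative_at_withinI[OF F]] .
  then have gD: "(g has_derivative frechet_derivative g (at p within M)) (at p within M)"
    using frechet_derivative_works differentiable_def by blast
  have along: "((\<lambda>t. g (c t)) has_derivative (\<lambda>t. D (t *\<^sub>R v))) (at 0)"
    if "(g has_derivative D) (at p within M)" for D
    using has_derivative_in_compose[of c "\<lambda>t. t *\<^sub>R v" 0 UNIV g D] c that
    by (auto simp: has_vector_derivative_def intro: has_derivative_subset)
  show ?thesis
    using has_derivative_unique[OF along[OF gD] along[OF gF]] by (metis scaleR_one)
qed

lemma orthonormal_frame:
  assumes "subspace (tangent_space M p)"
  shows "orthonormal_frame M p \<subseteq> tangent_space M p" "pairwise orthogonal (orthonormal_frame M p)"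
    "\<And>e. e \<in> orthonormal_frame M p \<Longrightarrow> norm e = 1" "span (orthonormal_frame M p) = tangent_space M p"
    "independent (orthonormal_frame M p)" "finite (orthonormal_frame M p)"
proof -
  let ?P = "\<lambda>B. B \<subseteq> tangent_space M p \<and> pairwise orthogonal B \<and> (\<forall>b\<in>B. norm b = 1)
        \<and> span B = tangent_space M p"
  obtain B where "?P B" using orthonormal_basis_subspace[OF assms] by metis
  then have "?P (orthonormal_frame M p)"
    unfolding orthonormal_frame_def by (rule someI[where P = ?P])
  then show *: "orthonormal_frame M p \<subseteq> tangent_space M p" "pairwise orthogonal (orthonormal_frame M p)"
    "\<And>e. e \<in> orthonormal_frame M p \<Longrightarrow> norm e = 1" "span (orthonormal_frame M p) = tangent_space M p"
    by auto
  show "independent (orthonormal_frame M p)"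
    using *(3) by (intro pairwise_orthogonal_independent[OF *(2)]) (metis norm_zero zero_neq_one)
  then show "finite (orthonormal_frame M p)" by (rule finiteI_independent)
qed

text \<open>The trace is the same in every orthonormal basis. This removes the unknown frame chosen
  in the definition of the Laplacian.\<close>

lemma sum_orthonormal_basis_trace:
  fixes A :: "'a::euclidean_space \<Rightarrow> 'a"
  assumes "pairwise orthogonal E" "\<And>e. e \<in> E \<Longrightarrow> norm e = 1" "span E = UNIV" "finite E" "linear A"
  shows "(\<Sum>e\<in>E. A e \<bullet> e) = (\<Sum>b\<in>Basis. A b \<bullet> b)"
proof -
  have "(\<Sum>b\<in>Basis. A b \<bullet> b) = (\<Sum>b\<in>Basis. \<Sum>e\<in>E. (b \<bullet> e) * (A e \<bullet> b))"
  proof (rule sum.cong[OF refl])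
    fix b :: 'a
    have "A b = A (\<Sum>e\<in>E. (b \<bullet> e) *\<^sub>R e)"
      using orthonormal_basis_expand[of E b] assms by simp
    then show "A b \<bullet> b = (\<Sum>e\<in>E. (b \<bullet> e) * (A e \<bullet> b))"
      using assms(5) by (simp add: linear_sum linear_scale inner_sum_left)
  qed
  also have "\<dots> = (\<Sum>e\<in>E. \<Sum>b\<in>Basis. (A e \<bullet> b) * (e \<bullet> b))"
    by (subst sum.swap) (simp add: inner_commute mult.commute)
  also have "\<dots> = (\<Sum>e\<in>E. A e \<bullet> e)"
    by (simp flip: euclidean_inner)
  finally show ?thesis by simp
qed

text \<open>\<open>grad M f\<close> is under control on \<open>M\<close> only. The field
  \<open>X\<close> is defined around \<open>M\<close>, agrees with the gradient on \<open>M\<close>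
  (it is tangent and represents the derivative of \<open>F\<close> on tangent vectors), and has a
  full derivative at \<open>p\<close>, from which the divergence can be read off.\<close>

lemma laplacian_eq_trace:
  fixes f F :: "'a::euclidean_space \<Rightarrow> real" and X :: "'a \<Rightarrow> 'a"
  assumes sub: "\<And>q. q \<in> M \<Longrightarrow> subspace (tangent_space M q)"
    and F: "\<And>q. q \<in> M \<Longrightarrow> (F has_derivative F' q) (at q)" and fF: "\<And>q. q \<in> M \<Longrightarrow> f q = F q"
    and X: "\<And>q. q \<in> M \<Longrightarrow> X q \<in> tangent_space M q"
    and FX: "\<And>q v. q \<in> M \<Longrightarrow> v \<in> tangent_space M q \<Longrightarrow> F' q v = X q \<bullet> v"
    and p: "p \<in> M" and X': "(X has_derivative X') (at p)"
  shows "laplacian M f p = - (\<Sum>e\<in>orthonormal_frame M p. X' e \<bullet> e)"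
proof -
  have grad: "grad M f q = X q" if q: "q \<in> M" for q
  proof -
    note E = orthonormal_frame[OF sub[OF q]]
    have "grad M f q = (\<Sum>e\<in>orthonormal_frame M q. (X q \<bullet> e) *\<^sub>R e)"
      unfolding grad_def using E(1) FX[OF q] frechet_derivative_within_tangent[OF q F[OF q] fF]
      by (intro sum.cong refl) (metis subsetD)
    also have "\<dots> = X q"
      using E X[OF q] by (intro orthonormal_basis_expand) auto
    finally show ?thesis .
  qed
  have "e \<in> tangent_space M p" if "e \<in> orthonormal_frame M p" for e
    using orthonormal_frame(1)[OF sub[OF p]] that by auto
  then show ?thesis
    unfolding laplacian_def diverg_def using frechet_derivative_within_tangent[OF p X' grad]
    by (intro arg_cong[where f = uminus] sum.cong refl) simp
qed

lemma Ck_on_gradient: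
  assumes "Ck_on (Suc (Suc k)) U f" "open U" "x \<in> U"
  shows "((\<lambda>x. \<Sum>b\<in>Basis. dir_deriv f b x *\<^sub>R b) has_derivative
     (\<lambda>v. \<Sum>b\<in>Basis. dir_deriv (dir_deriv f b) v x *\<^sub>R b)) (at x)"
proof -
  have "Ck_on (Suc k) U (dir_deriv f b)" for b using assms(1) by simp
  from Ck_on_has_derivative[OF this assms(2,3)] show ?thesis
    by (auto intro!: derivative_intros)
qed

lemma frechet_derivative_eq_gradient:
  assumes "Ck_on (Suc k) U f" "open U" "x \<in> U"
  shows "frechet_derivative f (at x) v = (\<Sum>b\<in>Basis. dir_deriv f b x *\<^sub>R b) \<bullet> v"
proof -
  have "linear (frechet_derivative f (at x))"
    using Ck_on_has_derivative[OF assms] has_derivative_linear by blast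
  then have "frechet_derivative f (at x) (\<Sum>b\<in>Basis. (v \<bullet> b) *\<^sub>R b) = (\<Sum>b\<in>Basis. (v \<bullet> b) * dir_deriv f b x)"
    by (simp add: linear_sum linear_scale)
  then have "frechet_derivative f (at x) v = (\<Sum>b\<in>Basis. (v \<bullet> b) * dir_deriv f b x)"
    by (simp only: euclidean_representation)
  then show ?thesis
    by (simp add: inner_sum_left mult.commute inner_commute[of v])
qed

text \<open>The sign is opposite to that of \<open>laplacian\<close>: this is the sum of the second
  derivatives.\<close>

definition euclidean_laplacian :: "('a::euclidean_space \<Rightarrow> real) \<Rightarrow> 'a \<Rightarrow> real" where
  "euclidean_laplacian f x = (\<Sum>b\<in>Basis. dir_deriv (dir_deriv f b) b x)"

lemma tangent_space_UNIV: "tangent_space UNIV (p::'a::euclidean_space) = UNIV"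
proof -
  have "v \<in> tangent_space UNIV p" for v
  proof -
    have "((\<lambda>t. p + t *\<^sub>R v) has_vector_derivative v) (at 0)"
      by (auto intro!: derivative_eq_intros)
    then show ?thesis
      unfolding tangent_space_def by (intro CollectI exI[of _ "\<lambda>t. p + t *\<^sub>R v"]) simp
  qed
  then show ?thesis by blast
qed

lemma laplacian_UNIV:
  assumes "Ck_on (Suc (Suc 0)) UNIV f"
  shows "laplacian UNIV f p = - euclidean_laplacian f p"
proof -
  let ?X = "\<lambda>x. \<Sum>b\<in>Basis. dir_deriv f b x *\<^sub>R b"
  let ?X' = "\<lambda>v. \<Sum>b\<in>Basis. dir_deriv (dir_deriv f b) v p *\<^sub>R b"
  have X': "(?X has_derivative ?X') (at p)"
    by (rule Ck_on_gradient[OF assms]) auto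
  have sub: "subspace (tangent_space UNIV (q::'a))" for q
    by (simp add: tangent_space_UNIV)
  have "laplacian UNIV f p = - (\<Sum>e\<in>orthonormal_frame UNIV p. ?X' e \<bullet> e)"
    by (rule laplacian_eq_trace[OF sub Ck_on_has_derivative[OF assms] refl _
        frechet_derivative_eq_gradient[OF assms] _ X']) (simp_all add: tangent_space_UNIV)
  also have "(\<Sum>e\<in>orthonormal_frame UNIV p. ?X' e \<bullet> e) = (\<Sum>b\<in>Basis. ?X' b \<bullet> b)"
    using orthonormal_frame[OF sub[of p]]
    by (intro sum_orthonormal_basis_trace has_derivative_linear[OF X']) (auto simp: tangent_space_UNIV)
  also have "\<dots> = euclidean_laplacian f p"
    unfolding euclidean_laplacian_def by (intro sum.cong refl) simp
  finally show ?thesis .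
qed

lemma smooth_on_UNIV: "smooth_on_submanifold UNIV f \<longleftrightarrow> (\<forall>k. Ck_on k UNIV f)"
proof -
  have "(\<forall>x. F x = f x) \<longleftrightarrow> F = f" for F by auto
  then show ?thesis unfolding smooth_on_submanifold_def by (auto simp: top.extremum_unique)
qed

lemma has_derivative_imp_line_derivative:
  fixes h :: "'a::euclidean_space \<Rightarrow> real"
  assumes "(h has_derivative D) (at x)"
  shows "((\<lambda>t. h (x + t *\<^sub>R b)) has_field_derivative D b) (at 0)"
proof -
  have "((\<lambda>t. x + t *\<^sub>R b) has_derivative (\<lambda>t. t *\<^sub>R b)) (at 0)"
    by (auto intro!: derivative_eq_intros)
  then have "((\<lambda>t. h (x + t *\<^sub>R b)) has_derivative (\<lambda>t. D (t *\<^sub>R b))) (at 0)"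
    by (rule has_derivative_compose) (use assms in simp)
  then show ?thesis
    using linear_scale[OF has_derivative_linear[OF assms]]
    by (simp add: has_field_derivative_def mult_commute_abs)
qed

section \<open>Fourier analysis on the torus\<close>

text \<open>Phrased through \<open>Basis\<close> so that one theory serves both
  \<open>real ^ 'n\<close> and the product type on which torus times surface lives.\<close>

definition int_lattice :: "'a::euclidean_space set" where
  "int_lattice = {v. \<forall>b\<in>Basis. v \<bullet> b \<in> \<int>}"

definition periodic :: "('a::euclidean_space \<Rightarrow> real) \<Rightarrow> bool" where
  "periodic f \<longleftrightarrow> (\<forall>z\<in>int_lattice. \<forall>x. f (x + z) = f x)"

text \<open>Hartley's function \<open>cas = cos + sin\<close>: the functions \<open>cas v\<close> form a real orthonormal Fourier
  basis indexed by the lattice itself rather than by the lattice modulo sign.\<close>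

definition cas :: "'a::euclidean_space \<Rightarrow> 'a \<Rightarrow> real" where
  "cas v x = cos (2 * pi * (v \<bullet> x)) + sin (2 * pi * (v \<bullet> x))"

lemma int_lattice_add: "u \<in> int_lattice \<Longrightarrow> v \<in> int_lattice \<Longrightarrow> u + v \<in> int_lattice"
  and int_lattice_diff: "u \<in> int_lattice \<Longrightarrow> v \<in> int_lattice \<Longrightarrow> u - v \<in> int_lattice"
  and int_lattice_minus: "u \<in> int_lattice \<Longrightarrow> - u \<in> int_lattice"
  and int_lattice_zero: "0 \<in> int_lattice"
  by (auto simp: int_lattice_def inner_add_left inner_diff_left)

lemma Basis_int_lattice: "b \<in> Basis \<Longrightarrow> b \<in> int_lattice"
  by (auto simp: int_lattice_def inner_Basis)

lemma inner_int_lattice: 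
  assumes "u \<in> int_lattice" "v \<in> int_lattice"
  shows "u \<bullet> v \<in> \<int>"
  using assms by (subst euclidean_inner) (auto simp: int_lattice_def intro!: Ints_sum Ints_mult)

lemma cas_zero [simp]: "cas 0 x = 1"
  by (simp add: cas_def)

lemma periodic_cas: "v \<in> int_lattice \<Longrightarrow> periodic (cas v)"
proof (unfold periodic_def, intro ballI allI)
  fix z x :: 'a assume "v \<in> int_lattice" "z \<in> int_lattice"
  then obtain n where "v \<bullet> z = of_int n" using inner_int_lattice Ints_cases by metis
  then have "2 * pi * (v \<bullet> (x + z)) = 2 * pi * (v \<bullet> x) + 2 * pi * of_int n"
    by (simp add: inner_add_right ring_distribs)
  then show "cas v (x + z) = cas v x"
    using sin_cos_eq_iff[of "2 * pi * (v \<bullet> x) + 2 * pi * of_int n" "2 * pi * (v \<bullet> x)"] by (auto simp: cas_def)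
qed

text \<open>The derivative of cos + sin is cos - sin, the same function at the negated argument. So
  differentiation only exchanges \<open>cas v\<close> and \<open>cas (- v)\<close> up to
  factors.\<close>

lemma cas_has_derivative: "(cas v has_derivative (\<lambda>w. 2 * pi * (v \<bullet> w) * cas (- v) x)) (at x)"
  unfolding cas_def by (auto intro!: derivative_eq_intros simp: algebra_simps)

lemma dir_deriv_cas: "dir_deriv (cas v) w = (\<lambda>x. 2 * pi * (v \<bullet> w) * cas (- v) x)"
  using frechet_derivative_eq[OF cas_has_derivative] by metis

lemma Ck_on_cas: "Ck_on k UNIV (cas v)"
proof (induction k arbitrary: v)
  case 0
  then show ?case by (auto simp: cas_def intro!: continuous_intros)
next
  case (Suc k)
  show ?case
    by (rule Ck_on_SucI[OF open_UNIV cas_has_derivative])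
      (rule Ck_on_mult[OF open_UNIV Ck_on_const[OF open_UNIV] Suc])
qed

abbreviation torus_integral :: "('a::euclidean_space \<Rightarrow> real) \<Rightarrow> real" where
  "torus_integral f \<equiv> integral (cbox 0 One) f"

lemma torus_integrable:
  fixes f :: "'a::euclidean_space \<Rightarrow> real"
  shows "continuous_on UNIV f \<Longrightarrow> f integrable_on cbox 0 One"
  by (rule integrable_continuous) (rule continuous_on_subset, auto)

lemma integral_dir_deriv_periodic:
  assumes h: "Ck_on (Suc 0) UNIV h" "periodic h" and b: "b \<in> Basis"
  shows "torus_integral (dir_deriv h b) = 0"
proof (rule integral_dir_deriv_box[OF b, of 1])
  show "((\<lambda>t. h (x + t *\<^sub>R b)) has_real_derivative dir_deriv h b x) (at 0)" for x
    using has_derivative_imp_line_derivative[OF Ck_on_has_derivative[OF h(1)]] by simp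
  show "continuous_on UNIV h" "continuous_on UNIV (dir_deriv h b)"
    using h(1) Ck_on_continuous[OF h(1)] by simp_all
  show "h (x + ((One - 0) \<bullet> b) *\<^sub>R b) = h x" for x
    using h(2) b Basis_int_lattice[OF b] by (simp add: periodic_def)
qed (use b in simp_all)

lemma periodic_dir_deriv:
  assumes "Ck_on (Suc k) UNIV f" "periodic f"
  shows "periodic (dir_deriv f v)"
proof (unfold periodic_def, intro ballI allI)
  fix z x :: 'a assume z: "z \<in> int_lattice"
  have "((\<lambda>x. x + z) has_derivative (\<lambda>v. v)) (at x)"
    by (auto intro!: derivative_eq_intros)
  then have "((\<lambda>x. f (x + z)) has_derivative (\<lambda>v. frechet_derivative f (at (x + z)) v)) (at x)"
    by (rule has_derivative_compose) (rule Ck_on_has_derivative[OF assms(1)], auto)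
  moreover have "(\<lambda>x. f (x + z)) = f" using assms(2) z by (auto simp: periodic_def)
  ultimately have "frechet_derivative f (at x) = (\<lambda>v. frechet_derivative f (at (x + z)) v)"
    using frechet_derivative_eq by metis
  then show "dir_deriv f v (x + z) = dir_deriv f v x" by metis
qed

text \<open>Green's formula on the torus: two integrations by parts move the Laplacian from
  \<open>f\<close> to \<open>cas w\<close>, which is an eigenfunction.\<close>

lemma torus_integral_laplacian_cas:
  assumes f: "Ck_on (Suc (Suc 0)) UNIV f" "periodic f" and w: "w \<in> int_lattice"
  shows "torus_integral (\<lambda>x. euclidean_laplacian f x * cas w x)
    = - (4 * pi\<^sup>2 * (w \<bullet> w)) * torus_integral (\<lambda>x. f x * cas w x)"
proof -
  have f1: "Ck_on (Suc 0) UNIV (dir_deriv f b)" for b using f(1) by simp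
  have f0: "continuous_on UNIV (dir_deriv (dir_deriv f b) b)" for b using f(1) by simp
  have fc: "continuous_on UNIV f" by (rule Ck_on_continuous[OF f(1)])
  have cc: "continuous_on UNIV (cas w)" by (rule Ck_on_continuous[OF Ck_on_cas])
  have part: "torus_integral (\<lambda>x. dir_deriv (dir_deriv f b) b x * cas w x)
     = - (4 * pi\<^sup>2 * (w \<bullet> b)\<^sup>2) * torus_integral (\<lambda>x. f x * cas w x)" if b: "b \<in> Basis" for b
  proof -
    \<comment> \<open>Both integrations by parts are done at once. In the derivative of
      \<open>h\<close> along \<open>b\<close> the terms with first derivatives of \<open>f\<close>
      cancel, leaving the two integrands to be compared.\<close>
    define h where "h x = dir_deriv f b x * cas w x + (- 2 * pi * (w \<bullet> b)) * (f x * cas (- w) x)" for x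
    have "(h has_derivative (\<lambda>v. (dir_deriv f b x * (2 * pi * (w \<bullet> v) * cas (- w) x) + dir_deriv (dir_deriv f b) v x * cas w x)
        + (- 2 * pi * (w \<bullet> b)) * (f x * (2 * pi * (- w \<bullet> v) * cas (- (- w)) x) + dir_deriv f v x * cas (- w) x))) (at x)" for x
      unfolding h_def
      by (intro has_derivative_add has_derivative_mult has_derivative_mult_right cas_has_derivative
        Ck_on_has_derivative[OF f(1)] Ck_on_has_derivative[OF f1] open_UNIV UNIV_I)
    from frechet_derivative_eq[OF this]
    have hd: "dir_deriv h b x = dir_deriv (dir_deriv f b) b x * cas w x + 4 * pi\<^sup>2 * (w \<bullet> b)\<^sup>2 * (f x * cas w x)" for x
      by (simp add: algebra_simps power2_eq_square)
    have "Ck_on (Suc 0) UNIV h"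
      unfolding h_def
      by (intro Ck_on_add Ck_on_mult Ck_on_const Ck_on_cas f1 open_UNIV Ck_on_Suc_D[OF f(1)])
    moreover have "periodic h"
      using periodic_dir_deriv[OF f, of b] f(2) periodic_cas[OF w] periodic_cas[OF int_lattice_minus[OF w]]
      by (simp add: h_def periodic_def)
    ultimately have "torus_integral (dir_deriv h b) = 0"
      using integral_dir_deriv_periodic b by blast
    then have "torus_integral (\<lambda>x. dir_deriv (dir_deriv f b) b x * cas w x + 4 * pi\<^sup>2 * (w \<bullet> b)\<^sup>2 * (f x * cas w x)) = 0"
      by (simp only: hd)
    moreover have "torus_integral (\<lambda>x. dir_deriv (dir_deriv f b) b x * cas w x + 4 * pi\<^sup>2 * (w \<bullet> b)\<^sup>2 * (f x * cas w x))
      = torus_integral (\<lambda>x. dir_deriv (dir_deriv f b) b x * cas w x) + torus_integral (\<lambda>x. 4 * pi\<^sup>2 * (w \<bullet> b)\<^sup>2 * (f x * cas w x))"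
      by (intro integral_add torus_integrable continuous_intros f0 fc cc)
    ultimately show ?thesis by (simp only: integral_mult_right) simp
  qed
  have "torus_integral (\<lambda>x. euclidean_laplacian f x * cas w x)
    = torus_integral (\<lambda>x. \<Sum>b\<in>Basis. dir_deriv (dir_deriv f b) b x * cas w x)"
    by (simp add: euclidean_laplacian_def sum_distrib_right)
  also have "\<dots> = (\<Sum>b\<in>Basis. torus_integral (\<lambda>x. dir_deriv (dir_deriv f b) b x * cas w x))"
    by (intro integral_sum finite_Basis torus_integrable continuous_intros f0 cc)
  also have "\<dots> = (\<Sum>b\<in>Basis. - (4 * pi\<^sup>2 * (w \<bullet> b)\<^sup>2) * torus_integral (\<lambda>x. f x * cas w x))"
    by (intro sum.cong refl part)
  also have "\<dots> = - (4 * pi\<^sup>2 * (w \<bullet> w)) * torus_integral (\<lambda>x. f x * cas w x)"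
    by (simp add: euclidean_inner[of w w] power2_eq_square sum_distrib_left sum_distrib_right sum_negf mult_ac)
  finally show ?thesis .
qed

text \<open>For nonzero \<open>u\<close>, the function \<open>cas u\<close> is a nonzero multiple of
  a partial derivative of the periodic function \<open>cas (- u)\<close>, so its integral
  vanishes.\<close>

lemma torus_integral_cas:
  assumes u: "u \<in> int_lattice"
  shows "torus_integral (cas u) = (if u = 0 then 1 else 0)"
proof (cases "u = 0")
  case True
  have "torus_integral (\<lambda>x::'a. 1) = 1" by simp
  then show ?thesis using True by (simp add: cas_def[abs_def])
next
  case False
  then obtain b where b: "b \<in> Basis" "u \<bullet> b \<noteq> 0" using euclidean_all_zero_iff by metis
  have "torus_integral (dir_deriv (cas (- u)) b) = 0"
    by (intro integral_dir_deriv_periodic Ck_on_cas periodic_cas int_lattice_minus u b)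
  then have "torus_integral (\<lambda>x. (- 2 * pi * (u \<bullet> b)) * cas u x) = 0"
    by (simp add: dir_deriv_cas)
  then show ?thesis using b False by (simp only: integral_mult_right) simp
qed

lemma cas_mult: "cas v x * cas w x = (cas (v - w) x + cas (w - v) x) / 2 + (cas (v + w) x - cas (- (v + w)) x) / 2"
  unfolding cas_def by (simp add: inner_add_left inner_diff_left sin_add cos_add sin_diff cos_diff field_simps)

text \<open>In the product formula the two terms with \<open>v + w\<close> always have equal
  integrals and cancel. The two terms with \<open>v - w\<close> contribute one half each exactly
  when \<open>v = w\<close>.\<close>

lemma cas_orthonormal:
  assumes "v \<in> int_lattice" "w \<in> int_lattice"
  shows "torus_integral (\<lambda>x. cas v x * cas w x) = (if v = w then 1 else 0)"
proof -
  have i: "(\<lambda>x. cas u x * c) integrable_on cbox 0 One" for u :: 'a and c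
    by (intro torus_integrable continuous_intros Ck_on_continuous[OF Ck_on_cas])
  have "torus_integral (\<lambda>x. cas v x * cas w x) = torus_integral (\<lambda>x. (cas (v - w) x * (1/2) + cas (w - v) x * (1/2))
      + (cas (v + w) x * (1/2) - cas (- (v + w)) x * (1/2)))"
    by (simp add: cas_mult add_divide_distrib diff_divide_distrib)
  also have "\<dots> = (torus_integral (cas (v - w)) * (1/2) + torus_integral (cas (w - v)) * (1/2))
      + (torus_integral (cas (v + w)) * (1/2) - torus_integral (cas (- (v + w))) * (1/2))"
    by (simp only: integral_add integral_diff integral_mult_left i integrable_add integrable_diff)
  also have "\<dots> = (if v = w then 1 else 0)"
    using assms by (simp add: torus_integral_cas int_lattice_add int_lattice_diff int_lattice_minus del: minus_add_distrib)
  finally show ?thesis .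
qed

section \<open>Trigonometric polynomials and their density\<close>

abbreviation trig :: "('a::euclidean_space \<Rightarrow> real) set" where
  "trig \<equiv> real_fun.span (cas ` int_lattice)"

lemma trig_cas: "v \<in> int_lattice \<Longrightarrow> cas v \<in> trig"
  by (rule real_fun.span_base) simp

lemma trig_add: "f \<in> trig \<Longrightarrow> g \<in> trig \<Longrightarrow> (\<lambda>x. f x + g x) \<in> trig"
  using real_fun.span_add[of f _ g] by (simp add: plus_fun_def)

lemma trig_scale: "f \<in> trig \<Longrightarrow> (\<lambda>x. c * f x) \<in> trig"
  using real_fun.span_scale by blast

lemma trig_const: "(\<lambda>x. c) \<in> trig"
  using trig_scale[OF trig_cas[OF int_lattice_zero], of c] by simp

lemma trig_sum: "(\<And>i. i \<in> I \<Longrightarrow> f i \<in> trig) \<Longrightarrow> (\<lambda>x. \<Sum>i\<in>I. f i x) \<in> trig"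
proof (induction I rule: infinite_finite_induct)
  case (insert i I)
  then show ?case using trig_add[of "f i" "\<lambda>x. \<Sum>i\<in>I. f i x"] by simp
qed (auto intro: trig_const)

lemma trig_induct [consumes 1, case_names add scale cas]:
  assumes "q \<in> trig"
    and "\<And>f g. P f \<Longrightarrow> P g \<Longrightarrow> P (\<lambda>x. f x + g x)" "\<And>c f. P f \<Longrightarrow> P (\<lambda>x. c * f x)"
    and "\<And>v. v \<in> int_lattice \<Longrightarrow> P (cas v)"
  shows "P q"
proof -
  have "P (\<lambda>x. 0 * cas 0 x)" by (intro assms int_lattice_zero)
  then have "P 0" by (simp add: zero_fun_def)
  then have "real_fun.subspace {f. P f}"
    using assms(2,3) by (intro real_fun.subspaceI) (auto simp: plus_fun_def)
  moreover have "cas ` int_lattice \<subseteq> {f. P f}" using assms(4) by auto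
  ultimately show ?thesis using real_fun.span_minimal assms(1) by blast
qed

lemma trig_mult:
  assumes "f \<in> trig" "g \<in> trig"
  shows "(\<lambda>x. f x * g x) \<in> trig"
  using assms(1)
proof (induction rule: trig_induct)
  case (cas v)
  from assms(2) show ?case
  proof (induction rule: trig_induct)
    case (cas w)
    have "(\<lambda>x. ((1/2) * cas (v - w) x + (1/2) * cas (w - v) x) + ((1/2) * cas (v + w) x + (-1/2) * cas (- (v + w)) x)) \<in> trig"
      using cas \<open>v \<in> int_lattice\<close>
      by (intro trig_add trig_scale trig_cas int_lattice_add int_lattice_diff int_lattice_minus)
    then show ?case by (simp add: cas_mult add_divide_distrib diff_divide_distrib)
  next
    case (add f g)
    then show ?case using trig_add[OF add] by (simp add: ring_distribs)
  next
    case (scale c f)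
    then show ?case using trig_scale[OF scale, of c] by (simp add: mult_ac)
  qed
next
  case (add f g)
  then show ?case using trig_add[OF add] by (simp add: ring_distribs)
next
  case (scale c f)
  then show ?case using trig_scale[OF scale, of c] by (simp add: mult_ac)
qed

lemma trig_cos_sin:
  assumes "v \<in> int_lattice"
  shows "(\<lambda>x. cos (2 * pi * (v \<bullet> x))) \<in> trig" "(\<lambda>x. sin (2 * pi * (v \<bullet> x))) \<in> trig"
proof -
  have "(\<lambda>x. (1/2) * cas v x + (1/2) * cas (- v) x) \<in> trig" "(\<lambda>x. (1/2) * cas v x + (-1/2) * cas (- v) x) \<in> trig"
    by (intro trig_add trig_scale trig_cas int_lattice_minus assms)+
  moreover have "(\<lambda>x. (1/2) * cas v x + (1/2) * cas (- v) x) = (\<lambda>x. cos (2 * pi * (v \<bullet> x)))"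
    "(\<lambda>x. (1/2) * cas v x + (-1/2) * cas (- v) x) = (\<lambda>x. sin (2 * pi * (v \<bullet> x)))"
    by (auto simp: cas_def field_simps)
  ultimately show "(\<lambda>x. cos (2 * pi * (v \<bullet> x))) \<in> trig" "(\<lambda>x. sin (2 * pi * (v \<bullet> x))) \<in> trig"
    by simp_all
qed

lemma trig_continuous: "q \<in> trig \<Longrightarrow> continuous_on UNIV q"
  by (induction rule: trig_induct) (auto intro!: continuous_intros Ck_on_continuous[OF Ck_on_cas])

lemma trig_orthogonal:
  assumes g: "continuous_on UNIV g" and 0: "\<And>v. v \<in> int_lattice \<Longrightarrow> torus_integral (\<lambda>x. g x * cas v x) = 0"
    and q: "q \<in> trig"
  shows "torus_integral (\<lambda>x. g x * q x) = 0"
proof -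
  \<comment> \<open>Continuity is carried through the induction because it supplies the
    integrability needed to split the integral of a sum.\<close>
  have "continuous_on UNIV q \<and> torus_integral (\<lambda>x. g x * q x) = 0"
    using q
  proof (induction rule: trig_induct)
    case (add p q)
    then have "torus_integral (\<lambda>x. g x * p x + g x * q x) = 0"
      by (subst integral_add) (auto intro!: torus_integrable continuous_intros g)
    then show ?case using add by (auto simp: ring_distribs intro!: continuous_intros)
  next
    case (scale c f)
    have "torus_integral (\<lambda>x. c * (g x * f x)) = 0" using scale by simp
    then show ?case using scale by (auto simp: mult_ac intro!: continuous_intros)
  next
    case (cas v)
    then show ?case using 0 Ck_on_continuous[OF Ck_on_cas] by blast
  qed
  then show ?thesis by blast
qed

text \<open>The standard embedding of the torus as a product of circles, with all cosines in the
  first and all sines in the second component. It turns trigonometric polynomials into restrictions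
  of polynomials.\<close>

definition torus_map :: "'a::euclidean_space \<Rightarrow> 'a \<times> 'a" where
  "torus_map x = (\<Sum>b\<in>Basis. cos (2 * pi * (b \<bullet> x)) *\<^sub>R b, \<Sum>b\<in>Basis. sin (2 * pi * (b \<bullet> x)) *\<^sub>R b)"

lemma torus_map_eq:
  assumes "torus_map x = torus_map y"
  shows "x - y \<in> int_lattice"
  unfolding int_lattice_def
proof (intro CollectI ballI)
  fix b :: 'a assume b: "b \<in> Basis"
  have "fst (torus_map x) \<bullet> b = fst (torus_map y) \<bullet> b" "snd (torus_map x) \<bullet> b = snd (torus_map y) \<bullet> b"
    using assms by simp_all
  then have "cos (2 * pi * (b \<bullet> x)) = cos (2 * pi * (b \<bullet> y))" "sin (2 * pi * (b \<bullet> x)) = sin (2 * pi * (b \<bullet> y))"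
    using b by (simp_all add: torus_map_def)
  then obtain n :: int where "2 * pi * (b \<bullet> x) = 2 * pi * (b \<bullet> y) + 2 * pi * n"
    using sin_cos_eq_iff[of "2 * pi * (b \<bullet> x)" "2 * pi * (b \<bullet> y)"] by auto
  then have "2 * pi * ((x - y) \<bullet> b) = 2 * pi * n" by (simp add: inner_diff_left inner_commute algebra_simps)
  then have "(x - y) \<bullet> b = n" by simp
  then show "(x - y) \<bullet> b \<in> \<int>" by simp
qed

lemma trig_polynomial_torus_map:
  fixes p :: "'a::euclidean_space \<times> 'a \<Rightarrow> real"
  assumes "real_polynomial_function p"
  shows "(\<lambda>x. p (torus_map x)) \<in> trig"
  using assms
proof induction
  case (linear f)
  have "torus_map x = (\<Sum>b\<in>Basis. cos (2 * pi * (b \<bullet> x)) *\<^sub>R (b, 0) + sin (2 * pi * (b \<bullet> x)) *\<^sub>R (0, b))" for x :: 'a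
    by (simp add: torus_map_def prod_eq_iff fst_sum snd_sum)
  then have "f (torus_map x) = (\<Sum>b\<in>Basis. f (b, 0) * cos (2 * pi * (b \<bullet> x)) + f (0, b) * sin (2 * pi * (b \<bullet> x)))" for x
    using bounded_linear.linear[OF linear] by (simp add: linear_sum linear_add linear_scale mult.commute del: scaleR_Pair)
  moreover have "(\<lambda>x. \<Sum>b\<in>Basis. f (b, 0) * cos (2 * pi * (b \<bullet> x)) + f (0, b) * sin (2 * pi * (b \<bullet> x))) \<in> trig"
    by (intro trig_sum trig_add trig_scale trig_cos_sin Basis_int_lattice)
  ultimately show ?case by simp
qed (auto intro: trig_const trig_add trig_mult)

text \<open>A periodic function factors through the embedding of the torus. The induced function
  \<open>h\<close> on the compact image is approximated by a polynomial, which pulls back to a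
  trigonometric polynomial.\<close>

lemma trig_dense:
  assumes g: "continuous_on UNIV g" "periodic g" and e: "0 < e"
  obtains q where "q \<in> trig" "\<And>x. x \<in> cbox 0 One \<Longrightarrow> \<bar>g x - q x\<bar> < e"
proof -
  define K where "K = torus_map ` cbox 0 (One::'a)"
  define h where "h y = g (SOME x. x \<in> cbox 0 One \<and> torus_map x = y)" for y
  have tc: "continuous_on S torus_map" for S :: "'a set"
    unfolding torus_map_def by (intro continuous_intros)
  have hg: "h (torus_map x) = g x" if "x \<in> cbox 0 One" for x
  proof -
    define x' where "x' = (SOME x'. x' \<in> cbox 0 One \<and> torus_map x' = torus_map x)"
    have "torus_map x' = torus_map x"
      using someI[of "\<lambda>x'. x' \<in> cbox 0 One \<and> torus_map x' = torus_map x" x] that unfolding x'_def by blast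
    then have "x' - x \<in> int_lattice" by (rule torus_map_eq)
    then have "g (x + (x' - x)) = g x" using g(2) unfolding periodic_def by blast
    then show ?thesis by (simp add: h_def x'_def)
  qed
  \<comment> \<open>The embedding restricted to the compact cube is a closed map, so the preimage of
    a closed set under \<open>h\<close>, being the image of a closed part of the cube, is
    closed.\<close>
  have hc: "continuous_on K h"
    unfolding continuous_on_closed_vimage[OF compact_imp_closed[OF compact_continuous_image[OF tc compact_cbox]], of 0 One, folded K_def]
  proof (intro allI impI)
    fix B :: "real set" assume "closed B"
    then have "closed (g -` B)" by (rule closed_vimage[OF _ g(1)])
    then have "compact (cbox 0 One \<inter> g -` B)" by (rule compact_Int_closed[OF compact_cbox])
    then have "closed (torus_map ` (cbox 0 One \<inter> g -` B))"
      by (intro compact_imp_closed compact_continuous_image tc)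
    moreover have "h -` B \<inter> K = torus_map ` (cbox 0 One \<inter> g -` B)"
      using hg by (auto simp: K_def)
    ultimately show "closed (h -` B \<inter> K)" by simp
  qed
  have "compact K" unfolding K_def by (intro compact_continuous_image tc compact_cbox)
  then obtain p where p: "real_polynomial_function p" "\<And>y. y \<in> K \<Longrightarrow> \<bar>h y - p y\<bar> < e"
    using Stone_Weierstrass_real_polynomial_function[OF _ hc e] by metis
  have "\<bar>g x - p (torus_map x)\<bar> < e" if "x \<in> cbox 0 One" for x
    using p(2)[of "torus_map x"] hg[OF that] that unfolding K_def by simp
  then show ?thesis
    using that[of "\<lambda>x. p (torus_map x)"] trig_polynomial_torus_map[OF p(1)] by blast
qed

lemma int_lattice_translate_cube:
  obtains z where "z \<in> int_lattice" "x + z \<in> cbox 0 One"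
proof
  let ?z = "\<Sum>b\<in>Basis. (- of_int \<lfloor>x \<bullet> b\<rfloor>) *\<^sub>R b"
  have z: "?z \<bullet> b = - of_int \<lfloor>x \<bullet> b\<rfloor>" if "b \<in> Basis" for b
    using that by (rule inner_sum_left_Basis)
  show "?z \<in> int_lattice" unfolding int_lattice_def using z by auto
  show "x + ?z \<in> cbox 0 One"
    unfolding mem_box
  proof (intro ballI)
    fix b :: 'a assume b: "b \<in> Basis"
    have "(x + ?z) \<bullet> b = x \<bullet> b - of_int \<lfloor>x \<bullet> b\<rfloor>" using z[OF b] by (simp only: inner_add_left)
    moreover have "(0::'a) \<bullet> b = 0" "One \<bullet> b = 1" using b by simp_all
    ultimately show "0 \<bullet> b \<le> (x + ?z) \<bullet> b \<and> (x + ?z) \<bullet> b \<le> One \<bullet> b" by linarith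
  qed
qed

text \<open>If \<open>g\<close> is orthogonal to a trigonometric polynomial \<open>q\<close> with
  \<open>g - q\<close> below \<open>e\<close> in modulus, then the integral of the square of
  \<open>g\<close> equals that of \<open>g * (g - q)\<close> and is at most \<open>e\<close> times
  the integral of the modulus of \<open>g\<close>. Letting \<open>e\<close> shrink makes it
  0.\<close>

lemma periodic_orthogonal_eq_0:
  assumes g: "continuous_on UNIV g" "periodic g"
    and 0: "\<And>v. v \<in> int_lattice \<Longrightarrow> torus_integral (\<lambda>x. g x * cas v x) = 0"
  shows "g x = 0"
proof -
  let ?I = "torus_integral (\<lambda>x. g x * g x)"
  let ?C = "torus_integral (\<lambda>x. \<bar>g x\<bar>)"
  have bound: "?I \<le> e * ?C" if e: "0 < e" for e
  proof -
    obtain q where q: "q \<in> trig" "\<And>x. x \<in> cbox 0 One \<Longrightarrow> \<bar>g x - q x\<bar> < e"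
      using trig_dense[OF g e] by blast
    have qc: "continuous_on UNIV q" by (rule trig_continuous[OF q(1)])
    have "torus_integral (\<lambda>x. g x * q x) = 0" by (rule trig_orthogonal[OF g(1) _ q(1)]) (rule 0)
    then have "?I = ?I - torus_integral (\<lambda>x. g x * q x)" by linarith
    also have "\<dots> = torus_integral (\<lambda>x. g x * g x - g x * q x)"
      by (intro integral_diff[symmetric] torus_integrable continuous_intros g qc)
    also have "\<dots> \<le> torus_integral (\<lambda>x. e * \<bar>g x\<bar>)"
    proof (intro integral_le torus_integrable continuous_intros g qc)
      fix x assume "x \<in> cbox 0 (One::'a)"
      then have "\<bar>g x * (g x - q x)\<bar> \<le> \<bar>g x\<bar> * e"
        using q(2)[of x] unfolding abs_mult by (intro mult_left_mono) auto
      then show "g x * g x - g x * q x \<le> e * \<bar>g x\<bar>"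
        unfolding right_diff_distrib[symmetric] mult.commute[of e] by linarith
    qed
    finally show ?thesis by simp
  qed
  have "?I \<le> 0"
  proof (rule ccontr)
    assume I: "\<not> ?I \<le> 0"
    \<comment> \<open>\<open>P\<close> replaces \<open>?C\<close>, which is not known to be nonzero;
      the choice \<open>e = ?I / (2 * P)\<close> then turns the bound into
      \<open>?I / 2\<close>.\<close>
    obtain P where P: "0 < P" "?C \<le> P" 
    proof
      show "0 < \<bar>?C\<bar> + 1" "?C \<le> \<bar>?C\<bar> + 1" by linarith+
    qed
    define e where "e = ?I / (2 * P)"
    have "0 < e" using I P(1) by (simp add: e_def)
    then have "?I \<le> e * ?C" by (rule bound)
    also have "\<dots> \<le> e * P" using \<open>0 < e\<close> P(2) by (intro mult_left_mono) auto
    also have "\<dots> = ?I / 2" using P(1) by (simp add: e_def)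
    finally show False using I by linarith
  qed
  moreover have "0 \<le> ?I" by (intro integral_nonneg torus_integrable continuous_intros g) simp
  ultimately have "?I = 0" by (rule order_antisym)
  then have "((\<lambda>x. g x * g x) has_integral 0) (cbox 0 One)"
    using integrable_integral[OF torus_integrable[OF continuous_on_mult[OF g(1) g(1)]]] by metis
  moreover have "box 0 (One::'a) \<noteq> {}" by (simp add: box_ne_empty)
  moreover have "continuous_on (cbox 0 One) (\<lambda>x. g x * g x)"
    by (intro continuous_intros continuous_on_subset[OF g(1)]) auto
  ultimately have zero: "g y * g y = 0" if "y \<in> cbox 0 One" for y
    using has_integral_0_cbox_imp_0[of 0 One "\<lambda>x. g x * g x" y] that by auto
  obtain z where "z \<in> int_lattice" "x + z \<in> cbox 0 One" using int_lattice_translate_cube by blast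
  then show ?thesis using zero[of "x + z"] g(2) by (simp add: periodic_def)
qed

section \<open>Multiplicities of torus quotients\<close>

lemma sum_fun_apply: "(\<Sum>i\<in>A. f i) x = (\<Sum>i\<in>A. f i x)"
  by (induction A rule: infinite_finite_induct) auto

text \<open>Meant for finite \<open>I\<close>. Working with a family keeps the coefficients indexed
  by lattice vectors; injectivity of the indexing is a consequence rather than an
  assumption.\<close>

definition independent_family :: "('i \<Rightarrow> 'a \<Rightarrow> real) \<Rightarrow> 'i set \<Rightarrow> bool" where
  "independent_family \<phi> I \<longleftrightarrow> (\<forall>c. (\<forall>x. (\<Sum>i\<in>I. c i * \<phi> i x) = 0) \<longrightarrow> (\<forall>i\<in>I. c i = 0))"

lemma dim_independent_family:
  assumes R: "finite R" and ind: "independent_family \<psi> R"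
  shows "real_fun.dim {f. \<exists>c. f = (\<lambda>x. \<Sum>v\<in>R. c v * \<psi> v x)} = card R" (is "real_fun.dim ?W = _")
proof -
  have W: "\<psi> v \<in> ?W" if "v \<in> R" for v
  proof -
    have "\<psi> v = (\<lambda>x. \<Sum>w\<in>R. (if w = v then 1 else 0) * \<psi> w x)"
      using that R by (auto simp: if_distrib[of "\<lambda>c. c * _"] cong: if_cong)
    then show ?thesis by (intro CollectI exI)
  qed
  have inj: "inj_on \<psi> R"
  proof (rule inj_onI, rule ccontr)
    fix v w assume vw: "v \<in> R" "w \<in> R" "\<psi> v = \<psi> w" "v \<noteq> w"
    have "(\<Sum>i\<in>R. ((if i = v then 1 else 0) - (if i = w then 1 else 0)) * \<psi> i x) = 0" for x
      using vw R by (simp add: left_diff_distrib sum_subtractf if_distrib[of "\<lambda>c. c * _"] cong: if_cong)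
    then have "(if v = v then 1 else 0) - (if v = w then 1 else 0) = (0::real)"
      using ind[unfolded independent_family_def, rule_format, of "\<lambda>i. (if i = v then 1 else 0) - (if i = w then 1 else 0)"] vw(1)
      by blast
    then show False using vw(4) by simp
  qed
  have "real_fun.independent (\<psi> ` R)"
  proof (rule real_fun.independent_if_scalars_zero)
    fix c f assume c: "(\<Sum>f\<in>\<psi> ` R. (\<lambda>x. c f * f x)) = 0" and f: "f \<in> \<psi> ` R"
    have "(\<Sum>v\<in>R. c (\<psi> v) * \<psi> v x) = 0" for x
    proof -
      have "(\<Sum>f\<in>\<psi> ` R. c f * f x) = 0" using fun_cong[OF c, of x] by (simp add: sum_fun_apply)
      then show ?thesis by (simp add: sum.reindex[OF inj])
    qed
    then show "c f = 0" using ind[unfolded independent_family_def, rule_format, of "\<lambda>v. c (\<psi> v)"] f by blast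
  qed (use R in simp)
  moreover have "?W \<subseteq> real_fun.span (\<psi> ` R)"
  proof clarify
    fix c
    have "(\<Sum>v\<in>R. (\<lambda>x. c v * \<psi> v x)) \<in> real_fun.span (\<psi> ` R)"
      by (intro real_fun.span_sum real_fun.span_scale real_fun.span_base) auto
    moreover have "(\<Sum>v\<in>R. (\<lambda>x. c v * \<psi> v x)) = (\<lambda>x. \<Sum>v\<in>R. c v * \<psi> v x)"
      by (auto simp: sum_fun_apply)
    ultimately show "(\<lambda>x. \<Sum>v\<in>R. c v * \<psi> v x) \<in> real_fun.span (\<psi> ` R)" by simp
  qed
  ultimately have "card (\<psi> ` R) = real_fun.dim ?W"
    using W by (intro real_fun.basis_card_eq_dim) auto
  then show ?thesis by (simp add: card_image[OF inj])
qed

text \<open>The invariants of a signed permutation of order two: every two-element orbit and every fixed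
  point of sign \<open>+1\<close> contributes one dimension.\<close>

lemma dim_signed_involution:
  fixes \<phi> :: "'i \<Rightarrow> 'a \<Rightarrow> real"
  assumes S: "finite S" and ind: "independent_family \<phi> S"
    and \<pi>: "\<And>v. v \<in> S \<Longrightarrow> \<pi> v \<in> S" "\<And>v. v \<in> S \<Longrightarrow> \<pi> (\<pi> v) = v"
    and \<epsilon>: "\<And>v. v \<in> S \<Longrightarrow> \<epsilon> v = 1 \<or> \<epsilon> v = -1" "\<And>v. v \<in> S \<Longrightarrow> \<epsilon> (\<pi> v) = \<epsilon> v"
  shows "2 * real_fun.dim {f. \<exists>a. f = (\<lambda>x. \<Sum>v\<in>S. a v * \<phi> v x) \<and> (\<forall>v\<in>S. a (\<pi> v) = \<epsilon> v * a v)}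
     + card {v\<in>S. \<pi> v = v \<and> \<epsilon> v = -1} = card S + card {v\<in>S. \<pi> v = v \<and> \<epsilon> v = 1}"
proof -
  \<comment> \<open>An arbitrary injection into the naturals orders \<open>S\<close>, which singles
    out one representative of each two-element orbit: \<open>P\<close> collects the smaller and
    \<open>P'\<close> the larger elements.\<close>
  obtain g :: "'i \<Rightarrow> nat" where g: "inj_on g S"
    using finite_imp_inj_to_nat_seg[OF S] by blast
  define P where "P = {v\<in>S. g v < g (\<pi> v)}"
  define P' where "P' = {v\<in>S. g (\<pi> v) < g v}"
  define F where "F = {v\<in>S. \<pi> v = v \<and> \<epsilon> v = 1}"
  define F' where "F' = {v\<in>S. \<pi> v = v \<and> \<epsilon> v = -1}"
  \<comment> \<open>\<open>R\<close> indexes a basis of the invariants. The set \<open>F'\<close> is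
    left out: at a fixed point of sign -1 the coefficient equals its own negative.\<close>
  define R where "R = P \<union> F"
  define \<psi> where "\<psi> v x = \<phi> v x + \<epsilon> v * \<phi> (\<pi> v) x" for v x
  have fin: "finite P" "finite P'" "finite F" "finite F'" "finite R"
    using S by (auto simp: P_def P'_def F_def F'_def R_def)
  have RS: "R \<subseteq> S" by (auto simp: R_def P_def F_def)
  have fixg: "\<pi> v = v" if "v \<in> S" "\<not> g v < g (\<pi> v)" "\<not> g (\<pi> v) < g v" for v
    using g \<pi>(1)[OF that(1)] that by (auto simp: inj_on_def)
  have bij: "bij_betw \<pi> S S"
    by (rule bij_betw_byWitness[of _ \<pi>]) (use \<pi> in auto)
  have "bij_betw \<pi> P P'"
    by (rule bij_betw_byWitness[of _ \<pi>]) (use \<pi> in \<open>auto simp: P_def P'_def\<close>)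
  then have PP': "card P = card P'" by (rule bij_betw_same_card)
  have "S = P \<union> P' \<union> F \<union> F'"
    using fixg \<epsilon>(1) by (auto simp: P_def P'_def F_def F'_def)
  moreover have "P \<inter> P' = {}" "(P \<union> P') \<inter> F = {}" "(P \<union> P' \<union> F) \<inter> F' = {}"
    by (auto simp: P_def P'_def F_def F'_def)
  ultimately have cS: "card S = card P + card P' + card F + card F'"
    using fin by (simp add: card_Un_disjoint)
  have cR: "card R = card P + card F"
    unfolding R_def by (rule card_Un_disjoint) (use fin in \<open>auto simp: P_def F_def\<close>)
  have expand: "(\<Sum>v\<in>R. c v * \<psi> v x) =
      (\<Sum>w\<in>S. ((if w \<in> R then c w else 0) + (if \<pi> w \<in> R then \<epsilon> w * c (\<pi> w) else 0)) * \<phi> w x)" for c x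
  proof -
    have "(\<Sum>v\<in>R. c v * \<psi> v x) = (\<Sum>v\<in>S. if v \<in> R then c v * \<psi> v x else 0)"
      using S RS by (simp add: sum.If_cases Int_absorb1)
    also have "\<dots> = (\<Sum>v\<in>S. (if v \<in> R then c v else 0) * \<phi> v x) + (\<Sum>v\<in>S. (if v \<in> R then \<epsilon> v * c v else 0) * \<phi> (\<pi> v) x)"
      unfolding sum.distrib[symmetric] by (intro sum.cong refl) (simp add: \<psi>_def algebra_simps)
    also have "(\<Sum>v\<in>S. (if v \<in> R then \<epsilon> v * c v else 0) * \<phi> (\<pi> v) x)
       = (\<Sum>w\<in>S. (if \<pi> w \<in> R then \<epsilon> (\<pi> w) * c (\<pi> w) else 0) * \<phi> (\<pi> (\<pi> w)) x)"
      by (rule sum.reindex_bij_betw[OF bij, symmetric])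
    also have "\<dots> = (\<Sum>w\<in>S. (if \<pi> w \<in> R then \<epsilon> w * c (\<pi> w) else 0) * \<phi> w x)"
      using \<pi> \<epsilon> by (intro sum.cong refl) simp
    finally show ?thesis by (simp add: sum.distrib ring_distribs)
  qed
  have notR: "\<pi> w \<notin> R" if "w \<in> P" for w
    using that \<pi> by (auto simp: R_def P_def F_def)
  have fixR: "\<pi> w = w" "\<epsilon> w = 1" if "w \<in> F" for w using that by (auto simp: F_def)
  have "independent_family \<psi> R"
    unfolding independent_family_def
  proof (intro allI impI ballI)
    fix c w assume 0: "\<forall>x. (\<Sum>v\<in>R. c v * \<psi> v x) = 0" and w: "w \<in> R"
    have "(if w \<in> R then c w else 0) + (if \<pi> w \<in> R then \<epsilon> w * c (\<pi> w) else 0) = 0"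
      using ind[unfolded independent_family_def, rule_format, of "\<lambda>w. (if w \<in> R then c w else 0) + (if \<pi> w \<in> R then \<epsilon> w * c (\<pi> w) else 0)" w]
        0 w RS unfolding expand by blast
    moreover have "w \<in> P \<or> w \<in> F" using w by (simp add: R_def)
    ultimately show "c w = 0" using notR[of w] fixR[of w] w by auto
  qed
  then have "real_fun.dim {f. \<exists>c. f = (\<lambda>x. \<Sum>v\<in>R. c v * \<psi> v x)} = card R"
    using dim_independent_family fin(5) by blast
  moreover have "{f. \<exists>c. f = (\<lambda>x. \<Sum>v\<in>R. c v * \<psi> v x)}
     = {f. \<exists>a. f = (\<lambda>x. \<Sum>v\<in>S. a v * \<phi> v x) \<and> (\<forall>v\<in>S. a (\<pi> v) = \<epsilon> v * a v)}" (is "?L = ?W")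
  proof (intro set_eqI iffI)
    fix f assume "f \<in> ?L"
    then obtain c where c: "f = (\<lambda>x. \<Sum>v\<in>R. c v * \<psi> v x)" by blast
    define a where "a w = (if w \<in> R then c w else 0) + (if \<pi> w \<in> R then \<epsilon> w * c (\<pi> w) else 0)" for w
    have "f = (\<lambda>x. \<Sum>v\<in>S. a v * \<phi> v x)" unfolding c expand a_def ..
    moreover have "a (\<pi> v) = \<epsilon> v * a v" if "v \<in> S" for v
      using \<epsilon>[OF that] \<pi>[OF that] by (auto simp: a_def)
    ultimately show "f \<in> ?W" by blast
  next
    fix f assume "f \<in> ?W"
    then obtain a where a: "f = (\<lambda>x. \<Sum>v\<in>S. a v * \<phi> v x)" "\<And>v. v \<in> S \<Longrightarrow> a (\<pi> v) = \<epsilon> v * a v" by blast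
    \<comment> \<open>At a fixed point of sign +1 the symmetrised function \<psi> is twice \<phi>,
      hence the factor one half.\<close>
    define c where "c v = (if v \<in> F then a v / 2 else a v)" for v
    have "(if w \<in> R then c w else 0) + (if \<pi> w \<in> R then \<epsilon> w * c (\<pi> w) else 0) = a w" if w: "w \<in> S" for w
    proof -
      consider "w \<in> P" | "w \<in> P'" | "w \<in> F" | "w \<in> F'" using w \<open>S = _\<close> by blast
      then show ?thesis
      proof cases
        case 1
        then have "w \<notin> F" by (auto simp: P_def F_def)
        then show ?thesis using 1 notR[OF 1] by (simp add: R_def c_def)
      next
        case 2
        then have "\<pi> w \<in> P" "\<pi> w \<notin> F" "w \<notin> R" using \<pi>[OF w] by (auto simp: P_def P'_def F_def R_def)
        then show ?thesis using a(2)[OF w] \<epsilon>(1)[OF w] by (auto simp: R_def c_def)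
      next
        case 3
        then show ?thesis using fixR[OF 3] by (simp add: R_def c_def)
      next
        case 4
        then have "w \<notin> R" "\<pi> w = w" "\<epsilon> w = -1" by (auto simp: F'_def R_def P_def F_def)
        then show ?thesis using a(2)[OF w] by simp
      qed
    qed
    then have "f = (\<lambda>x. \<Sum>v\<in>R. c v * \<psi> v x)" unfolding expand a(1) by simp
    then show "f \<in> ?L" by blast
  qed
  \<comment> \<open>The dimension is \<open>card P + card F\<close>, while \<open>card S\<close> is
    twice \<open>card P\<close> plus \<open>card F + card F'\<close>. Doubling and adding
    \<open>card F'\<close> avoids division and subtraction.\<close>
  ultimately show ?thesis using cS cR PP' unfolding F_def F'_def by simp
qed

section \<open>Eigenfunctions on the torus as finite Fourier sums\<close>

abbreviation lattice_sphere :: "real \<Rightarrow> 'a::euclidean_space set" where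
  "lattice_sphere r \<equiv> {v \<in> int_lattice. v \<bullet> v = r}"

lemma torus_integral_cas_sum:
  assumes S: "finite S" "S \<subseteq> int_lattice" and w: "w \<in> int_lattice"
  shows "torus_integral (\<lambda>x. (\<Sum>v\<in>S. a v * cas v x) * cas w x) = (if w \<in> S then a w else 0)"
proof -
  have "torus_integral (\<lambda>x. (\<Sum>v\<in>S. a v * cas v x) * cas w x) = torus_integral (\<lambda>x. \<Sum>v\<in>S. a v * (cas v x * cas w x))"
    by (simp add: sum_distrib_right mult.assoc)
  also have "\<dots> = (\<Sum>v\<in>S. torus_integral (\<lambda>x. a v * (cas v x * cas w x)))"
    by (intro integral_sum S torus_integrable continuous_intros Ck_on_continuous[OF Ck_on_cas])
  also have "\<dots> = (\<Sum>v\<in>S. if v = w then a v else 0)"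
    using S(2) w by (intro sum.cong refl) (auto simp: cas_orthonormal subsetD)
  finally show ?thesis using S(1) by simp
qed

lemma independent_family_cas:
  assumes "finite S" "S \<subseteq> int_lattice"
  shows "independent_family cas S"
  unfolding independent_family_def
proof (intro allI impI ballI)
  fix c w assume "\<forall>x. (\<Sum>v\<in>S. c v * cas v x) = 0" "w \<in> S"
  then show "c w = 0" using torus_integral_cas_sum[OF assms, of w c] assms(2) by auto
qed

lemma Ck_on_cas_sum: "Ck_on k UNIV (\<lambda>x. \<Sum>v\<in>S. a v * cas v x)"
  by (intro Ck_on_sum Ck_on_mult Ck_on_const Ck_on_cas open_UNIV)

lemma periodic_cas_sum: "S \<subseteq> int_lattice \<Longrightarrow> periodic (\<lambda>x. \<Sum>v\<in>S. a v * cas v x)"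
  unfolding periodic_def
proof (intro ballI allI sum.cong refl)
  fix z x v :: 'a assume "S \<subseteq> int_lattice" "z \<in> int_lattice" "v \<in> S"
  then show "a v * cas v (x + z) = a v * cas v x" using periodic_cas[of v] unfolding periodic_def by auto
qed

text \<open>The parameter \<sigma> allows a second use on the result of the first: one derivative
  replaces \<open>cas v\<close> by \<open>cas (- v)\<close>, so the second derivative is the
  instance with \<open>uminus\<close>.\<close>

lemma dir_deriv_cas_sum:
  "dir_deriv (\<lambda>x. \<Sum>v\<in>S. a v * cas (\<sigma> v) x) w x = (\<Sum>v\<in>S. (a v * (2 * pi * (\<sigma> v \<bullet> w))) * cas (- \<sigma> v) x)"
proof -
  have "((\<lambda>x. \<Sum>v\<in>S. a v * cas (\<sigma> v) x) has_derivative (\<lambda>w. \<Sum>v\<in>S. a v * (2 * pi * (\<sigma> v \<bullet> w) * cas (- \<sigma> v) x))) (at x)"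
    by (intro has_derivative_sum has_derivative_mult_right cas_has_derivative)
  from frechet_derivative_eq[OF this] show ?thesis by (simp add: mult.assoc)
qed

lemma euclidean_laplacian_cas_sum:
  assumes "\<And>v. v \<in> S \<Longrightarrow> v \<bullet> v = r"
  shows "euclidean_laplacian (\<lambda>x. \<Sum>v\<in>S. a v * cas v x) x = - (4 * pi\<^sup>2 * r) * (\<Sum>v\<in>S. a v * cas v x)"
proof -
  have "euclidean_laplacian (\<lambda>x. \<Sum>v\<in>S. a v * cas v x) x
    = (\<Sum>b\<in>Basis. \<Sum>v\<in>S. - (4 * pi\<^sup>2) * ((v \<bullet> b) * (v \<bullet> b)) * (a v * cas v x))"
    unfolding euclidean_laplacian_def
    unfolding dir_deriv_cas_sum[where \<sigma> = "\<lambda>v. v"] dir_deriv_cas_sum[where \<sigma> = uminus]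
    by (intro sum.cong refl) (simp add: power2_eq_square)
  also have "\<dots> = (\<Sum>v\<in>S. - (4 * pi\<^sup>2) * (v \<bullet> v) * (a v * cas v x))"
    by (subst sum.swap, intro sum.cong refl)
      (simp only: sum_distrib_left[symmetric] sum_distrib_right[symmetric] euclidean_inner[symmetric])
  also have "\<dots> = - (4 * pi\<^sup>2 * r) * (\<Sum>v\<in>S. a v * cas v x)"
    unfolding sum_distrib_left using assms by (intro sum.cong refl) simp
  finally show ?thesis .
qed

text \<open>Green's formula compares two eigenvalues, so the Fourier coefficient of \<open>f\<close>
  vanishes at every lattice vector off the sphere of squared length \<open>r\<close>. Hence
  \<open>f\<close> minus the finite sum is orthogonal to all \<open>cas w\<close>, and completeness
  makes it 0.\<close>

lemma torus_eigenfunction_expansion: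
  assumes f: "Ck_on (Suc (Suc 0)) UNIV f" "periodic f"
    and eig: "\<And>x. euclidean_laplacian f x = - (4 * pi\<^sup>2 * r) * f x"
    and S: "finite (lattice_sphere r :: 'a::euclidean_space set)"
  shows "f = (\<lambda>x. \<Sum>v\<in>lattice_sphere r. torus_integral (\<lambda>x. f x * cas v x) * cas (v::'a) x)"
proof
  fix x
  define a where "a v = torus_integral (\<lambda>x. f x * cas v x)" for v
  define s where "s x = (\<Sum>v\<in>lattice_sphere r. a v * cas (v::'a) x)" for x
  have fc: "continuous_on UNIV f" by (rule Ck_on_continuous[OF f(1)])
  have sc: "continuous_on UNIV s" unfolding s_def by (rule Ck_on_continuous[OF Ck_on_cas_sum[of 0]])
  have "f x - s x = 0"
  proof (rule periodic_orthogonal_eq_0[where g = "\<lambda>x. f x - s x"])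
    show "continuous_on UNIV (\<lambda>x. f x - s x)" by (intro continuous_intros fc sc)
    show "periodic (\<lambda>x. f x - s x)"
      using f(2) periodic_cas_sum[of "lattice_sphere r" a] by (auto simp: periodic_def s_def)
    fix w :: 'a assume w: "w \<in> int_lattice"
    have "torus_integral (\<lambda>x. (f x - s x) * cas w x) = torus_integral (\<lambda>x. f x * cas w x - s x * cas w x)"
      by (simp add: left_diff_distrib)
    also have "\<dots> = a w - torus_integral (\<lambda>x. s x * cas w x)"
      unfolding a_def
      by (intro integral_diff torus_integrable continuous_intros fc sc Ck_on_continuous[OF Ck_on_cas])
    also have "\<dots> = a w - (if w \<in> lattice_sphere r then a w else 0)"
      unfolding s_def by (subst torus_integral_cas_sum[OF S _ w]) auto
    also have "\<dots> = 0"
    proof (cases "w \<bullet> w = r")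
      case False
      have "- (4 * pi\<^sup>2 * r) * a w = torus_integral (\<lambda>x. (- (4 * pi\<^sup>2 * r)) * (f x * cas w x))"
        unfolding a_def by (simp only: integral_mult_right)
      also have "\<dots> = torus_integral (\<lambda>x. euclidean_laplacian f x * cas w x)"
        unfolding eig by (simp only: mult.assoc)
      also have "\<dots> = - (4 * pi\<^sup>2 * (w \<bullet> w)) * a w"
        unfolding a_def by (rule torus_integral_laplacian_cas[OF f w])
      finally have "a w = 0" using False by simp
      then show ?thesis by simp
    qed (use w in simp)
    finally show "torus_integral (\<lambda>x. (f x - s x) * cas w x) = 0" .
  qed
  then show "f x = (\<Sum>v\<in>lattice_sphere r. torus_integral (\<lambda>x. f x * cas v x) * cas v x)"
    by (simp add: s_def a_def)
qed

text \<open>The map \<open>\<pi>\<close> is the transpose of the linear part of \<open>\<tau>\<close>; the sign \<open>\<epsilon>\<close> comes from its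
  translation part.\<close>

lemma multiplicity_torus_quotient:
  fixes Q :: "'a::euclidean_space quotient_presentation"
  assumes Q: "fst Q = UNIV"
    "\<And>f::'a \<Rightarrow> real. (\<forall>g\<in>snd Q. \<forall>x. f (g x) = f x) \<longleftrightarrow> periodic f \<and> (\<forall>x. f (\<tau> x) = f x)"
    and \<pi>: "\<And>v. v \<in> int_lattice \<Longrightarrow> \<pi> v \<in> int_lattice" "\<And>v. \<pi> v \<bullet> \<pi> v = v \<bullet> v" "\<And>v. \<pi> (\<pi> v) = v"
    and \<epsilon>: "\<And>v. \<epsilon> v = 1 \<or> \<epsilon> v = -1" "\<And>v. \<epsilon> (\<pi> v) = \<epsilon> v"
    and cas: "\<And>v x. v \<in> int_lattice \<Longrightarrow> cas v (\<tau> x) = \<epsilon> v * cas (\<pi> v) x"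
    and fin: "finite (lattice_sphere r :: 'a set)"
  shows "2 * multiplicity_0 Q (4 * pi\<^sup>2 * r) + card {v \<in> lattice_sphere r. \<pi> v = v \<and> \<epsilon> v = -1}
    = card (lattice_sphere r :: 'a set) + card {v \<in> lattice_sphere r. \<pi> v = v \<and> \<epsilon> v = 1}"
proof -
  let ?S = "lattice_sphere r :: 'a set"
  have \<pi>S: "\<pi> v \<in> ?S" if "v \<in> ?S" for v using that \<pi> by auto
  have bij: "bij_betw \<pi> ?S ?S"
    by (rule bij_betw_byWitness[of _ \<pi>]) (use \<pi> in auto)
  have SL: "?S \<subseteq> int_lattice" by auto
  note ind = independent_family_cas[OF fin SL]
  have act: "(\<Sum>v\<in>?S. a v * cas v (\<tau> x)) = (\<Sum>w\<in>?S. (\<epsilon> w * a (\<pi> w)) * cas w x)" for a x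
  proof -
    have "(\<Sum>v\<in>?S. a v * cas v (\<tau> x)) = (\<Sum>v\<in>?S. (\<epsilon> v * a v) * cas (\<pi> v) x)"
      using cas by (intro sum.cong refl) auto
    also have "\<dots> = (\<Sum>w\<in>?S. (\<epsilon> (\<pi> w) * a (\<pi> w)) * cas (\<pi> (\<pi> w)) x)"
      by (rule sum.reindex_bij_betw[OF bij, symmetric])
    finally show ?thesis by (simp add: \<pi> \<epsilon>)
  qed
  have lap: "(\<forall>p. laplacian UNIV f p = 4 * pi\<^sup>2 * r * f p) \<longleftrightarrow> (\<forall>x. euclidean_laplacian f x = - (4 * pi\<^sup>2 * r) * f x)"
    if "\<And>k. Ck_on k UNIV f" for f :: "'a \<Rightarrow> real"
    unfolding laplacian_UNIV[OF that] by (intro all_cong1) (simp, linarith)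
  have "eigenspace Q (4 * pi\<^sup>2 * r) = {f. \<exists>a. f = (\<lambda>x. \<Sum>v\<in>?S. a v * cas v x) \<and> (\<forall>v\<in>?S. a (\<pi> v) = \<epsilon> v * a v)}"
    (is "_ = ?W")
  proof (intro set_eqI iffI)
    fix f assume "f \<in> eigenspace Q (4 * pi\<^sup>2 * r)"
    then have f: "\<And>k. Ck_on k UNIV f" "periodic f" "\<And>x. f (\<tau> x) = f x"
      "\<And>x. euclidean_laplacian f x = - (4 * pi\<^sup>2 * r) * f x"
      using Q lap[of f] unfolding eigenspace_def smooth_on_UNIV by (simp_all add: smooth_on_UNIV)
    define a where "a v = torus_integral (\<lambda>x. f x * cas v x)" for v
    have fa: "f = (\<lambda>x. \<Sum>v\<in>?S. a v * cas v x)"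
      unfolding a_def by (rule torus_eigenfunction_expansion[OF f(1,2,4) fin])
    have "a (\<pi> v) = \<epsilon> v * a v" if v: "v \<in> ?S" for v
    proof -
      have "(\<Sum>w\<in>?S. (\<epsilon> w * a (\<pi> w) - a w) * cas w x) = 0" for x
      proof -
        have "(\<Sum>w\<in>?S. (\<epsilon> w * a (\<pi> w)) * cas w x) = (\<Sum>v\<in>?S. a v * cas v x)"
          using f(3)[of x] unfolding act[symmetric] by (simp add: fun_cong[OF fa])
        then show ?thesis by (simp add: left_diff_distrib sum_subtractf)
      qed
      then have "\<epsilon> v * a (\<pi> v) - a v = 0"
        using ind[unfolded independent_family_def, rule_format, of "\<lambda>w. \<epsilon> w * a (\<pi> w) - a w", OF _ v] by blast
      then show ?thesis using \<epsilon>(1)[of v] by auto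
    qed
    with fa show "f \<in> ?W" by blast
  next
    fix f assume "f \<in> ?W"
    then obtain a where a: "f = (\<lambda>x. \<Sum>v\<in>?S. a v * cas v x)" "\<And>v. v \<in> ?S \<Longrightarrow> a (\<pi> v) = \<epsilon> v * a v" by blast
    have C: "Ck_on k UNIV f" for k unfolding a(1) by (rule Ck_on_cas_sum)
    have "periodic f" unfolding a(1) by (rule periodic_cas_sum[OF SL])
    moreover have "f (\<tau> x) = f x" for x
    proof -
      have "f (\<tau> x) = (\<Sum>w\<in>?S. (\<epsilon> w * a (\<pi> w)) * cas w x)" unfolding a(1) by (rule act)
      also have "\<dots> = f x"
        unfolding a(1)
      proof (intro sum.cong refl)
        fix w assume "w \<in> ?S"
        then show "(\<epsilon> w * a (\<pi> w)) * cas w x = a w * cas w x" using a(2)[of w] \<epsilon>(1)[of w] by auto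
      qed
      finally show ?thesis .
    qed
    moreover have "\<forall>x. euclidean_laplacian f x = - (4 * pi\<^sup>2 * r) * f x"
      unfolding a(1) by (intro allI euclidean_laplacian_cas_sum) auto
    ultimately show "f \<in> eigenspace Q (4 * pi\<^sup>2 * r)"
      using Q C lap[OF C] unfolding eigenspace_def by (simp add: smooth_on_UNIV)
  qed
  then show ?thesis
    using dim_signed_involution[where \<pi> = \<pi> and \<epsilon> = \<epsilon>, OF fin ind \<pi>S \<pi>(3) \<epsilon>]
    by (simp add: multiplicity_0_def)
qed

section \<open>Counting lattice vectors of squared length below 4\<close>

definition lattice_sphere_in :: "'a::euclidean_space set \<Rightarrow> real \<Rightarrow> 'a set" where
  "lattice_sphere_in B r = {v \<in> int_lattice. (\<forall>b\<in>Basis - B. v \<bullet> b = 0) \<and> v \<bullet> v = r}"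

lemma lattice_sphere_eq: "lattice_sphere r = lattice_sphere_in Basis r"
  by (auto simp: lattice_sphere_in_def)

lemma Ints_square_less_4:
  assumes "j \<in> \<int>" "j\<^sup>2 < (4::real)"
  shows "j = 0 \<or> j = 1 \<or> j = -1"
proof -
  obtain n where n: "j = of_int n" using assms(1) Ints_cases by blast
  have "\<bar>j\<bar> < 2" using assms(2) abs_less_iff power2_less_imp_less[of "\<bar>j\<bar>" 2] by simp
  then have "\<bar>n\<bar> < 2" using n by linarith
  then have "n = 0 \<or> n = 1 \<or> n = -1" by linarith
  then show ?thesis using n by auto
qed

text \<open>Below squared length 4 every coordinate is -1, 0 or 1, so a new axis splits the set into
  three pieces. Restricting the support to a set of axes makes this recursion possible and also
  describes the vectors fixed by a reflection.\<close>

lemma lattice_sphere_in_insert: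
  assumes b: "b \<in> Basis" "b \<notin> B" and r: "r < 4"
  shows "lattice_sphere_in (insert b B) r = lattice_sphere_in B r \<union>
     ((\<lambda>v. v + b) ` lattice_sphere_in B (r - 1) \<union> (\<lambda>v. v - b) ` lattice_sphere_in B (r - 1))"
    (is "?L = ?R")
proof -
  have bb: "b \<bullet> b = 1" and bc: "\<And>c. c \<in> Basis - insert b B \<Longrightarrow> b \<bullet> c = 0"
    using b by (auto simp: inner_Basis)
  have shift: "v + j *\<^sub>R b \<in> lattice_sphere_in (insert b B) r \<and> (v + j *\<^sub>R b) \<bullet> b = j"
    if "v \<in> lattice_sphere_in B (r - j\<^sup>2)" "j \<in> \<int>" for v j
  proof -
    have v: "v \<in> int_lattice" "\<And>c. c \<in> Basis - B \<Longrightarrow> v \<bullet> c = 0" "v \<bullet> v = r - j\<^sup>2"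
      using that by (auto simp: lattice_sphere_in_def)
    have vb: "v \<bullet> b = 0" using v(2) b by blast
    have "v + j *\<^sub>R b \<in> int_lattice"
      using v(1) that(2) Basis_int_lattice[OF b(1)] by (auto simp: int_lattice_def inner_add_left)
    moreover have "(v + j *\<^sub>R b) \<bullet> c = 0" if "c \<in> Basis - insert b B" for c
      using v(2)[of c] bc[OF that] that by (simp add: inner_add_left)
    moreover have "(v + j *\<^sub>R b) \<bullet> (v + j *\<^sub>R b) = r"
      using v(3) vb bb by (simp add: inner_add_left inner_add_right inner_commute[of b v] power2_eq_square)
    ultimately show ?thesis using vb bb by (simp add: lattice_sphere_in_def inner_add_left)
  qed
  have "?R \<subseteq> ?L"
    using shift[where j = 0] shift[where j = 1] shift[where j = "-1"] by auto
  moreover have "v \<in> ?R" if v: "v \<in> ?L" for v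
  proof -
    define j where "j = v \<bullet> b"
    define w where "w = v - j *\<^sub>R b"
    have j: "j \<in> \<int>" using v b by (auto simp: j_def lattice_sphere_in_def int_lattice_def)
    have wb: "w \<bullet> b = 0" using bb by (simp add: w_def inner_diff_left j_def)
    have ww: "w \<bullet> w = r - j\<^sup>2"
      using v bb by (simp add: w_def inner_diff_left inner_diff_right lattice_sphere_in_def j_def inner_commute[of b v] power2_eq_square)
    then have "j\<^sup>2 < 4" using r inner_ge_zero[of w] by linarith
    then have "j = 0 \<or> j = 1 \<or> j = -1" using j Ints_square_less_4 by blast
    moreover have "w \<in> lattice_sphere_in B (r - j\<^sup>2)"
    proof -
      have "w \<in> int_lattice"
        using v j Basis_int_lattice[OF b(1)] by (auto simp: w_def int_lattice_def inner_diff_left lattice_sphere_in_def)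
      moreover have "w \<bullet> c = 0" if "c \<in> Basis - B" for c
      proof (cases "c = b")
        case False
        then have "c \<in> Basis - insert b B" using that by blast
        then show ?thesis using v bc by (simp add: w_def inner_diff_left lattice_sphere_in_def)
      qed (use wb in simp)
      ultimately show ?thesis using ww by (simp add: lattice_sphere_in_def)
    qed
    moreover have v: "v = w + j *\<^sub>R b" by (simp add: w_def)
    ultimately show ?thesis
    proof (elim disjE)
      assume "j = 1" "w \<in> lattice_sphere_in B (r - j\<^sup>2)"
      then show ?thesis using v by (intro UnI2 UnI1 image_eqI[of _ _ w]) simp_all
    next
      assume "j = -1" "w \<in> lattice_sphere_in B (r - j\<^sup>2)"
      then show ?thesis using v by (intro UnI2 image_eqI[of _ _ w]) simp_all
    qed (use v in simp)
  qed
  ultimately show ?thesis by blast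
qed

lemma finite_lattice_sphere_in:
  fixes B :: "'a::euclidean_space set"
  assumes "B \<subseteq> Basis" "r < 4"
  shows "finite (lattice_sphere_in B r)"
proof -
  have "finite B" using assms(1) finite_Basis by (rule finite_subset)
  then show ?thesis using assms
  proof (induction B arbitrary: r)
    case empty
    have "lattice_sphere_in {} r \<subseteq> {0::'a}"
      by (auto simp: lattice_sphere_in_def euclidean_all_zero_iff)
    then show ?case by (rule finite_subset) simp
  next
    case (insert b B)
    then show ?case by (subst lattice_sphere_in_insert) auto
  qed
qed

lemma card_lattice_sphere_in_insert:
  assumes b: "b \<in> Basis" "b \<notin> B" and B: "B \<subseteq> Basis" and r: "r < 4"
  shows "card (lattice_sphere_in (insert b B) r) = card (lattice_sphere_in B r) + 2 * card (lattice_sphere_in B (r - 1))"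
proof -
  have bb: "b \<bullet> b = 1" using b by simp
  have vb: "v \<bullet> b = 0" if "v \<in> lattice_sphere_in B s" for v s
    using that b by (auto simp: lattice_sphere_in_def)
  let ?P = "(\<lambda>v. v + b) ` lattice_sphere_in B (r - 1)"
  let ?M = "(\<lambda>v. v - b) ` lattice_sphere_in B (r - 1)"
  have "v \<bullet> b = 1" if "v \<in> ?P" for v using that vb bb by (auto simp: inner_add_left)
  moreover have "v \<bullet> b = -1" if "v \<in> ?M" for v using that vb bb by (auto simp: inner_diff_left)
  ultimately have "lattice_sphere_in B r \<inter> (?P \<union> ?M) = {}" "?P \<inter> ?M = {}"
    using vb by fastforce+
  moreover have "finite (lattice_sphere_in B r)" "finite (lattice_sphere_in B (r - 1))"
    using finite_lattice_sphere_in[OF B] r by simp_all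
  moreover have "card ?P = card (lattice_sphere_in B (r - 1))" "card ?M = card (lattice_sphere_in B (r - 1))"
    by (auto intro!: card_image inj_onI)
  ultimately show ?thesis
    by (simp add: lattice_sphere_in_insert[OF b r] card_Un_disjoint)
qed

lemma card_lattice_sphere_in_0: "card (lattice_sphere_in B 0) = 1"
proof -
  have "lattice_sphere_in B 0 = {0::'a}" by (auto simp: lattice_sphere_in_def int_lattice_zero)
  then show ?thesis by simp
qed

lemma card_lattice_sphere_in_1: "B \<subseteq> Basis \<Longrightarrow> card (lattice_sphere_in B 1) = 2 * card B"
proof -
  assume B: "B \<subseteq> (Basis::'a set)"
  then have "finite B" using finite_Basis by (rule finite_subset)
  then show ?thesis using B
  proof (induction B)
    case empty
    have "lattice_sphere_in {} 1 = ({}::'a set)"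
      by (auto simp: lattice_sphere_in_def euclidean_all_zero_iff)
    then show ?case by simp
  next
    case (insert b B)
    then show ?case by (simp add: card_lattice_sphere_in_insert card_lattice_sphere_in_0)
  qed
qed

text \<open>Such a vector is a choice of two axes and two signs. For empty \<open>B\<close> the
  truncated \<open>card B - 1\<close> is multiplied by 0.\<close>

lemma card_lattice_sphere_in_2: "B \<subseteq> Basis \<Longrightarrow> card (lattice_sphere_in B 2) = 2 * card B * (card B - 1)"
proof -
  assume B: "B \<subseteq> (Basis::'a set)"
  then have "finite B" using finite_Basis by (rule finite_subset)
  then show ?thesis using B
  proof (induction B)
    case empty
    have "lattice_sphere_in {} 2 = ({}::'a set)"
      by (auto simp: lattice_sphere_in_def euclidean_all_zero_iff)
    then show ?case by simp
  next
    case (insert b B)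
    then show ?case
      by (cases "card B") (simp_all add: card_lattice_sphere_in_insert card_lattice_sphere_in_1)
  qed
qed

text \<open>Presentations are compared through their invariant functions rather than their
  generators. Thus a product presentation, whose generators act on one factor at a time, is treated
  like the lattice of the product with one further involution.\<close>

definition presents_torus_quotient :: "'a::euclidean_space quotient_presentation \<Rightarrow> ('a \<Rightarrow> 'a) \<Rightarrow> bool" where
  "presents_torus_quotient Q \<tau> \<longleftrightarrow> fst Q = UNIV \<and>
     (\<forall>f::'a \<Rightarrow> real. (\<forall>g\<in>snd Q. \<forall>x. f (g x) = f x) \<longleftrightarrow> periodic f \<and> (\<forall>x. f (\<tau> x) = f x))"

section \<open>Reflections, coordinate swaps and glide reflections\<close>

lemma multiplicity_torus_linear:
  fixes Q :: "'a::euclidean_space quotient_presentation"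
  assumes Q: "presents_torus_quotient Q \<tau>"
    and \<tau>: "\<And>v. v \<in> int_lattice \<Longrightarrow> \<tau> v \<in> int_lattice" "\<And>v x. \<tau> v \<bullet> x = v \<bullet> \<tau> x" "\<And>v. \<tau> (\<tau> v) = v"
    and r: "r < 4"
  shows "2 * multiplicity_0 Q (4 * pi\<^sup>2 * r) = card (lattice_sphere_in (Basis :: 'a set) r) + card {v \<in> lattice_sphere r. \<tau> v = v}"
  using multiplicity_torus_quotient[of Q \<tau> \<tau> "\<lambda>_. 1" r] finite_lattice_sphere_in[OF order_refl r, where ?'a = 'a] Q \<tau>
  by (simp add: presents_torus_quotient_def cas_def flip: lattice_sphere_eq)

lemma multiplicity_torus_reflection:
  fixes Q :: "'a::euclidean_space quotient_presentation"
  assumes Q: "presents_torus_quotient Q \<tau>"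
    and \<tau>: "\<And>x b. b \<in> Basis \<Longrightarrow> \<tau> x \<bullet> b = (if b \<in> N then - (x \<bullet> b) else x \<bullet> b)" and r: "r < 4"
  shows "2 * multiplicity_0 Q (4 * pi\<^sup>2 * r) = card (lattice_sphere_in (Basis :: 'a set) r) + card (lattice_sphere_in (Basis - N) r)"
proof -
  have fixed: "{v \<in> lattice_sphere r. \<tau> v = v} = lattice_sphere_in (Basis - N) r"
  proof -
    have "\<tau> v = v \<longleftrightarrow> (\<forall>b\<in>Basis - (Basis - N). v \<bullet> b = 0)" for v
    proof -
      have "\<tau> v = v \<longleftrightarrow> (\<forall>b\<in>Basis. (if b \<in> N then - (v \<bullet> b) else v \<bullet> b) = v \<bullet> b)"
        by (simp add: euclidean_eq_iff[of "\<tau> v" v] \<tau>)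
      then show ?thesis by auto
    qed
    then show ?thesis by (auto simp: lattice_sphere_in_def)
  qed
  have lat: "\<tau> v \<in> int_lattice" if "v \<in> int_lattice" for v
    using that by (simp add: int_lattice_def \<tau>)
  have adj: "\<tau> v \<bullet> x = v \<bullet> \<tau> x" for v x
    unfolding euclidean_inner[of "\<tau> v" x] euclidean_inner[of v "\<tau> x"] by (intro sum.cong refl) (simp add: \<tau>)
  have inv: "\<tau> (\<tau> v) = v" for v by (rule euclidean_eqI) (simp add: \<tau>)
  show ?thesis using multiplicity_torus_linear[OF Q lat adj inv r] unfolding fixed .
qed

lemma multiplicity_torus_swap:
  fixes Q :: "'a::euclidean_space quotient_presentation"
  assumes Q: "presents_torus_quotient Q \<tau>" and e: "e1 \<in> Basis" "e2 \<in> Basis" "e1 \<noteq> e2"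
    and \<tau>: "\<And>x b. b \<in> Basis \<Longrightarrow> \<tau> x \<bullet> b = (if b = e1 then x \<bullet> e2 else if b = e2 then x \<bullet> e1 else x \<bullet> b)" and r: "r < 4"
  shows "2 * multiplicity_0 Q (4 * pi\<^sup>2 * r) = card (lattice_sphere_in (Basis :: 'a set) r) + card {v \<in> lattice_sphere r. v \<bullet> e1 = v \<bullet> e2}"
proof -
  have fixed: "\<tau> v = v \<longleftrightarrow> v \<bullet> e1 = v \<bullet> e2" for v
  proof -
    have "\<tau> v = v \<longleftrightarrow> (\<forall>b\<in>Basis. (if b = e1 then v \<bullet> e2 else if b = e2 then v \<bullet> e1 else v \<bullet> b) = v \<bullet> b)"
      by (simp add: euclidean_eq_iff[of "\<tau> v" v] \<tau>)
    then show ?thesis using e by auto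
  qed
  have lat: "\<tau> v \<in> int_lattice" if "v \<in> int_lattice" for v
    using that e by (simp add: int_lattice_def \<tau>)
  have adj: "\<tau> v \<bullet> x = v \<bullet> \<tau> x" for v x
  proof -
    have split: "y \<bullet> z = (y \<bullet> e1) * (z \<bullet> e1) + (y \<bullet> e2) * (z \<bullet> e2) + (\<Sum>b\<in>Basis - {e1, e2}. (y \<bullet> b) * (z \<bullet> b))" for y z
      using sum.subset_diff[of "{e1, e2}" Basis "\<lambda>b. (y \<bullet> b) * (z \<bullet> b)"] e by (subst euclidean_inner) simp
    show ?thesis
      unfolding split[of "\<tau> v" x] split[of v "\<tau> x"] using e by (simp add: \<tau>)
  qed
  have inv: "\<tau> (\<tau> v) = v" for v by (rule euclidean_eqI) (use e in \<open>simp add: \<tau>\<close>)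
  show ?thesis using multiplicity_torus_linear[OF Q lat adj inv r] unfolding fixed .
qed

text \<open>Translation by half of \<open>e1\<close> multiplies \<open>cas v\<close> by the parity
  sign of the coordinate at \<open>e1\<close>. Among the vectors fixed by the reflection, those of
  sign +1 have an even such coordinate, which is 0 since \<open>r < 4\<close>. The counts of both
  signs add up to that for \<open>Basis - {e2}\<close>; eliminating the count for sign -1 produces
  the factor 2 on the right.\<close>

lemma multiplicity_torus_glide:
  fixes Q :: "'a::euclidean_space quotient_presentation"
  assumes Q: "presents_torus_quotient Q \<tau>" and e: "e1 \<in> Basis" "e2 \<in> Basis" "e1 \<noteq> e2"
    and \<tau>: "\<And>x b. b \<in> Basis \<Longrightarrow> \<tau> x \<bullet> b = (if b = e1 then x \<bullet> e1 + 1/2 else if b = e2 then - (x \<bullet> e2) else x \<bullet> b)" and r: "r < 4"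
  shows "2 * multiplicity_0 Q (4 * pi\<^sup>2 * r) + card (lattice_sphere_in (Basis - {e2}) r)
     = card (lattice_sphere_in (Basis :: 'a set) r) + 2 * card (lattice_sphere_in (Basis - {e1, e2}) r)"
proof -
  define \<pi> where "\<pi> v = v - (2 * (v \<bullet> e2)) *\<^sub>R e2" for v
  \<comment> \<open>Parity is expressed by integrality of the half, so that the sign is defined for
    all vectors and not only for lattice vectors; the sign conditions of
    \<open>multiplicity_torus_quotient\<close> range over all of them.\<close>
  define \<epsilon> where "\<epsilon> v = (if (v \<bullet> e1) / 2 \<in> \<int> then 1 else - 1 :: real)" for v
  have \<pi>b: "\<pi> v \<bullet> b = (if b = e2 then - (v \<bullet> e2) else v \<bullet> b)" if "b \<in> Basis" for v b
    using that e by (auto simp: \<pi>_def inner_diff_left inner_Basis)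
  have \<tau>\<pi>: "\<tau> x = \<pi> x + (1/2) *\<^sub>R e1" for x
    by (rule euclidean_eqI) (use e in \<open>auto simp: \<tau> \<pi>b inner_add_left inner_Basis\<close>)
  have \<pi>inner: "v \<bullet> \<pi> x = \<pi> v \<bullet> x" for v x
    by (simp add: \<pi>_def inner_diff_left inner_diff_right inner_commute)
  have \<pi>\<pi>: "\<pi> (\<pi> v) = v" for v by (rule euclidean_eqI) (use e in \<open>simp add: \<pi>b\<close>)
  have \<pi>L: "\<pi> v \<in> int_lattice" if "v \<in> int_lattice" for v
    using that e by (simp add: int_lattice_def \<pi>b)
  have half_turn: "cos (x + pi * of_int n) = (if even n then 1 else -1) * cos x \<and>
      sin (x + pi * of_int n) = (if even n then 1 else -1) * sin x" for x :: real and n :: int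
  proof (cases "even n")
    case True
    then obtain k where "n = 2 * k" by (elim evenE)
    then show ?thesis using sin_cos_eq_iff[of "x + pi * of_int n" x] by auto
  next
    case False
    then obtain k where "n = 2 * k + 1" by (elim oddE)
    then have "x + pi * of_int n = (x + pi) + 2 * pi * of_int k" by (simp add: algebra_simps)
    then show ?thesis using False sin_cos_eq_iff[of "x + pi * of_int n" "x + pi"] by auto
  qed
  have cas: "cas v (\<tau> x) = \<epsilon> v * cas (\<pi> v) x" if v: "v \<in> int_lattice" for v x
  proof -
    obtain n where n: "v \<bullet> e1 = of_int n" using v e Ints_cases unfolding int_lattice_def by blast
    have "\<epsilon> v = (if even n then 1 else -1)"
    proof -
      have "(v \<bullet> e1) / 2 \<in> \<int> \<longleftrightarrow> even n"
      proof
        assume "(v \<bullet> e1) / 2 \<in> \<int>"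
        then obtain k where "(v \<bullet> e1) / 2 = of_int k" using Ints_cases by blast
        then have "real_of_int n = real_of_int (2 * k)" using n by simp
        then show "even n" by (simp only: of_int_eq_iff) simp
      next
        assume "even n"
        then show "(v \<bullet> e1) / 2 \<in> \<int>" using n by (auto elim!: evenE)
      qed
      then show ?thesis by (simp add: \<epsilon>_def)
    qed
    moreover have "2 * pi * (v \<bullet> \<tau> x) = 2 * pi * (\<pi> v \<bullet> x) + pi * of_int n"
      by (simp add: \<tau>\<pi> inner_add_right \<pi>inner n ring_distribs)
    ultimately show ?thesis
      using half_turn[of "2 * pi * (\<pi> v \<bullet> x)" n] by (simp add: cas_def)
  qed
  have \<epsilon>\<pi>: "\<epsilon> (\<pi> v) = \<epsilon> v" for v using e by (simp add: \<epsilon>_def \<pi>b)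
  have fixed: "\<pi> v = v \<longleftrightarrow> v \<bullet> e2 = 0" for v
  proof -
    have "\<pi> v = v \<longleftrightarrow> (\<forall>b\<in>Basis. (if b = e2 then - (v \<bullet> e2) else v \<bullet> b) = v \<bullet> b)"
      by (simp add: euclidean_eq_iff[of "\<pi> v" v] \<pi>b)
    then show ?thesis using e by auto
  qed
  let ?P = "{v \<in> lattice_sphere r. \<pi> v = v \<and> \<epsilon> v = 1}"
  let ?M = "{v \<in> lattice_sphere r. \<pi> v = v \<and> \<epsilon> v = -1}"
  have "v \<bullet> e1 = 0" if v: "v \<in> lattice_sphere r" "\<epsilon> v = 1" for v
  proof -
    have half: "(v \<bullet> e1) / 2 \<in> \<int>" using v(2) by (auto simp: \<epsilon>_def split: if_splits)
    have "(v \<bullet> e1)\<^sup>2 \<le> v \<bullet> v"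
      using Basis_le_norm[OF e(1), of v] by (metis abs_ge_zero power2_abs power2_norm_eq_inner power_mono)
    then have "(v \<bullet> e1)\<^sup>2 < 4" using v r by simp
    then have "\<bar>v \<bullet> e1\<bar> < 2" using power2_less_imp_less[of "\<bar>v \<bullet> e1\<bar>" 2] by simp
    then have "\<bar>(v \<bullet> e1) / 2\<bar> < 1" by simp
    then show ?thesis using half Ints_nonzero_abs_less1 by fastforce
  qed
  moreover have "\<epsilon> v = 1" if "v \<bullet> e1 = 0" for v using that by (simp add: \<epsilon>_def)
  moreover have "Basis - (Basis - {e1, e2}) = {e1, e2}" "Basis - (Basis - {e2}) = {e2}" using e by auto
  ultimately have P: "?P = lattice_sphere_in (Basis - {e1, e2}) r"
    and PM: "?P \<union> ?M = lattice_sphere_in (Basis - {e2}) r"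
    by (auto simp: lattice_sphere_in_def fixed \<epsilon>_def)
  have fin: "finite (lattice_sphere r :: 'a set)"
    unfolding lattice_sphere_eq by (rule finite_lattice_sphere_in[OF order_refl r])
  have "card (?P \<union> ?M) = card ?P + card ?M"
    by (intro card_Un_disjoint finite_subset[OF _ fin]) auto
  moreover have "2 * multiplicity_0 Q (4 * pi\<^sup>2 * r) + card ?M = card (lattice_sphere r :: 'a set) + card ?P"
    using Q unfolding presents_torus_quotient_def
    by (intro multiplicity_torus_quotient[of Q \<tau>] \<pi>L \<pi>\<pi> cas \<epsilon>\<pi> fin) (auto simp: \<epsilon>_def \<pi>inner \<pi>\<pi>)
  ultimately show ?thesis
    unfolding PM unfolding P lattice_sphere_eq[symmetric] by linarith
qed

section \<open>The levels r = 1 and r = 2 on torus quotients\<close>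

lemma first_eigenvalue_reflection:
  fixes Q :: "'a::euclidean_space quotient_presentation"
  assumes Q: "presents_torus_quotient Q \<tau>" and N: "N \<subseteq> Basis"
    and \<tau>: "\<And>x b. b \<in> Basis \<Longrightarrow> \<tau> x \<bullet> b = (if b \<in> N then - (x \<bullet> b) else x \<bullet> b)"
  shows "multiplicity_0 Q (4 * pi\<^sup>2) + card N = 2 * DIM('a)"
proof -
  have "card (Basis - N) = DIM('a) - card N" "card N \<le> DIM('a)"
    using N by (auto simp: card_Diff_subset finite_subset card_mono)
  then show ?thesis
    using multiplicity_torus_reflection[OF Q \<tau>, where r = 1]
    by (simp add: card_lattice_sphere_in_1)
qed

lemma first_eigenvalue_glide:
  fixes Q :: "'a::euclidean_space quotient_presentation"
  assumes Q: "presents_torus_quotient Q \<tau>" and e: "e1 \<in> Basis" "e2 \<in> Basis" "e1 \<noteq> e2"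
    and \<tau>: "\<And>x b. b \<in> Basis \<Longrightarrow> \<tau> x \<bullet> b = (if b = e1 then x \<bullet> e1 + 1/2 else if b = e2 then - (x \<bullet> e2) else x \<bullet> b)"
  shows "multiplicity_0 Q (4 * pi\<^sup>2) + 3 = 2 * DIM('a)"
proof -
  have "card {e1, e2} \<le> DIM('a)" using e by (intro card_mono) auto
  then have "card (Basis - {e1, e2}) = DIM('a) - 2" "card (Basis - {e2}) = DIM('a) - 1" "2 \<le> DIM('a)"
    using e by (simp_all add: card_Diff_subset)
  then show ?thesis
    using multiplicity_torus_glide[OF Q e \<tau>, where r = 1]
    by (simp add: card_lattice_sphere_in_1)
qed

text \<open>A fixed unit lattice vector has the same integer j at \<open>e1\<close> and
  \<open>e2\<close>, and twice the square of j is at most 1, so j = 0. The count therefore coincides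
  with that of a reflection reversing two axes.\<close>

lemma first_eigenvalue_swap:
  fixes Q :: "'a::euclidean_space quotient_presentation"
  assumes Q: "presents_torus_quotient Q \<tau>" and e: "e1 \<in> Basis" "e2 \<in> Basis" "e1 \<noteq> e2"
    and \<tau>: "\<And>x b. b \<in> Basis \<Longrightarrow> \<tau> x \<bullet> b = (if b = e1 then x \<bullet> e2 else if b = e2 then x \<bullet> e1 else x \<bullet> b)"
  shows "multiplicity_0 Q (4 * pi\<^sup>2) + 2 = 2 * DIM('a)"
proof -
  have "card {e1, e2} \<le> DIM('a)" using e by (intro card_mono) auto
  then have card: "card (Basis - {e1, e2}) = DIM('a) - 2" "2 \<le> DIM('a)"
    using e by (simp_all add: card_Diff_subset)
  have zero: "v \<bullet> e1 = 0" if v: "v \<in> int_lattice" "v \<bullet> v = 1" "v \<bullet> e1 = v \<bullet> e2" for v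
  proof -
    have "(\<Sum>b\<in>{e1, e2}. (v \<bullet> b) * (v \<bullet> b)) \<le> (\<Sum>b\<in>Basis. (v \<bullet> b) * (v \<bullet> b))"
      using e by (intro sum_mono2) auto
    then have "2 * (v \<bullet> e1)\<^sup>2 \<le> 1"
      using e v by (simp add: euclidean_inner[of v v, symmetric] power2_eq_square)
    moreover have "v \<bullet> e1 \<in> \<int>" using v e by (auto simp: int_lattice_def)
    ultimately show ?thesis using Ints_square_less_4[of "v \<bullet> e1"] by auto
  qed
  have "Basis - (Basis - {e1, e2}) = {e1, e2}" using e by auto
  then have "{v \<in> lattice_sphere 1. v \<bullet> e1 = v \<bullet> e2} = lattice_sphere_in (Basis - {e1, e2}) 1"
    using zero by (fastforce simp: lattice_sphere_in_def)
  then show ?thesis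
    using multiplicity_torus_swap[OF Q e \<tau>, where r = 1] card
    by (simp add: card_lattice_sphere_in_1)
qed

text \<open>Three reversed axes is the case that ties with the glide at r = 1. With \<open>d\<close>
  the dimension minus 3, twice the difference of the multiplicities at r = 2 is 2d(d-1) +
  2(d+2)(d+1) - 4(d+1)d, which is 4 for every \<open>d\<close>.\<close>

lemma second_eigenvalue_reflection_glide:
  fixes Q :: "'a::euclidean_space quotient_presentation" and Q' :: "'b::euclidean_space quotient_presentation"
  assumes dim: "DIM('a) = DIM('b)"
    and Q: "presents_torus_quotient Q \<tau>" and N: "N \<subseteq> Basis" "card N = 3"
    and \<tau>: "\<And>x b. b \<in> Basis \<Longrightarrow> \<tau> x \<bullet> b = (if b \<in> N then - (x \<bullet> b) else x \<bullet> b)"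
    and Q': "presents_torus_quotient Q' \<tau>'" and e: "e1 \<in> Basis" "e2 \<in> Basis" "e1 \<noteq> e2"
    and \<tau>': "\<And>x b. b \<in> Basis \<Longrightarrow> \<tau>' x \<bullet> b = (if b = e1 then x \<bullet> e1 + 1/2 else if b = e2 then - (x \<bullet> e2) else x \<bullet> b)"
  shows "multiplicity_0 Q (4 * pi\<^sup>2 * 2) \<noteq> multiplicity_0 Q' (4 * pi\<^sup>2 * 2)"
proof -
  have "card N \<le> DIM('a)" using N by (intro card_mono) auto
  then obtain d where d: "DIM('a) = d + 3" using N(2) le_Suc_ex by (metis add.commute)
  have cN: "card (Basis - N) = d"
    using N d by (simp add: card_Diff_subset finite_subset[OF N(1)])
  have ce: "card (Basis - {e1, e2}) = d + 1" "card (Basis - {e2}) = d + 2"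
    using e d dim by (simp_all add: card_Diff_subset)
  have "2 * multiplicity_0 Q (4 * pi\<^sup>2 * 2) = card (lattice_sphere_in (Basis :: 'a set) 2) + 2 * d * (d - 1)"
    using multiplicity_torus_reflection[OF Q \<tau>, where r = 2] cN by (simp add: card_lattice_sphere_in_2)
  moreover have "2 * multiplicity_0 Q' (4 * pi\<^sup>2 * 2) + 2 * (d + 2) * (d + 1)
      = card (lattice_sphere_in (Basis :: 'b set) 2) + 2 * (2 * (d + 1) * d)"
    using multiplicity_torus_glide[OF Q' e \<tau>', where r = 2] ce by (simp add: card_lattice_sphere_in_2)
  moreover have "card (lattice_sphere_in (Basis :: 'a set) 2) = card (lattice_sphere_in (Basis :: 'b set) 2)"
    using dim by (simp add: card_lattice_sphere_in_2)
  moreover have "2 * d * (d - 1) + 2 * (d + 2) * (d + 1) \<noteq> 2 * (2 * (d + 1) * d)"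
    by (cases d) (simp_all add: algebra_simps)
  ultimately show ?thesis by linarith
qed

section \<open>The Klein bottle, cylinder, Moebius strip and pillow, and their products with
  tori\<close>

lemma int_lattice_vec: "(v :: real ^ 'n) \<in> int_lattice \<longleftrightarrow> (\<forall>i. v $ i \<in> \<int>)"
  by (auto simp: int_lattice_def Basis_vec_def inner_axis)

lemma int_lattice_Pair: "(u, w) \<in> int_lattice \<longleftrightarrow> u \<in> int_lattice \<and> w \<in> int_lattice"
  by (auto simp: int_lattice_def Basis_prod_def ball_Un)

lemma cubical_torus_eq: "(cubical_torus :: (real ^ 'n) quotient_presentation) = (UNIV, {\<lambda>x. x + z | z. z \<in> int_lattice})"
  by (simp add: cubical_torus_def int_lattice_vec)

lemma presents_quotient_by_torus: "presents_torus_quotient (quotient_by cubical_torus \<tau>) \<tau>"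
  by (auto simp: presents_torus_quotient_def quotient_by_def cubical_torus_eq periodic_def)

lemma presents_torus_product:
  "presents_torus_quotient
     (riemannian_product (cubical_torus :: (real ^ 't) quotient_presentation) (quotient_by (cubical_torus :: (real ^ 'n) quotient_presentation) \<tau>))
     (map_prod id \<tau>)" (is "presents_torus_quotient ?Q _")
  unfolding presents_torus_quotient_def
proof (intro conjI allI iffI)
  show "fst ?Q = UNIV"
    by (simp add: riemannian_product_def quotient_by_def cubical_torus_eq)
next
  fix f :: "(real ^ 't) \<times> (real ^ 'n) \<Rightarrow> real"
  assume inv: "\<forall>g\<in>snd ?Q. \<forall>x. f (g x) = f x"
  have 1: "f (u + z, w) = f (u, w)" if "z \<in> int_lattice" for u w z
  proof -
    have "map_prod (\<lambda>x. x + z) id \<in> snd ?Q"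
      using that by (auto simp: riemannian_product_def quotient_by_def cubical_torus_eq)
    then have "f (map_prod (\<lambda>x. x + z) id (u, w)) = f (u, w)" using inv by blast
    then show ?thesis by simp
  qed
  have 2: "f (u, w + z) = f (u, w)" if "z \<in> int_lattice" for u w z
  proof -
    have "map_prod id (\<lambda>x. x + z) \<in> snd ?Q"
      using that by (auto simp: riemannian_product_def quotient_by_def cubical_torus_eq)
    then have "f (map_prod id (\<lambda>x. x + z) (u, w)) = f (u, w)" using inv by blast
    then show ?thesis by simp
  qed
  show "periodic f"
    unfolding periodic_def by (auto simp: int_lattice_Pair 1 2)
  have "map_prod id \<tau> \<in> snd ?Q"
    by (auto simp: riemannian_product_def quotient_by_def cubical_torus_eq)
  then show "f (map_prod id \<tau> x) = f x" for x using inv by blast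
next
  fix f :: "(real ^ 't) \<times> (real ^ 'n) \<Rightarrow> real"
  assume f: "periodic f \<and> (\<forall>x. f (map_prod id \<tau> x) = f x)"
  have per: "f (x + z) = f x" if "z \<in> int_lattice" for x z
    using conjunct1[OF f] that unfolding periodic_def by blast
  have 1: "f (u + z, w) = f (u, w)" if "z \<in> int_lattice" for u w z
    using per[of "(z, 0)" "(u, w)"] that by (simp add: int_lattice_Pair int_lattice_zero)
  have 2: "f (u, w + z) = f (u, w)" if "z \<in> int_lattice" for u w z
    using per[of "(0, z)" "(u, w)"] that by (simp add: int_lattice_Pair int_lattice_zero)
  have 3: "f (u, \<tau> w) = f (u, w)" for u w
    using spec[OF conjunct2[OF f], of "(u, w)"] by simp
  have "f (g (u, w)) = f (u, w)" if "g \<in> snd ?Q" for g u w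
    using that by (auto simp: riemannian_product_def quotient_by_def cubical_torus_eq 1 2 3)
  then show "\<forall>g\<in>snd ?Q. \<forall>x. f (g x) = f x" by auto
qed

abbreviation e\<^sub>1 :: "real ^ 2" where "e\<^sub>1 \<equiv> axis 1 1"
abbreviation e\<^sub>2 :: "real ^ 2" where "e\<^sub>2 \<equiv> axis 2 1"

lemma Basis_real2: "(Basis :: (real ^ 2) set) = {e\<^sub>1, e\<^sub>2}"
  by (auto simp: Basis_vec_def UNIV_2)

lemma e_neq: "e\<^sub>1 \<noteq> e\<^sub>2" "e\<^sub>2 \<noteq> e\<^sub>1"
  by (auto simp: axis_eq_axis)

lemma klein_action:
  assumes "b \<in> Basis"
  shows "(vector [v $ 1 + 1 / 2, - (v $ 2)] :: real ^ 2) \<bullet> b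
    = (if b = e\<^sub>1 then v \<bullet> e\<^sub>1 + 1/2 else if b = e\<^sub>2 then - (v \<bullet> e\<^sub>2) else v \<bullet> b)"
  using assms by (auto simp: Basis_real2 inner_axis e_neq)

lemma cylinder_action:
  assumes "b \<in> Basis"
  shows "(vector [v $ 1, - (v $ 2)] :: real ^ 2) \<bullet> b = (if b \<in> {e\<^sub>2} then - (v \<bullet> b) else v \<bullet> b)"
  using assms by (auto simp: Basis_real2 inner_axis e_neq)

lemma moebius_action:
  assumes "b \<in> Basis"
  shows "(vector [v $ 2, v $ 1] :: real ^ 2) \<bullet> b
    = (if b = e\<^sub>1 then v \<bullet> e\<^sub>2 else if b = e\<^sub>2 then v \<bullet> e\<^sub>1 else v \<bullet> b)"
  using assms by (auto simp: Basis_real2 inner_axis e_neq)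

lemma e_Basis: "e\<^sub>1 \<in> Basis" "e\<^sub>2 \<in> Basis"
  by (simp_all add: Basis_real2)

lemma not_isospectral_0I: "multiplicity_0 P \<mu> \<noteq> multiplicity_0 Q \<mu> \<Longrightarrow> \<not> isospectral_0 P Q"
  by (auto simp: isospectral_0_def)

lemma first_eigenvalue_surfaces:
  "multiplicity_0 klein_bottle (4 * pi\<^sup>2) = 1" "multiplicity_0 cylinder (4 * pi\<^sup>2) = 3"
  "multiplicity_0 moebius_strip (4 * pi\<^sup>2) = 2" "multiplicity_0 four_pillow (4 * pi\<^sup>2) = 2"
proof -
  show "multiplicity_0 klein_bottle (4 * pi\<^sup>2) = 1"
    using first_eigenvalue_glide[OF presents_quotient_by_torus e_Basis e_neq(1) klein_action]
    by (simp add: klein_bottle_def)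
  show "multiplicity_0 cylinder (4 * pi\<^sup>2) = 3"
    using first_eigenvalue_reflection[OF presents_quotient_by_torus _ cylinder_action] e_Basis
    by (simp add: cylinder_def)
  show "multiplicity_0 moebius_strip (4 * pi\<^sup>2) = 2"
    using first_eigenvalue_swap[OF presents_quotient_by_torus e_Basis e_neq(1) moebius_action]
    by (simp add: moebius_strip_def)
  show "multiplicity_0 four_pillow (4 * pi\<^sup>2) = 2"
    using first_eigenvalue_reflection[OF presents_quotient_by_torus order_refl, of "\<lambda>v :: real ^ 2. - v"]
    by (simp add: four_pillow_def)
qed

text \<open>At r = 2 negation fixes no lattice vector, whereas the swap fixes the sum of the two
  unit vectors. It is enough that the set of fixed vectors is finite and nonempty.\<close>

lemma second_eigenvalue_moebius_pillow:
  "multiplicity_0 moebius_strip (4 * pi\<^sup>2 * 2) \<noteq> multiplicity_0 four_pillow (4 * pi\<^sup>2 * 2)"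
proof -
  let ?F = "{v :: real ^ 2. v \<in> lattice_sphere 2 \<and> v \<bullet> e\<^sub>1 = v \<bullet> e\<^sub>2}"
  have 1: "2 * multiplicity_0 moebius_strip (4 * pi\<^sup>2 * 2) = card (lattice_sphere_in (Basis :: (real ^ 2) set) 2) + card ?F"
    unfolding moebius_strip_def
    by (rule multiplicity_torus_swap[OF presents_quotient_by_torus e_Basis e_neq(1) moebius_action]) simp_all
  have "2 * multiplicity_0 four_pillow (4 * pi\<^sup>2 * 2) = card (lattice_sphere_in (Basis :: (real ^ 2) set) 2)
      + card (lattice_sphere_in (Basis - Basis :: (real ^ 2) set) 2)"
    unfolding four_pillow_def by (rule multiplicity_torus_reflection[OF presents_quotient_by_torus]) simp_all
  then have 2: "2 * multiplicity_0 four_pillow (4 * pi\<^sup>2 * 2) = card (lattice_sphere_in (Basis :: (real ^ 2) set) 2)"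
    using card_lattice_sphere_in_2[of "{} :: (real ^ 2) set"] by simp
  have "(e\<^sub>1 + e\<^sub>2) \<bullet> (e\<^sub>1 + e\<^sub>2) = 2" "(e\<^sub>1 + e\<^sub>2) \<bullet> e\<^sub>1 = (e\<^sub>1 + e\<^sub>2) \<bullet> e\<^sub>2"
    by (simp_all only: inner_add_left inner_add_right inner_Basis e_Basis e_neq if_True if_False) simp_all
  then have "e\<^sub>1 + e\<^sub>2 \<in> ?F"
    using int_lattice_add[OF Basis_int_lattice[OF e_Basis(1)] Basis_int_lattice[OF e_Basis(2)]] by blast
  moreover have "?F \<subseteq> lattice_sphere_in Basis 2"
    unfolding lattice_sphere_eq[symmetric] by blast
  then have "finite ?F"
    by (rule finite_subset) (simp add: finite_lattice_sphere_in)
  ultimately have "card ?F \<noteq> 0" using card_0_eq by blast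
  with 1 2 show ?thesis by linarith
qed

lemma Basis_prod_cases:
  assumes "b \<in> Basis"
  obtains u where "b = (u, 0)" "u \<in> Basis" | w where "b = (0, w)" "w \<in> Basis"
  using assms by (auto simp: Basis_prod_def)

lemma klein_product_action:
  fixes x :: "(real ^ 't) \<times> (real ^ 2)"
  assumes "b \<in> Basis"
  shows "map_prod id (\<lambda>v. vector [v $ 1 + 1 / 2, - (v $ 2)]) x \<bullet> b
    = (if b = (0, e\<^sub>1) then x \<bullet> (0, e\<^sub>1) + 1/2 else if b = (0, e\<^sub>2) then - (x \<bullet> (0, e\<^sub>2)) else x \<bullet> b)"
  using assms by (cases x, cases rule: Basis_prod_cases) (auto simp: klein_action)

lemma cylinder_product_action:
  fixes x :: "(real ^ 't) \<times> (real ^ 2)"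
  assumes "b \<in> Basis"
  shows "map_prod id (\<lambda>v. vector [v $ 1, - (v $ 2)]) x \<bullet> b = (if b \<in> {(0, e\<^sub>2)} then - (x \<bullet> b) else x \<bullet> b)"
  using assms by (cases x, cases rule: Basis_prod_cases) (auto simp: cylinder_action)

lemma moebius_product_action:
  fixes x :: "(real ^ 't) \<times> (real ^ 2)"
  assumes "b \<in> Basis"
  shows "map_prod id (\<lambda>v. vector [v $ 2, v $ 1]) x \<bullet> b
    = (if b = (0, e\<^sub>1) then x \<bullet> (0, e\<^sub>2) else if b = (0, e\<^sub>2) then x \<bullet> (0, e\<^sub>1) else x \<bullet> b)"
  using assms by (cases x, cases rule: Basis_prod_cases) (auto simp: moebius_action)

lemma e_product: "(0, e\<^sub>1) \<in> Basis" "(0, e\<^sub>2) \<in> Basis" "(0, e\<^sub>1) \<noteq> (0, e\<^sub>2)"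
  by (auto simp: Basis_prod_def e_Basis e_neq)

lemma first_eigenvalue_products:
  defines "T \<equiv> (cubical_torus :: (real ^ 't) quotient_presentation)"
  shows "multiplicity_0 (riemannian_product T klein_bottle) (4 * pi\<^sup>2) + 3 = 2 * (CARD('t) + 2)"
    "multiplicity_0 (riemannian_product T cylinder) (4 * pi\<^sup>2) + 1 = 2 * (CARD('t) + 2)"
    "multiplicity_0 (riemannian_product T moebius_strip) (4 * pi\<^sup>2) + 2 = 2 * (CARD('t) + 2)"
proof -
  have dim: "DIM((real ^ 't) \<times> (real ^ 2)) = CARD('t) + 2" by simp
  show "multiplicity_0 (riemannian_product T klein_bottle) (4 * pi\<^sup>2) + 3 = 2 * (CARD('t) + 2)"
    unfolding klein_bottle_def T_def dim[symmetric]
    by (rule first_eigenvalue_glide[OF presents_torus_product e_product klein_product_action])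
  have "multiplicity_0 (riemannian_product T cylinder) (4 * pi\<^sup>2) + card {(0 :: real ^ 't, e\<^sub>2)} = 2 * (CARD('t) + 2)"
    unfolding cylinder_def T_def dim[symmetric]
    by (rule first_eigenvalue_reflection[OF presents_torus_product _ cylinder_product_action]) (use e_product in auto)
  then show "multiplicity_0 (riemannian_product T cylinder) (4 * pi\<^sup>2) + 1 = 2 * (CARD('t) + 2)" by simp
  show "multiplicity_0 (riemannian_product T moebius_strip) (4 * pi\<^sup>2) + 2 = 2 * (CARD('t) + 2)"
    unfolding moebius_strip_def T_def dim[symmetric]
    by (rule first_eigenvalue_swap[OF presents_torus_product e_product moebius_product_action])
qed

section \<open>Sign matrices and the flat orbifolds\<close>

lemma card_initial_segments:
  assumes "r \<le> CARD('n::{finite,linorder})"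
  shows "card {i :: 'n. card {l. l < i} < r} = r"
proof -
  let ?\<rho> = "\<lambda>i :: 'n. card {l. l < i}"
  have mono: "?\<rho> i < ?\<rho> j" if "i < j" for i j
    using that by (intro psubset_card_mono) auto
  then have inj: "inj ?\<rho>" by (intro injI) (metis less_irrefl linorder_less_linear)
  have "?\<rho> i < CARD('n)" for i
    by (intro psubset_card_mono) auto
  then have "range ?\<rho> \<subseteq> {..<CARD('n)}" by auto
  \<comment> \<open>The rank function is injective into a set of the same size, hence onto: the
    ranks are exactly the numbers below \<open>CARD('n)\<close>.\<close>
  then have range: "range ?\<rho> = {..<CARD('n)}"
    by (rule card_subset_eq[rotated]) (simp_all add: card_image[OF inj])
  have "?\<rho> ` {i. ?\<rho> i < r} = {..<r}"
  proof
    show "{..<r} \<subseteq> ?\<rho> ` {i. ?\<rho> i < r}"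
    proof
      fix j assume "j \<in> {..<r}"
      then have "j < r" "j \<in> range ?\<rho>" using assms range by auto
      then show "j \<in> ?\<rho> ` {i. ?\<rho> i < r}" by auto
    qed
  qed auto
  then show ?thesis using card_image[OF inj_on_subset[OF inj], of "{i. ?\<rho> i < r}"] by simp
qed

lemma sign_matrix_mult: "(sign_matrix r *v x) $ i = (if card {l. l < i} < r then - (x $ i) else x $ i)"
  by (auto simp: sign_matrix_def matrix_vector_mult_def if_distrib[of "\<lambda>c. c * _"] cong: if_cong)

definition negated_axes :: "nat \<Rightarrow> (real, 'n::{finite,linorder}) vec set" where
  "negated_axes r = (\<lambda>i. axis i 1) ` {i. card {l. l < i} < r}"

lemma negated_axes_Basis: "negated_axes r \<subseteq> Basis"
  by (auto simp: negated_axes_def Basis_vec_def)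

lemma card_negated_axes:
  assumes "r \<le> CARD('n::{finite,linorder})"
  shows "card (negated_axes r :: (real, 'n) vec set) = r"
proof -
  have "inj_on (\<lambda>i. axis i 1 :: (real, 'n) vec) A" for A
    by (auto intro!: inj_onI simp: axis_eq_axis)
  then show ?thesis
    unfolding negated_axes_def using card_initial_segments[OF assms] by (simp add: card_image)
qed

lemma sign_matrix_action:
  assumes "b \<in> Basis"
  shows "(sign_matrix r *v x) \<bullet> b = (if b \<in> negated_axes r then - (x \<bullet> b) else x \<bullet> b)"
  using assms by (auto simp: Basis_vec_def negated_axes_def inner_axis sign_matrix_mult axis_eq_axis)

lemma first_eigenvalue_flat_orbifold:
  assumes "k \<le> CARD('n)"
  shows "multiplicity_0 (flat_orbifold k :: (real, 'n::{finite,linorder}) vec quotient_presentation) (4 * pi\<^sup>2) = CARD('n) + k"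
proof -
  have "multiplicity_0 (flat_orbifold k :: (real, 'n) vec quotient_presentation) (4 * pi\<^sup>2)
      + card (negated_axes (CARD('n) - k) :: (real, 'n) vec set) = 2 * DIM((real, 'n) vec)"
    unfolding flat_orbifold_def
    by (rule first_eigenvalue_reflection[OF presents_quotient_by_torus negated_axes_Basis sign_matrix_action])
  then show ?thesis using assms by (simp add: card_negated_axes)
qed

lemma second_eigenvalue_flat_orbifold_klein:
  assumes n: "CARD('n) = CARD('t) + 2" "3 \<le> CARD('n::{finite,linorder})"
  shows "multiplicity_0 (flat_orbifold (CARD('n) - 3) :: (real, 'n) vec quotient_presentation) (4 * pi\<^sup>2 * 2)
    \<noteq> multiplicity_0 (riemannian_product (cubical_torus :: (real ^ 't) quotient_presentation) klein_bottle) (4 * pi\<^sup>2 * 2)"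
  unfolding flat_orbifold_def klein_bottle_def
  by (rule second_eigenvalue_reflection_glide[OF _ presents_quotient_by_torus negated_axes_Basis _ sign_matrix_action
    presents_torus_product e_product klein_product_action]) (use n in \<open>simp_all add: card_negated_axes\<close>)

section \<open>Homogeneous harmonic functions\<close>

lemma Ck_on_Suc_dir_deriv: "Ck_on (Suc k) U f \<Longrightarrow> Ck_on k U (dir_deriv f v)"
  by simp

lemma line_has_derivative:
  assumes "Ck_on (Suc k) U f" "open U" "x + t *\<^sub>R v \<in> U"
  shows "((\<lambda>t. f (x + t *\<^sub>R v)) has_field_derivative dir_deriv f v (x + t *\<^sub>R v)) (at t)"
proof -
  have "((\<lambda>s. f ((x + t *\<^sub>R v) + s *\<^sub>R v)) has_field_derivative dir_deriv f v (x + t *\<^sub>R v)) (at (t - t))"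
    using has_derivative_imp_line_derivative[OF Ck_on_has_derivative[OF assms]] by simp
  then have "((\<lambda>s. f ((x + t *\<^sub>R v) + (s - t) *\<^sub>R v)) has_field_derivative dir_deriv f v (x + t *\<^sub>R v) * 1) (at t)"
    by (rule DERIV_chain2) (auto intro!: derivative_eq_intros)
  then show ?thesis by (simp add: algebra_simps)
qed

text \<open>Both mixed partial derivatives are values of the same second difference quotient
  of \<open>f\<close>, taken at points close to \<open>x\<close>.\<close>

lemma second_difference_mean_value:
  assumes f: "Ck_on (Suc (Suc k)) U f" and U: "open U" and h: "0 < h"
    and sq: "\<And>s t. 0 \<le> s \<Longrightarrow> s \<le> h \<Longrightarrow> 0 \<le> t \<Longrightarrow> t \<le> h \<Longrightarrow> x + s *\<^sub>R a + t *\<^sub>R b \<in> U"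
  obtains s t where "0 < s" "s < h" "0 < t" "t < h"
    "f (x + h *\<^sub>R a + h *\<^sub>R b) - f (x + h *\<^sub>R a) - f (x + h *\<^sub>R b) + f x
      = h * (h * dir_deriv (dir_deriv f a) b (x + s *\<^sub>R a + t *\<^sub>R b))"
proof -
  \<comment> \<open>The mean value theorem is applied to \<open>u\<close> in direction
    \<open>a\<close>, and then to the resulting difference of first derivatives in direction
    \<open>b\<close>.\<close>
  define u where "u s = f ((x + h *\<^sub>R b) + s *\<^sub>R a) - f (x + s *\<^sub>R a)" for s
  have "(u has_field_derivative (dir_deriv f a ((x + h *\<^sub>R b) + s *\<^sub>R a) - dir_deriv f a (x + s *\<^sub>R a))) (at s)"
    if "0 \<le> s" "s \<le> h" for s
    unfolding u_def
    by (intro DERIV_diff line_has_derivative[OF f U]) (use sq[of s h] sq[of s 0] that h in \<open>auto simp: algebra_simps\<close>)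
  then obtain s where s: "0 < s" "s < h"
    "u h - u 0 = (h - 0) * (dir_deriv f a ((x + h *\<^sub>R b) + s *\<^sub>R a) - dir_deriv f a (x + s *\<^sub>R a))"
    using MVT2[OF h, of u "\<lambda>s. dir_deriv f a ((x + h *\<^sub>R b) + s *\<^sub>R a) - dir_deriv f a (x + s *\<^sub>R a)"] by blast
  have "((\<lambda>t. dir_deriv f a ((x + s *\<^sub>R a) + t *\<^sub>R b)) has_field_derivative
      dir_deriv (dir_deriv f a) b ((x + s *\<^sub>R a) + t *\<^sub>R b)) (at t)"
    if "0 \<le> t" "t \<le> h" for t
    by (rule line_has_derivative[OF Ck_on_Suc_dir_deriv[OF f] U]) (use sq[of s t] s that in auto)
  then obtain t where t: "0 < t" "t < h"
    "dir_deriv f a ((x + s *\<^sub>R a) + h *\<^sub>R b) - dir_deriv f a ((x + s *\<^sub>R a) + 0 *\<^sub>R b)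
      = (h - 0) * dir_deriv (dir_deriv f a) b ((x + s *\<^sub>R a) + t *\<^sub>R b)"
    using MVT2[OF h, of "\<lambda>t. dir_deriv f a ((x + s *\<^sub>R a) + t *\<^sub>R b)"
      "\<lambda>t. dir_deriv (dir_deriv f a) b ((x + s *\<^sub>R a) + t *\<^sub>R b)"] by blast
  have swap: "(x + h *\<^sub>R b) + s *\<^sub>R a = (x + s *\<^sub>R a) + h *\<^sub>R b" "(x + h *\<^sub>R b) + h *\<^sub>R a = x + h *\<^sub>R a + h *\<^sub>R b"
    by (simp_all add: algebra_simps)
  have "u h - u 0 = h * (h * dir_deriv (dir_deriv f a) b (x + s *\<^sub>R a + t *\<^sub>R b))"
    using s(3) t(3) unfolding swap(1) by simp
  then show ?thesis
    using that[OF s(1,2) t(1,2)] swap(2) by (simp add: u_def)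
qed

text \<open>If the mixed derivatives differed at \<open>x\<close>, then by continuity each would
  stay within half the gap of its value at \<open>x\<close> on a small enough parallelogram. The
  common second difference makes them equal at two points of it, a contradiction.\<close>

lemma dir_deriv_commute:
  assumes f: "Ck_on (Suc (Suc k)) U f" and U: "open U" and x: "x \<in> U"
  shows "dir_deriv (dir_deriv f a) b x = dir_deriv (dir_deriv f b) a x"
proof (rule ccontr)
  define A where "A = dir_deriv (dir_deriv f a) b"
  define B where "B = dir_deriv (dir_deriv f b) a"
  assume "dir_deriv (dir_deriv f a) b x \<noteq> dir_deriv (dir_deriv f b) a x"
  then have e: "0 < \<bar>A x - B x\<bar> / 2" by (simp add: A_def B_def)
  have "isCont A x" "isCont B x"
    unfolding A_def B_def using U x Ck_on_continuous[OF Ck_on_Suc_dir_deriv[OF Ck_on_Suc_dir_deriv[OF f]]]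
    by (simp_all add: continuous_on_eq_continuous_at)
  then obtain d1 d2 where d: "0 < d1" "\<And>y. dist y x < d1 \<Longrightarrow> dist (A y) (A x) < \<bar>A x - B x\<bar> / 2"
      "0 < d2" "\<And>y. dist y x < d2 \<Longrightarrow> dist (B y) (B x) < \<bar>A x - B x\<bar> / 2"
    using e unfolding continuous_at_eps_delta by metis
  obtain r where r: "0 < r" "ball x r \<subseteq> U" using U x open_contains_ball by metis
  define d where "d = min r (min d1 d2)"
  have "0 < d" using r d by (simp add: d_def)
  \<comment> \<open>The side \<open>h\<close> keeps the parallelogram within distance
    \<open>d / 2\<close> of \<open>x\<close>; the summand 1 makes \<open>P\<close> positive even for
    \<open>a = b = 0\<close>.\<close>
  define P where "P = norm a + norm b + 1"
  define h where "h = d / (2 * P)"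
  have pos: "0 < P" using norm_ge_zero[of a] norm_ge_zero[of b] unfolding P_def by linarith
  then have h: "0 < h" using \<open>0 < d\<close> by (simp add: h_def)
  have near: "dist (x + s *\<^sub>R a + t *\<^sub>R b) x < d" if "0 \<le> s" "s \<le> h" "0 \<le> t" "t \<le> h" for s t
  proof -
    have "norm (s *\<^sub>R a + t *\<^sub>R b) \<le> norm (s *\<^sub>R a) + norm (t *\<^sub>R b)" by (rule norm_triangle_ineq)
    also have "\<dots> \<le> h * norm a + h * norm b"
      using that by (auto intro!: add_mono mult_right_mono)
    also have "\<dots> \<le> h * P" using h by (simp add: P_def algebra_simps)
    also have "\<dots> = d / 2" using pos by (simp add: h_def)
    also have "\<dots> < d" using \<open>0 < d\<close> by simp
    finally show ?thesis by (simp add: dist_norm algebra_simps)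
  qed
  have inU: "x + s *\<^sub>R a + t *\<^sub>R b \<in> U" if "0 \<le> s" "s \<le> h" "0 \<le> t" "t \<le> h" for s t
    using near[OF that] r by (auto simp: d_def dist_commute)
  have inU': "x + t *\<^sub>R b + s *\<^sub>R a \<in> U" if "0 \<le> t" "t \<le> h" "0 \<le> s" "s \<le> h" for s t
    using inU[OF that(3,4,1,2)] by (simp add: algebra_simps)
  obtain s t where st: "0 < s" "s < h" "0 < t" "t < h"
    "f (x + h *\<^sub>R a + h *\<^sub>R b) - f (x + h *\<^sub>R a) - f (x + h *\<^sub>R b) + f x = h * (h * A (x + s *\<^sub>R a + t *\<^sub>R b))"
    unfolding A_def using second_difference_mean_value[OF f U h inU] by blast
  obtain t' s' where st': "0 < t'" "t' < h" "0 < s'" "s' < h"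
    "f (x + h *\<^sub>R b + h *\<^sub>R a) - f (x + h *\<^sub>R b) - f (x + h *\<^sub>R a) + f x = h * (h * B (x + t' *\<^sub>R b + s' *\<^sub>R a))"
    unfolding B_def using second_difference_mean_value[OF f U h inU'] by blast
  have swap: "x + h *\<^sub>R b + h *\<^sub>R a = x + h *\<^sub>R a + h *\<^sub>R b" "x + t' *\<^sub>R b + s' *\<^sub>R a = x + s' *\<^sub>R a + t' *\<^sub>R b"
    by (simp_all add: algebra_simps)
  have "h * (h * A (x + s *\<^sub>R a + t *\<^sub>R b)) = h * (h * B (x + s' *\<^sub>R a + t' *\<^sub>R b))"
    using st(5) st'(5) unfolding swap by linarith
  then have "A (x + s *\<^sub>R a + t *\<^sub>R b) = B (x + s' *\<^sub>R a + t' *\<^sub>R b)" using h by simp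
  moreover have "dist (A (x + s *\<^sub>R a + t *\<^sub>R b)) (A x) < \<bar>A x - B x\<bar> / 2"
    by (rule d(2)) (use near[of s t] st in \<open>simp add: d_def\<close>)
  moreover have "dist (B (x + s' *\<^sub>R a + t' *\<^sub>R b)) (B x) < \<bar>A x - B x\<bar> / 2"
    by (rule d(4)) (use near[of s' t'] st' in \<open>simp add: d_def\<close>)
  ultimately show False by (simp add: dist_real_def) (smt (verit) field_sum_of_halves)
qed

lemma ray_has_derivative:
  fixes g :: "'a::euclidean_space \<Rightarrow> real"
  assumes "Ck_on (Suc k) (-{0}) g" "x \<noteq> 0"
  shows "((\<lambda>t. g (t *\<^sub>R x)) has_field_derivative dir_deriv g x x) (at 1)"
  using line_has_derivative[OF assms(1) _ , of 0 1 x] assms(2) by (simp add: open_Compl)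

text \<open>Euler's relation in degree 0; the next lemma is the case of degree 1. Homogeneity is
  only asked for along the ray through \<open>x\<close>.\<close>

lemma homogeneous_0_radial_derivative:
  assumes g: "Ck_on (Suc k) (-{0}) g" "x \<noteq> 0" and hom: "\<And>t. 0 < t \<Longrightarrow> g (t *\<^sub>R x) = g x"
  shows "dir_deriv g x x = 0"
proof -
  have "((\<lambda>t. g x) has_field_derivative dir_deriv g x x) (at 1)"
    by (rule has_field_derivative_transform_within_open[OF ray_has_derivative[OF g], of "{0<..}"]) (use hom in auto)
  then show ?thesis using DERIV_unique DERIV_const by blast
qed

lemma homogeneous_1_radial_derivative:
  assumes g: "Ck_on (Suc k) (-{0}) g" "x \<noteq> 0" and hom: "\<And>t. 0 < t \<Longrightarrow> g (t *\<^sub>R x) = t * g x"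
  shows "dir_deriv g x x = g x"
proof -
  have "((\<lambda>t. t * g x) has_field_derivative dir_deriv g x x) (at 1)"
    by (rule has_field_derivative_transform_within_open[OF ray_has_derivative[OF g], of "{0<..}"]) (use hom in auto)
  moreover have "((\<lambda>t. t * g x) has_field_derivative g x) (at 1)"
    by (auto intro!: derivative_eq_intros)
  ultimately show ?thesis using DERIV_unique by blast
qed

text \<open>A single dilation \<open>t\<close> with a free factor \<open>c\<close> covers both uses:
  \<open>c = t\<close> shows that derivatives of a function of degree 1 have degree 0, and
  \<open>c = 1\<close> that derivatives of a function of degree 0 have degree -1.\<close>

lemma homogeneous_dir_deriv:
  assumes g: "Ck_on (Suc k) (-{0::'a::euclidean_space}) g" and x: "x \<noteq> 0" and t: "t \<noteq> 0"
    and hom: "\<And>y. y \<noteq> 0 \<Longrightarrow> g (t *\<^sub>R y) = c * g y"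
  shows "t * dir_deriv g v (t *\<^sub>R x) = c * dir_deriv g v x"
proof -
  have gt: "(g has_derivative frechet_derivative g (at (t *\<^sub>R x))) (at (t *\<^sub>R x))"
    and gx: "(g has_derivative frechet_derivative g (at x)) (at x)"
    using x t by (auto intro!: Ck_on_has_derivative[OF g])
  have "((\<lambda>y. g (t *\<^sub>R y)) has_derivative (\<lambda>v. frechet_derivative g (at (t *\<^sub>R x)) (t *\<^sub>R v))) (at x)"
    by (rule has_derivative_compose[where f = "\<lambda>y. t *\<^sub>R y", OF _ gt]) (auto intro!: derivative_eq_intros)
  then have "((\<lambda>y. c * g y) has_derivative (\<lambda>v. frechet_derivative g (at (t *\<^sub>R x)) (t *\<^sub>R v))) (at x)"
    by (rule has_derivative_transform_within_open[of _ _ _ _ "-{0}"]) (use hom x in auto)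
  moreover have "((\<lambda>y. c * g y) has_derivative (\<lambda>v. c * frechet_derivative g (at x) v)) (at x)"
    by (rule has_derivative_mult_right[OF gx])
  ultimately have "(\<lambda>v. frechet_derivative g (at (t *\<^sub>R x)) (t *\<^sub>R v)) = (\<lambda>v. c * frechet_derivative g (at x) v)"
    by (rule has_derivative_unique)
  then have "frechet_derivative g (at (t *\<^sub>R x)) (t *\<^sub>R v) = c * frechet_derivative g (at x) v" by metis
  then show ?thesis using linear_scale[OF has_derivative_linear[OF gt]] by simp
qed

text \<open>Squaring removes the kink of the positive part, which gives an explicit cutoff with a
  continuous derivative.\<close>

lemma has_derivative_max_square:
  "((\<lambda>u::real. (max 0 u)\<^sup>2) has_field_derivative 2 * max 0 u) (at u)"
proof (cases u "0::real" rule: linorder_cases)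
  case less
  have "((\<lambda>u::real. 0) has_field_derivative 2 * max 0 u) (at u)" using less by simp
  then show ?thesis
    by (rule has_field_derivative_transform_within_open[of _ _ _ "{..<0}"]) (use less in auto)
next
  case greater
  have "((\<lambda>u::real. u\<^sup>2) has_field_derivative 2 * max 0 u) (at u)"
    using greater by (auto intro!: derivative_eq_intros)
  then show ?thesis
    by (rule has_field_derivative_transform_within_open[of _ _ _ "{0<..}"]) (use greater in auto)
next
  case equal
  have "((\<lambda>t::real. (max 0 t)\<^sup>2 / t) \<longlongrightarrow> 0) (at 0)"
  proof (rule Lim_null_comparison)
    show "\<forall>\<^sub>F t in at 0. norm ((max 0 t)\<^sup>2 / t) \<le> \<bar>t::real\<bar>"
      by (intro always_eventually allI) (auto simp: max_def power2_eq_square)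
    show "((\<lambda>t::real. \<bar>t\<bar>) \<longlongrightarrow> 0) (at 0)" by (rule tendsto_rabs_zero) simp
  qed
  then show ?thesis using equal by (simp add: DERIV_def)
qed

text \<open>A \<open>C\<^sup>1\<close> radial cutoff, supported in the shell \<open>s/2 \<le> |x|\<^sup>2 \<le> 2 s\<close>.\<close>

definition shell_cutoff :: "real \<Rightarrow> 'a::euclidean_space \<Rightarrow> real" where
  "shell_cutoff s x = (max 0 ((x \<bullet> x - s / 2) * (2 * s - x \<bullet> x)))\<^sup>2"

text \<open>The gradient of the cutoff at \<open>x\<close> is this factor times \<open>x\<close>, by
  the chain rule through the squared norm.\<close>

definition shell_cutoff_deriv :: "real \<Rightarrow> 'a::euclidean_space \<Rightarrow> real" where
  "shell_cutoff_deriv s x = 2 * max 0 ((x \<bullet> x - s / 2) * (2 * s - x \<bullet> x)) * (2 * (5 * s / 2 - 2 * (x \<bullet> x)))"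

lemma shell_cutoff_has_derivative:
  "(shell_cutoff s has_derivative (\<lambda>v. shell_cutoff_deriv s x * (x \<bullet> v))) (at x)"
proof -
  have "((\<lambda>x. (x \<bullet> x - s / 2) * (2 * s - x \<bullet> x)) has_derivative
      (\<lambda>v. 2 * (5 * s / 2 - 2 * (x \<bullet> x)) * (x \<bullet> v))) (at x)"
    by (auto intro!: derivative_eq_intros simp: algebra_simps inner_commute)
  from DERIV_compose_FDERIV[OF has_derivative_max_square this]
  show ?thesis by (simp add: shell_cutoff_def[abs_def] shell_cutoff_deriv_def mult_ac)
qed

lemma shell_cutoff_outside:
  assumes "0 < s" "x \<bullet> x \<le> s / 2 \<or> 2 * s \<le> x \<bullet> x"
  shows "shell_cutoff s x = 0" "shell_cutoff_deriv s x = 0"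
proof -
  have "(x \<bullet> x - s / 2) * (2 * s - x \<bullet> x) \<le> 0"
    using assms by (auto intro: mult_nonpos_nonneg mult_nonneg_nonpos)
  then have "max 0 ((x \<bullet> x - s / 2) * (2 * s - x \<bullet> x)) = 0" by (rule max_absorb1)
  then show "shell_cutoff s x = 0" "shell_cutoff_deriv s x = 0"
    by (simp_all only: shell_cutoff_def shell_cutoff_deriv_def) simp_all
qed

text \<open>The divergence theorem for the field \<open>\<phi> h \<nabla>h\<close> with a radial cutoff \<open>\<phi>\<close>: its divergence
  is \<open>\<phi> |\<nabla>h|\<^sup>2\<close>, because \<open>\<nabla>h\<close> is orthogonal to the radial direction.\<close>

lemma homogeneous_0_harmonic_gradient:
  fixes h :: "'a::euclidean_space \<Rightarrow> real"
  assumes h: "Ck_on (Suc (Suc 0)) (-{0}) h" and hom: "\<And>t x. 0 < t \<Longrightarrow> x \<noteq> 0 \<Longrightarrow> h (t *\<^sub>R x) = h x"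
    and harm: "\<And>x. x \<noteq> 0 \<Longrightarrow> euclidean_laplacian h x = 0" and x0: "x0 \<noteq> 0" and c: "c \<in> Basis"
  shows "dir_deriv h c x0 = 0"
proof -
  \<comment> \<open>The shell is centred so that it contains \<open>x0\<close>, where the cutoff is
    positive.\<close>
  define s where "s = x0 \<bullet> x0"
  have s: "0 < s" using x0 by (simp add: s_def)
  \<comment> \<open>The summand 1 leaves a layer of width 1 inside each face of the box where the
    cutoff vanishes, so \<open>integral_dir_deriv_box\<close> applies with \<open>1\<close> for its
    \<open>\<delta>\<close>.\<close>
  define R where "R = sqrt (2 * s) + 1"
  have R: "1 \<le> R" using s by (simp add: R_def)
  have R2: "2 * s \<le> (R - 1)\<^sup>2" using s by (simp add: R_def)
  let ?\<phi> = "shell_cutoff s :: 'a \<Rightarrow> real"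
  let ?\<phi>' = "shell_cutoff_deriv s :: 'a \<Rightarrow> real"
  \<comment> \<open>\<open>G b\<close> is a component of the field and \<open>k b\<close> its
    derivative along \<open>b\<close>, so that the sum of all \<open>k b\<close> is the
    divergence.\<close>
  define G where "G b x = ?\<phi> x * (h x * dir_deriv h b x)" for b x
  define k where "k b x = ?\<phi> x * (h x * dir_deriv (dir_deriv h b) b x + dir_deriv h b x * dir_deriv h b x)
      + (?\<phi>' x * (x \<bullet> b)) * (h x * dir_deriv h b x)" for b x
  have op: "open (-{0::'a})" by (simp add: open_Compl)
  have hb: "Ck_on (Suc 0) (-{0}) (dir_deriv h b)" for b by (rule Ck_on_Suc_dir_deriv[OF h])
  have hbb: "continuous_on (-{0}) (dir_deriv (dir_deriv h b) b)" for b
    using Ck_on_continuous[OF Ck_on_Suc_dir_deriv[OF hb]] .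
  have hc: "continuous_on (-{0}) h" by (rule Ck_on_continuous[OF h])
  have hbc: "continuous_on (-{0}) (dir_deriv h b)" for b by (rule Ck_on_continuous[OF hb])
  have \<phi>c: "continuous_on A ?\<phi>" "continuous_on A ?\<phi>'" for A
    unfolding shell_cutoff_def shell_cutoff_deriv_def by (intro continuous_intros)+
  \<comment> \<open>Nothing is known about \<open>h\<close> at the origin. On this neighbourhood the
    cutoff and its derivative vanish, so \<open>G\<close> and \<open>k\<close> extend continuously
    across it.\<close>
  define B where "B = {x::'a. x \<bullet> x < s / 2}"
  have Bo: "open B" unfolding B_def by (intro open_Collect_less continuous_intros)
  have VB: "-{0} \<union> B = UNIV" using s by (auto simp: B_def)
  have B0: "?\<phi> x = 0" "?\<phi>' x = 0" if "x \<in> B" for x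
    using shell_cutoff_outside[OF s, of x] that by (auto simp: B_def)
  have glue: "continuous_on UNIV f" if "continuous_on (-{0}) f" "\<And>x. x \<in> B \<Longrightarrow> f x = 0" for f :: "'a \<Rightarrow> real"
  proof -
    have "continuous_on B f" using that(2) by (simp cong: continuous_on_cong)
    then show ?thesis using continuous_on_open_Un[OF op Bo that(1)] VB by simp
  qed
  have Gc: "continuous_on UNIV (G b)" for b
    by (rule glue) (auto simp: G_def B0 intro!: continuous_intros \<phi>c hc hbc)
  have kc: "continuous_on UNIV (k b)" for b
    by (rule glue) (auto simp: k_def B0 intro!: continuous_intros \<phi>c hc hbc hbb)
  have Gk: "((\<lambda>t. G b (x + t *\<^sub>R b)) has_field_derivative k b x) (at 0)" for b x
  proof (cases "x = 0")
    case True
    have xB: "x \<in> B" using True s by (simp add: B_def)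
    have "(G b has_derivative (\<lambda>v. 0)) (at x)"
      by (rule has_derivative_transform_within_open[OF has_derivative_const[of 0] Bo xB]) (simp add: G_def B0)
    moreover have "k b x = 0" using B0[of x] True s by (simp add: k_def B_def)
    ultimately show ?thesis using has_derivative_imp_line_derivative[of "G b" _ x b] by simp
  next
    case False
    then have x: "x \<in> -{0}" by simp
    have "(G b has_derivative (\<lambda>v. ?\<phi> x * (h x * dir_deriv (dir_deriv h b) v x + dir_deriv h v x * dir_deriv h b x)
        + (?\<phi>' x * (x \<bullet> v)) * (h x * dir_deriv h b x))) (at x)"
      unfolding G_def
      by (intro has_derivative_mult shell_cutoff_has_derivative Ck_on_has_derivative[OF h op x] Ck_on_has_derivative[OF hb op x])
    from has_derivative_imp_line_derivative[OF this] show ?thesis by (simp add: k_def)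
  qed
  let ?a = "(- R) *\<^sub>R One :: 'a"
  let ?c = "R *\<^sub>R One :: 'a"
  have out: "?\<phi> x = 0" if "R - 1 \<le> \<bar>x \<bullet> b\<bar>" "b \<in> Basis" for x b
  proof -
    have "(R - 1)\<^sup>2 \<le> \<bar>x \<bullet> b\<bar>\<^sup>2" using that(1) R by (intro power_mono) auto
    also have "\<dots> \<le> (norm x)\<^sup>2" using Basis_le_norm[OF that(2), of x] by (intro power_mono) auto
    finally have "2 * s \<le> x \<bullet> x" using R2 by (simp add: power2_norm_eq_inner)
    then show ?thesis using shell_cutoff_outside[OF s] by blast
  qed
  have int0: "integral (cbox ?a ?c) (k b) = 0" if b: "b \<in> Basis" for b
  proof (rule integral_dir_deriv_box[OF b _ _ Gk Gc kc, of 1])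
    have One: "One \<bullet> b = 1" using b by simp
    show "1 \<le> (?c - ?a) \<bullet> b" using R One by (simp add: inner_diff_left inner_add_left)
    fix x assume x: "x \<in> cbox ?a ?c" "x \<bullet> b \<le> ?a \<bullet> b + 1"
    have lo: "- R \<le> x \<bullet> b" "x \<bullet> b \<le> - R + 1"
      using x b One by (auto simp: mem_box)
    have "(x + ((?c - ?a) \<bullet> b) *\<^sub>R b) \<bullet> b = x \<bullet> b + 2 * R"
      using b One by (simp add: inner_add_left inner_diff_left)
    then have "?\<phi> (x + ((?c - ?a) \<bullet> b) *\<^sub>R b) = 0" using lo R b by (intro out[of _ b]) auto
    moreover have "?\<phi> x = 0" using lo R b by (intro out[of _ b]) auto
    ultimately show "G b (x + ((?c - ?a) \<bullet> b) *\<^sub>R b) = G b x" by (simp add: G_def)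
  qed simp
  define E where "E x = (\<Sum>b\<in>Basis. k b x)" for x
  have E: "E x = ?\<phi> x * (\<Sum>b\<in>Basis. (dir_deriv h b x)\<^sup>2)" for x
  proof (cases "x = 0")
    case True
    then show ?thesis using B0[of x] s by (simp add: E_def k_def B_def)
  next
    case False
    have "(\<Sum>b\<in>Basis. (x \<bullet> b) * dir_deriv h b x) = dir_deriv h x x"
      using frechet_derivative_eq_gradient[OF h op, of x x] False by (simp add: inner_sum_left inner_commute[of x] mult.commute)
    then have radial: "(\<Sum>b\<in>Basis. (x \<bullet> b) * dir_deriv h b x) = 0"
      using homogeneous_0_radial_derivative[OF h False hom] False by simp
    have "E x = ?\<phi> x * (h x * euclidean_laplacian h x) + ?\<phi> x * (\<Sum>b\<in>Basis. (dir_deriv h b x)\<^sup>2)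
        + ?\<phi>' x * h x * (\<Sum>b\<in>Basis. (x \<bullet> b) * dir_deriv h b x)"
      unfolding E_def k_def euclidean_laplacian_def sum_distrib_left sum.distrib[symmetric]
      by (intro sum.cong refl) (simp add: algebra_simps power2_eq_square)
    then show ?thesis using radial harm[OF False] by simp
  qed
  have Ec: "continuous_on UNIV E" unfolding E_def by (intro continuous_intros kc)
  have ki: "k b integrable_on cbox ?a ?c" for b
    by (rule integrable_continuous) (rule continuous_on_subset[OF kc], simp)
  have "(E has_integral (\<Sum>b\<in>Basis. integral (cbox ?a ?c) (k b))) (cbox ?a ?c)"
    unfolding E_def by (intro has_integral_sum finite_Basis integrable_integral ki)
  then have int: "(E has_integral 0) (cbox ?a ?c)" using int0 by simp
  have x0box: "x0 \<in> cbox ?a ?c"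
    unfolding mem_box
  proof (intro ballI)
    fix b :: 'a assume b: "b \<in> Basis"
    have "\<bar>x0 \<bullet> b\<bar> \<le> norm x0" by (rule Basis_le_norm[OF b])
    also have "\<dots> \<le> R" using s by (simp add: R_def s_def norm_eq_sqrt_inner real_sqrt_mult)
        (smt (verit) mult_right_mono mult_cancel_right1 real_sqrt_ge_1_iff real_sqrt_ge_zero inner_ge_zero)
    finally show "?a \<bullet> b \<le> x0 \<bullet> b \<and> x0 \<bullet> b \<le> ?c \<bullet> b" using b by (simp add: abs_le_iff)
  qed
  have "E x0 = 0"
  proof (rule has_integral_0_cbox_imp_0[OF _ _ int _ x0box])
    show "continuous_on (cbox ?a ?c) E" by (rule continuous_on_subset[OF Ec]) simp
    show "0 \<le> E x" for x unfolding E by (intro mult_nonneg_nonneg sum_nonneg) (auto simp: shell_cutoff_def)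
    show "box ?a ?c \<noteq> {}" unfolding box_ne_empty using R by (intro ballI) simp
  qed
  moreover have "?\<phi> x0 \<noteq> 0" using s by (simp add: shell_cutoff_def flip: s_def)
  ultimately have "(\<Sum>b\<in>Basis. (dir_deriv h b x0)\<^sup>2) = 0" unfolding E by simp
  then have "(dir_deriv h c x0)\<^sup>2 = 0" using c by (subst (asm) sum_nonneg_eq_0_iff) auto
  then show ?thesis by simp
qed

section \<open>First eigenvalue of sphere quotients\<close>

text \<open>The Laplacian has constant coefficients and commutes with directional derivatives.
  Symmetry of second derivatives is used twice, the first time on all of \<open>U\<close> because
  the identity is then differentiated.\<close>

lemma euclidean_laplacian_dir_deriv:
  assumes f: "Ck_on (Suc (Suc (Suc 0))) U f" and U: "open U" and x: "x \<in> U"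
    and harm: "\<And>y. y \<in> U \<Longrightarrow> euclidean_laplacian f y = 0"
  shows "euclidean_laplacian (dir_deriv f b) x = 0"
proof -
  have third: "dir_deriv (dir_deriv (dir_deriv f b) c) c x = dir_deriv (dir_deriv (dir_deriv f c) c) b x" for c
  proof -
    have "dir_deriv (dir_deriv f b) c y = dir_deriv (dir_deriv f c) b y" if "y \<in> U" for y
      by (rule dir_deriv_commute[OF f U that])
    then have "dir_deriv (dir_deriv (dir_deriv f b) c) c x = dir_deriv (dir_deriv (dir_deriv f c) b) c x"
      using frechet_derivative_cong_open[OF U x, of "dir_deriv (dir_deriv f b) c" "dir_deriv (dir_deriv f c) b"] by simp
    also have "\<dots> = dir_deriv (dir_deriv (dir_deriv f c) c) b x"
      by (rule dir_deriv_commute[OF Ck_on_Suc_dir_deriv[OF f] U x])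
    finally show ?thesis .
  qed
  have C1: "Ck_on (Suc 0) U (dir_deriv (dir_deriv f c) c)" for c
    by (rule Ck_on_Suc_dir_deriv[OF Ck_on_Suc_dir_deriv[OF f]])
  have "(euclidean_laplacian f has_derivative (\<lambda>v. \<Sum>c\<in>Basis. dir_deriv (dir_deriv (dir_deriv f c) c) v x)) (at x)"
    unfolding euclidean_laplacian_def[abs_def]
    by (intro has_derivative_sum Ck_on_has_derivative[OF C1 U x])
  moreover have "(euclidean_laplacian f has_derivative (\<lambda>v. 0)) (at x)"
    by (rule has_derivative_transform_within_open[OF has_derivative_const[of 0] U x]) (simp add: harm)
  ultimately have "(\<lambda>v. \<Sum>c\<in>Basis. dir_deriv (dir_deriv (dir_deriv f c) c) v x) = (\<lambda>v. 0)"
    by (rule has_derivative_unique)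
  then have "(\<Sum>c\<in>Basis. dir_deriv (dir_deriv (dir_deriv f c) c) b x) = 0" by metis
  then show ?thesis unfolding euclidean_laplacian_def third .
qed

text \<open>The first derivatives are harmonic and homogeneous of degree 0, hence constant.\<close>

lemma homogeneous_1_harmonic_linear:
  fixes F :: "'a::euclidean_space \<Rightarrow> real"
  assumes dim: "2 \<le> DIM('a)" and F: "Ck_on (Suc (Suc (Suc 0))) (-{0}) F"
    and hom: "\<And>t x. 0 < t \<Longrightarrow> x \<noteq> 0 \<Longrightarrow> F (t *\<^sub>R x) = t * F x"
    and harm: "\<And>x. x \<noteq> 0 \<Longrightarrow> euclidean_laplacian F x = 0"
  obtains a where "\<And>x. x \<noteq> 0 \<Longrightarrow> F x = x \<bullet> a"
proof -
  have op: "open (-{0::'a})" by (simp add: open_Compl)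
  \<comment> \<open>Dimension at least 2 enters here. On the line the modulus is homogeneous of
    degree 1 and harmonic off 0, but not linear.\<close>
  have conn: "connected (-{0::'a})" by (rule connected_punctured_universe[OF dim])
  obtain x0 :: 'a where x0: "x0 \<in> -{0}"
    using nonempty_Basis nonzero_Basis by blast
  note Fb = Ck_on_Suc_dir_deriv[OF F]
  have hom0: "dir_deriv F b (t *\<^sub>R x) = dir_deriv F b x" if "0 < t" "x \<noteq> 0" for t x b
    using homogeneous_dir_deriv[OF F that(2), of t t b] that hom by simp
  have zero: "dir_deriv (dir_deriv F b) c x = 0" if "x \<noteq> 0" "c \<in> Basis" for b c x
    by (rule homogeneous_0_harmonic_gradient[OF Fb hom0 _ that])
      (use euclidean_laplacian_dir_deriv[OF F op] harm in auto)
  have const: "dir_deriv F b x = dir_deriv F b x0" if x: "x \<noteq> 0" for b x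
  proof (rule has_derivative_zero_unique_connected[OF op conn])
    fix y :: 'a assume y: "y \<in> -{0}"
    have "frechet_derivative (dir_deriv F b) (at y) = (\<lambda>v. 0)"
    proof
      fix v
      have "frechet_derivative (dir_deriv F b) (at y) v
         = (\<Sum>c\<in>Basis. dir_deriv (dir_deriv F b) c y *\<^sub>R c) \<bullet> v"
        by (rule frechet_derivative_eq_gradient[OF Fb op y])
      also have "(\<Sum>c\<in>Basis. dir_deriv (dir_deriv F b) c y *\<^sub>R c) = 0"
        using y by (intro sum.neutral ballI) (simp add: zero)
      finally show "frechet_derivative (dir_deriv F b) (at y) v = 0" by simp
    qed
    then show "(dir_deriv F b has_derivative (\<lambda>v. 0)) (at y)"
      using Ck_on_has_derivative[OF Fb op y, of b] by simp
  qed (use x x0 in auto)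
  show ?thesis
  proof (rule that[of "\<Sum>b\<in>Basis. dir_deriv F b x0 *\<^sub>R b"])
    fix x :: 'a assume x: "x \<noteq> 0"
    \<comment> \<open>Euler's relation recovers \<open>F\<close> from its gradient, which is
      constant.\<close>
    have "F x = dir_deriv F x x"
      using homogeneous_1_radial_derivative[OF F x] hom[OF _ x] by simp
    also have "\<dots> = (\<Sum>b\<in>Basis. dir_deriv F b x *\<^sub>R b) \<bullet> x"
      by (rule frechet_derivative_eq_gradient[OF F op]) (use x in simp)
    also have "\<dots> = x \<bullet> (\<Sum>b\<in>Basis. dir_deriv F b x0 *\<^sub>R b)"
      by (subst inner_commute) (simp only: const[OF x])
    finally show "F x = x \<bullet> (\<Sum>b\<in>Basis. dir_deriv F b x0 *\<^sub>R b)" .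
  qed
qed

section \<open>The sphere Laplacian by homogeneous extension of degree 1\<close>

lemma tangent_space_sphere:
  fixes p :: "'a::euclidean_space"
  assumes p: "norm p = 1"
  shows "tangent_space (sphere 0 1) p = {v. p \<bullet> v = 0}"
proof (intro set_eqI iffI CollectI)
  fix v assume "v \<in> tangent_space (sphere 0 1) p"
  then obtain c where c: "c 0 = p" "range c \<subseteq> sphere 0 1" "(c has_vector_derivative v) (at 0)"
    by (auto simp: tangent_space_def)
  have c1: "c t \<bullet> c t = 1" for t using c(2) by (simp add: image_subset_iff flip: power2_norm_eq_inner)
  have "((\<lambda>t. c t \<bullet> c t) has_derivative (\<lambda>h. c 0 \<bullet> (h *\<^sub>R v) + (h *\<^sub>R v) \<bullet> c 0)) (at 0)"
    using c(3) unfolding has_vector_derivative_def by (intro has_derivative_inner)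
  moreover have "((\<lambda>t. c t \<bullet> c t) has_derivative (\<lambda>h. 0)) (at 0)" unfolding c1 by simp
  ultimately have "(\<lambda>h. c 0 \<bullet> (h *\<^sub>R v) + (h *\<^sub>R v) \<bullet> c 0) = (\<lambda>h. 0)" by (rule has_derivative_unique)
  from fun_cong[OF this, of 1] show "p \<bullet> v = 0" using c(1) by (simp add: inner_commute)
next
  fix v assume "v \<in> {v. p \<bullet> v = 0}"
  then have pv: "p \<bullet> v = 0" "v \<bullet> p = 0" by (simp_all add: inner_commute)
  have pp: "p \<bullet> p = 1" using p by (simp flip: power2_norm_eq_inner)
  show "v \<in> tangent_space (sphere 0 1) p"
  proof (cases "v = 0")
    case True
    then show ?thesis
      unfolding tangent_space_def using p by (intro CollectI exI[of _ "\<lambda>_. p"]) auto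
  next
    case False
    define r where "r = norm v"
    have r: "r \<noteq> 0" "v \<bullet> v = r\<^sup>2" using False by (simp_all add: r_def power2_norm_eq_inner)
    \<comment> \<open>The great circle through \<open>p\<close> in direction \<open>v\<close>;
      dividing the sine by the length of \<open>v\<close> gives it velocity exactly \<open>v\<close>
      at 0.\<close>
    define c where "c t = cos (t * r) *\<^sub>R p + (sin (t * r) / r) *\<^sub>R v" for t
    have "c t \<bullet> c t = (cos (t * r))\<^sup>2 + (sin (t * r))\<^sup>2" for t
      using r pv pp by (simp add: c_def inner_add_left inner_add_right power2_eq_square)
    then have "range c \<subseteq> sphere 0 1" by (auto simp: norm_eq_sqrt_inner)
    moreover have "(c has_vector_derivative v) (at 0)"
      unfolding c_def using r by (auto intro!: derivative_eq_intros)
    moreover have "c 0 = p" by (simp add: c_def)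
    ultimately show ?thesis unfolding tangent_space_def by blast
  qed
qed

text \<open>By Euler's relation the radial component of the gradient of \<open>F\<close> at a unit
  vector is \<open>F\<close> itself, so the tangential gradient is \<open>X\<close>. In its
  divergence the radial term is orthogonal to the frame, and the term \<open>F p\<close> is counted
  once per frame vector, which gives the factor \<open>DIM('a) - 1\<close>. First derivatives of
  \<open>F\<close> have degree 0, so the Hessian vanishes in direction \<open>p\<close> and its
  trace over the tangent space is the full Laplacian.\<close>

lemma laplacian_sphere:
  fixes F f :: "'a::euclidean_space \<Rightarrow> real"
  assumes F: "Ck_on (Suc (Suc 0)) (-{0}) F" and hom: "\<And>t x. 0 < t \<Longrightarrow> x \<noteq> 0 \<Longrightarrow> F (t *\<^sub>R x) = t * F x"
    and fF: "\<And>q. q \<in> sphere 0 1 \<Longrightarrow> f q = F q" and p: "p \<in> sphere 0 1"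
  shows "laplacian (sphere 0 1) f p = (real DIM('a) - 1) * f p - euclidean_laplacian F p"
proof -
  let ?S = "sphere 0 1 :: 'a set"
  have op: "open (-{0::'a})" by (simp add: open_Compl)
  have S0: "q \<in> -{0}" if "q \<in> ?S" for q using that by auto
  have T: "tangent_space ?S q = {v. q \<bullet> v = 0}" if "q \<in> ?S" for q
    using that by (intro tangent_space_sphere) simp
  have sub: "subspace (tangent_space ?S q)" if "q \<in> ?S" for q
    unfolding T[OF that] by (rule subspace_hyperplane)
  define D where "D x = (\<Sum>b\<in>Basis. dir_deriv F b x *\<^sub>R b)" for x
  define H where "H v = (\<Sum>b\<in>Basis. dir_deriv (dir_deriv F b) v p *\<^sub>R b)" for v
  define X where "X x = D x - F x *\<^sub>R x" for x
  have pp: "p \<bullet> p = 1" using p by (simp flip: power2_norm_eq_inner)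
  have FD: "dir_deriv F v q = D q \<bullet> v" if "q \<in> ?S" for q v
    unfolding D_def by (rule frechet_derivative_eq_gradient[OF F op S0[OF that]])
  have X': "(X has_derivative (\<lambda>v. H v - (F p *\<^sub>R v + dir_deriv F v p *\<^sub>R p))) (at p)"
    unfolding X_def[abs_def] D_def H_def
    by (intro has_derivative_diff has_derivative_scaleR Ck_on_gradient[OF F op S0[OF p]]
      Ck_on_has_derivative[OF F op S0[OF p]] has_derivative_ident)
  note E = orthonormal_frame[OF sub[OF p]]
  let ?E = "orthonormal_frame ?S p"
  have pE: "p \<bullet> e = 0" if "e \<in> ?E" for e using E(1) that unfolding T[OF p] by blast
  have pnE: "p \<notin> ?E" using pE[of p] pp by auto
  have "laplacian ?S f p = - (\<Sum>e\<in>?E. (H e - (F p *\<^sub>R e + dir_deriv F e p *\<^sub>R p)) \<bullet> e)"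
  proof (rule laplacian_eq_trace[OF sub _ fF _ _ p X'])
    show "(F has_derivative frechet_derivative F (at q)) (at q)" if "q \<in> ?S" for q
      by (rule Ck_on_has_derivative[OF F op S0[OF that]])
    show "X q \<in> tangent_space ?S q" if q: "q \<in> ?S" for q
    proof -
      have "D q \<bullet> q = F q"
        unfolding FD[OF q, symmetric]
        using homogeneous_1_radial_derivative[OF F, of q] hom[of _ q] S0[OF q] by simp
      moreover have "q \<bullet> q = 1" using q by (simp flip: power2_norm_eq_inner)
      ultimately show ?thesis unfolding T[OF q] by (simp add: X_def inner_diff_right inner_commute)
    qed
    show "frechet_derivative F (at q) v = X q \<bullet> v" if "q \<in> ?S" "v \<in> tangent_space ?S q" for q v
      using that FD[OF that(1)] unfolding T[OF that(1)] by (simp add: X_def inner_diff_left)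
  qed
  also have "(\<Sum>e\<in>?E. (H e - (F p *\<^sub>R e + dir_deriv F e p *\<^sub>R p)) \<bullet> e) = (\<Sum>e\<in>?E. H e \<bullet> e - F p)"
  proof (intro sum.cong refl)
    fix e assume e: "e \<in> ?E"
    have "e \<bullet> e = 1" using E(3)[OF e] by (simp flip: power2_norm_eq_inner)
    then show "(H e - (F p *\<^sub>R e + dir_deriv F e p *\<^sub>R p)) \<bullet> e = H e \<bullet> e - F p"
      using pE[OF e] by (simp add: inner_diff_left inner_add_left)
  qed
  also have "\<dots> = (\<Sum>e\<in>?E. H e \<bullet> e) - real (card ?E) * F p" by (simp add: sum_subtractf)
  also have "real (card ?E) = real DIM('a) - 1"
  proof -
    have "card ?E = dim (tangent_space ?S p)"
      using E(4,5) by (metis dim_eq_card_independent dim_span)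
    also have "\<dots> = DIM('a) - 1" unfolding T[OF p] by (rule dim_hyperplane) (use pp in auto)
    finally show ?thesis using DIM_positive[where 'a = 'a] by linarith
  qed
  also have "(\<Sum>e\<in>?E. H e \<bullet> e) = euclidean_laplacian F p"
  proof -
    have "H p \<bullet> p = 0"
    proof -
      have "dir_deriv (dir_deriv F b) p p = 0" for b
      proof (rule homogeneous_0_radial_derivative[OF Ck_on_Suc_dir_deriv[OF F]])
        show "dir_deriv F b (t *\<^sub>R p) = dir_deriv F b p" if "0 < t" for t
          using homogeneous_dir_deriv[OF F, of p t t b] hom[of t] S0[OF p] that by simp
      qed (use S0[OF p] in simp)
      then show ?thesis by (simp add: H_def)
    qed
    then have "(\<Sum>e\<in>?E. H e \<bullet> e) = (\<Sum>e\<in>insert p ?E. H e \<bullet> e)" using pnE E(6) by simp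
    also have "\<dots> = (\<Sum>b\<in>Basis. H b \<bullet> b)"
    proof (rule sum_orthonormal_basis_trace)
      show "pairwise orthogonal (insert p ?E)"
        using E(2) pE by (auto simp: pairwise_insert orthogonal_def inner_commute)
      show "norm e = 1" if "e \<in> insert p ?E" for e using that E(3) p by auto
      show "span (insert p ?E) = UNIV"
      proof -
        have "x \<in> span (insert p ?E)" for x
        proof -
          have "x - (p \<bullet> x) *\<^sub>R p \<in> span ?E"
            unfolding E(4) T[OF p] by (simp add: inner_diff_right pp)
          then show ?thesis by (auto simp: span_insert)
        qed
        then show ?thesis by blast
      qed
      show "finite (insert p ?E)" using E(6) by simp
      have "(D has_derivative H) (at p)"
        unfolding D_def[abs_def] H_def[abs_def] by (rule Ck_on_gradient[OF F op S0[OF p]])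
      then show "linear H" by (rule has_derivative_linear)
    qed
    also have "\<dots> = euclidean_laplacian F p"
      unfolding euclidean_laplacian_def H_def by (intro sum.cong refl) simp
    finally show ?thesis .
  qed
  finally show ?thesis using fF[OF p] by simp
qed

text \<open>Set to 0 off the sphere to meet the normalisation in \<open>eigenspace\<close>.\<close>

definition sphere_linear :: "'a::euclidean_space \<Rightarrow> 'a \<Rightarrow> real" where
  "sphere_linear a x = (if x \<in> sphere 0 1 then x \<bullet> a else 0)"

text \<open>Both powers of the norm are written with \<open>powr\<close>, so that smoothness of the
  scaling factor and of the radial projection come from one lemma.\<close>

lemma Ck_on_radial_extension:
  fixes G :: "'a::euclidean_space \<Rightarrow> real"
  assumes "open U" "sphere 0 1 \<subseteq> U" "Ck_on k U G"
  shows "Ck_on k (-{0}) (\<lambda>x. norm x powr 1 * G (norm x powr -1 *\<^sub>R x))"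
proof (intro Ck_on_mult Ck_on_norm_powr)
  show op: "open (-{0::'a})" by (simp add: open_Compl)
  show "Ck_on k (- {0}) (\<lambda>x. G (norm x powr -1 *\<^sub>R x))"
  proof (rule Ck_on_compose[OF assms(1) op _ _ assms(3)])
    show "Ck_on k (-{0}) (\<lambda>x. (norm x powr -1 *\<^sub>R x) \<bullet> b)" for b :: 'a
      unfolding inner_scaleR_left by (rule Ck_on_mult[OF op Ck_on_norm_powr Ck_on_inner[OF op]])
    show "(\<lambda>x. norm x powr -1 *\<^sub>R x) ` (-{0}) \<subseteq> U"
    proof (rule image_subsetI)
      fix x :: 'a assume "x \<in> -{0}"
      then have "norm x powr -1 *\<^sub>R x \<in> sphere 0 1" by (simp add: powr_minus)
      then show "norm x powr -1 *\<^sub>R x \<in> U" using assms(2) by blast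
    qed
  qed
qed

lemma sphere_first_eigenfunction_linear:
  fixes f :: "'a::euclidean_space \<Rightarrow> real"
  assumes dim: "2 \<le> DIM('a)" and f: "smooth_on_submanifold (sphere 0 1) f"
    and eig: "\<And>p. p \<in> sphere 0 1 \<Longrightarrow> laplacian (sphere 0 1) f p = (real DIM('a) - 1) * f p"
  obtains a where "\<And>x. x \<in> sphere 0 1 \<Longrightarrow> f x = x \<bullet> a"
proof -
  obtain U G where G: "open U" "sphere 0 1 \<subseteq> U" "\<And>k. Ck_on k U G" "\<And>x. x \<in> sphere 0 1 \<Longrightarrow> G x = f x"
    using f unfolding smooth_on_submanifold_def by blast
  define F where "F x = norm x powr 1 * G (norm x powr -1 *\<^sub>R x)" for x
  have F: "Ck_on k (-{0}) F" for k unfolding F_def by (rule Ck_on_radial_extension[OF G(1-3)])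
  have hom: "F (t *\<^sub>R x) = t * F x" if "0 < t" "x \<noteq> 0" for t x
  proof -
    have "norm (t *\<^sub>R x) powr -1 *\<^sub>R (t *\<^sub>R x) = norm x powr -1 *\<^sub>R x"
      using that by (simp add: powr_minus field_simps)
    then show ?thesis unfolding F_def using that by simp
  qed
  have fF: "f q = F q" if "q \<in> sphere 0 1" for q
    using that G(4)[OF that] by (simp add: F_def)
  have harm1: "euclidean_laplacian F p = 0" if "p \<in> sphere 0 1" for p
    using laplacian_sphere[OF F hom fF that] eig[OF that] by simp
  \<comment> \<open>The Laplacian of a function of degree 1 has degree -1, so its vanishing on the
    sphere spreads along rays.\<close>
  have "euclidean_laplacian F x = 0" if x: "x \<noteq> 0" for x
  proof -
    define p where "p = x /\<^sub>R norm x"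
    have p: "p \<noteq> 0" "p \<in> sphere 0 1" "x = norm x *\<^sub>R p" using x by (auto simp: p_def)
    have nx: "0 < norm x" using x by simp
    have hom0: "dir_deriv F b (t *\<^sub>R y) = 1 * dir_deriv F b y" if "0 < t" "y \<noteq> 0" for t y b
      using homogeneous_dir_deriv[OF F[of "Suc 0"] that(2), of t t b] that hom by simp
    have "norm x * dir_deriv (dir_deriv F b) b x = dir_deriv (dir_deriv F b) b p" for b
      using homogeneous_dir_deriv[OF Ck_on_Suc_dir_deriv[OF F[of "Suc (Suc 0)"]] p(1), of "norm x" b 1 b]
        hom0[OF nx] nx p(3) by simp
    then have "norm x * euclidean_laplacian F x = euclidean_laplacian F p"
      by (simp add: euclidean_laplacian_def sum_distrib_left)
    then show ?thesis using harm1[OF p(2)] x by simp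
  qed
  then obtain a where a: "\<And>x. x \<noteq> 0 \<Longrightarrow> F x = x \<bullet> a"
    using homogeneous_1_harmonic_linear[OF dim F hom] by blast
  show ?thesis
  proof (rule that[of a])
    fix x :: 'a assume x: "x \<in> sphere 0 1"
    then have "x \<noteq> 0" by auto
    then show "f x = x \<bullet> a" using fF[OF x] a by simp
  qed
qed

lemma sphere_linear_eigenfunction:
  fixes a :: "'a::euclidean_space"
  shows "smooth_on_submanifold (sphere 0 1) (sphere_linear a)"
    "p \<in> sphere 0 1 \<Longrightarrow> laplacian (sphere 0 1) (sphere_linear a) p = (real DIM('a) - 1) * sphere_linear a p"
proof -
  show "smooth_on_submanifold (sphere 0 1) (sphere_linear a)"
    unfolding smooth_on_submanifold_def
    by (intro exI[of _ UNIV] exI[of _ "\<lambda>x. x \<bullet> a"]) (auto simp: Ck_on_inner sphere_linear_def)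
  assume p: "p \<in> sphere 0 1"
  have d: "dir_deriv (\<lambda>x. x \<bullet> a) b = (\<lambda>x. b \<bullet> a)" for b
    by (rule ext, subst frechet_derivative_eq[where D = "\<lambda>v. v \<bullet> a"]) (auto intro!: derivative_eq_intros)
  have "euclidean_laplacian (\<lambda>x. x \<bullet> a) p = 0"
    unfolding euclidean_laplacian_def d by simp
  then show "laplacian (sphere 0 1) (sphere_linear a) p = (real DIM('a) - 1) * sphere_linear a p"
    using laplacian_sphere[OF Ck_on_inner, of a "sphere_linear a" p] p
    by (simp add: open_Compl sphere_linear_def)
qed

lemma sphere_linear_inj:
  assumes "\<And>x. x \<in> sphere 0 1 \<Longrightarrow> x \<bullet> a = x \<bullet> b"
  shows "a = b"
proof (rule ccontr)
  assume "a \<noteq> b"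
  then have "(a - b) /\<^sub>R norm (a - b) \<in> sphere 0 1" by simp
  from assms[OF this] have "(a - b) \<bullet> a = (a - b) \<bullet> b" using \<open>a \<noteq> b\<close> by simp
  then have "(a - b) \<bullet> (a - b) = 0" by (simp add: inner_diff_right)
  then show False using \<open>a \<noteq> b\<close> by simp
qed

text \<open>For self-adjoint \<sigma>, the linear function given by \<open>a\<close> is invariant on
  the sphere exactly when \<sigma> fixes \<open>a\<close>, because a vector is determined by its
  inner products with unit vectors. So a basis of the fixed space yields a basis of the
  eigenspace.\<close>

lemma multiplicity_sphere_quotient:
  fixes \<sigma> :: "'a::euclidean_space \<Rightarrow> 'a"
  assumes dim: "2 \<le> DIM('a)" and lin: "linear \<sigma>" and adj: "\<And>x y. \<sigma> x \<bullet> y = x \<bullet> \<sigma> y"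
    and iso: "\<And>x. x \<in> sphere 0 1 \<Longrightarrow> \<sigma> x \<in> sphere 0 1"
  shows "multiplicity_0 (sphere 0 1, {\<sigma>}) (real DIM('a) - 1) = dim {a. \<sigma> a = a}"
proof -
  let ?A = "{a. \<sigma> a = a}"
  have "subspace ?A" using lin by (auto simp: subspace_def linear_0 linear_add linear_scale)
  obtain B where B: "B \<subseteq> ?A" "independent B" "?A \<subseteq> span B" "card B = dim ?A"
    using basis_exists by blast
  have fin: "finite B" using B(2) by (rule finiteI_independent)
  have spanB: "span B = ?A" using B(1,3) \<open>subspace ?A\<close> by (simp add: span_minimal subset_antisym)
  have sum: "(\<Sum>a\<in>B. c a * sphere_linear a x) = sphere_linear (\<Sum>a\<in>B. c a *\<^sub>R a) x" for c x
    by (simp add: sphere_linear_def inner_sum_right)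
  have "eigenspace (sphere 0 1, {\<sigma>}) (real DIM('a) - 1) = {f. \<exists>c. f = (\<lambda>x. \<Sum>a\<in>B. c a * sphere_linear a x)}"
  proof (intro set_eqI iffI)
    fix f assume "f \<in> eigenspace (sphere 0 1, {\<sigma>}) (real DIM('a) - 1)"
    then have f: "smooth_on_submanifold (sphere 0 1) f" "\<And>x. x \<notin> sphere 0 1 \<Longrightarrow> f x = 0"
      "\<And>x. x \<in> sphere 0 1 \<Longrightarrow> f (\<sigma> x) = f x"
      "\<And>p. p \<in> sphere 0 1 \<Longrightarrow> laplacian (sphere 0 1) f p = (real DIM('a) - 1) * f p"
      unfolding eigenspace_def by auto
    obtain a where a: "\<And>x. x \<in> sphere 0 1 \<Longrightarrow> f x = x \<bullet> a"
      using sphere_first_eigenfunction_linear[OF dim f(1,4)] by blast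
    have "\<sigma> a = a"
      by (rule sphere_linear_inj) (metis a f(3) adj iso)
    then obtain c where "a = (\<Sum>b\<in>B. c b *\<^sub>R b)"
      using spanB fin by (auto simp: span_finite)
    then have "f x = (\<Sum>a\<in>B. c a * sphere_linear a x)" for x
      unfolding sum using a[of x] f(2)[of x] by (simp add: sphere_linear_def)
    then show "f \<in> {f. \<exists>c. f = (\<lambda>x. \<Sum>a\<in>B. c a * sphere_linear a x)}" by blast
  next
    fix f assume "f \<in> {f. \<exists>c. f = (\<lambda>x. \<Sum>a\<in>B. c a * sphere_linear a x)}"
    then obtain c where c: "f = sphere_linear (\<Sum>a\<in>B. c a *\<^sub>R a)" by (auto simp: sum)
    have "(\<Sum>a\<in>B. c a *\<^sub>R a) \<in> span B" by (intro span_sum span_scale span_base)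
    then have "\<sigma> (\<Sum>a\<in>B. c a *\<^sub>R a) = (\<Sum>a\<in>B. c a *\<^sub>R a)" using spanB by blast
    then have "f (\<sigma> x) = f x" if "x \<in> sphere 0 1" for x
      using iso[OF that] that adj[of x "\<Sum>a\<in>B. c a *\<^sub>R a"] by (simp add: c sphere_linear_def)
    moreover have "f x = 0" if "x \<notin> sphere 0 1" for x using that by (simp add: c sphere_linear_def)
    ultimately show "f \<in> eigenspace (sphere 0 1, {\<sigma>}) (real DIM('a) - 1)"
      unfolding eigenspace_def c by (simp add: sphere_linear_eigenfunction)
  qed
  moreover have "independent_family sphere_linear B"
    unfolding independent_family_def
  proof (intro allI impI ballI)
    fix c a assume 0: "\<forall>x. (\<Sum>a\<in>B. c a * sphere_linear a x) = 0" and "a \<in> B"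
    have "(\<Sum>a\<in>B. c a *\<^sub>R a) = 0"
    proof (rule sphere_linear_inj)
      fix x :: 'a assume "x \<in> sphere 0 1"
      then show "x \<bullet> (\<Sum>a\<in>B. c a *\<^sub>R a) = x \<bullet> 0"
        using spec[OF 0, of x] unfolding sum by (simp add: sphere_linear_def)
    qed
    then show "c a = 0" using independentD[OF B(2) fin subset_refl] \<open>a \<in> B\<close> by blast
  qed
  ultimately show ?thesis
    unfolding multiplicity_0_def using dim_independent_family[OF fin] B(4) by simp
qed

section \<open>Comparison of the spectra\<close>

lemma multiplicity_spherical_orbifold:
  assumes "2 \<le> CARD('s)" "k \<le> CARD('s)"
  shows "multiplicity_0 (spherical_orbifold k :: (real, 's::{finite,linorder}) vec quotient_presentation) (real CARD('s) - 1) = k"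
proof -
  let ?N = "negated_axes (CARD('s) - k) :: (real, 's) vec set"
  let ?\<sigma> = "\<lambda>x :: (real, 's) vec. sign_matrix (CARD('s) - k) *v x"
  have adj: "?\<sigma> x \<bullet> y = x \<bullet> ?\<sigma> y" for x y
    unfolding euclidean_inner[of "?\<sigma> x" y] euclidean_inner[of x "?\<sigma> y"]
    by (intro sum.cong refl) (simp add: sign_matrix_action)
  have involution: "?\<sigma> (?\<sigma> x) = x" for x
    by (rule euclidean_eqI) (simp add: sign_matrix_action)
  have iso: "?\<sigma> x \<in> sphere 0 1" if "x \<in> sphere 0 1" for x
    using that adj[of x "?\<sigma> x"] by (simp add: involution norm_eq_sqrt_inner)
  have "{a. ?\<sigma> a = a} = {x. \<forall>b\<in>Basis. b \<notin> Basis - ?N \<longrightarrow> x \<bullet> b = 0}"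
  proof -
    have "?\<sigma> a = a \<longleftrightarrow> (\<forall>b\<in>Basis. (if b \<in> ?N then - (a \<bullet> b) else a \<bullet> b) = a \<bullet> b)" for a
      by (simp add: euclidean_eq_iff[of "?\<sigma> a" a] sign_matrix_action)
    then show ?thesis by auto
  qed
  moreover have "card (Basis - ?N) = k"
    using assms card_negated_axes[of "CARD('s) - k", where ?'n = 's]
    by (simp add: card_Diff_subset finite_subset[OF negated_axes_Basis] negated_axes_Basis)
  ultimately have "dim {a. ?\<sigma> a = a} = k" by (simp only: dim_substandard[OF Diff_subset])
  then show ?thesis
    using multiplicity_sphere_quotient[OF _ matrix_vector_mul_linear adj iso] assms(1)
    by (simp add: spherical_orbifold_def quotient_by_def round_sphere_def)
qed

lemma multiplicity_projective_space:
  assumes "2 \<le> CARD('s::finite)"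
  shows "multiplicity_0 (projective_space :: (real ^ 's) quotient_presentation) (real CARD('s) - 1) = 0"
proof -
  have "{a :: real ^ 's. - a = a} = {0}" by (auto simp: vec_eq_iff)
  then have "dim {a :: real ^ 's. - a = a} = 0" by simp
  then show ?thesis
    using multiplicity_sphere_quotient[of "\<lambda>x :: real ^ 's. - x"] assms
    by (simp add: projective_space_def quotient_by_def round_sphere_def linear_iff)
qed

lemma multiplicity_hemisphere:
  fixes u :: "real ^ 's"
  assumes "2 \<le> CARD('s)" "norm u = 1"
  shows "multiplicity_0 (hemisphere u) (real CARD('s) - 1) = CARD('s) - 1"
proof -
  let ?\<sigma> = "\<lambda>x. x - (2 * (x \<bullet> u)) *\<^sub>R u"
  have u: "u \<bullet> u = 1" "u \<noteq> 0" using assms(2) by (auto simp flip: power2_norm_eq_inner)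
  have lin: "linear ?\<sigma>" by (rule linearI) (simp_all add: inner_add_left algebra_simps)
  have adj: "?\<sigma> x \<bullet> y = x \<bullet> ?\<sigma> y" for x y
    by (simp add: inner_diff_left inner_diff_right inner_commute)
  have iso: "?\<sigma> x \<in> sphere 0 1" if "x \<in> sphere 0 1" for x
  proof -
    have "?\<sigma> x \<bullet> ?\<sigma> x = x \<bullet> x"
      using u(1) by (simp add: inner_diff_left inner_diff_right inner_commute[of u x])
    then show ?thesis using that by (simp add: norm_eq_sqrt_inner)
  qed
  have "{a. ?\<sigma> a = a} = {a. u \<bullet> a = 0}" using u by (auto simp: inner_commute)
  then have "dim {a. ?\<sigma> a = a} = CARD('s) - 1" using u by (simp add: dim_hyperplane)
  then show ?thesis
    using multiplicity_sphere_quotient[OF _ lin adj iso] assms(1)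
    by (simp add: hemisphere_def quotient_by_def round_sphere_def)
qed

lemma surfaces_not_isospectral:
  "\<not> isospectral_0 klein_bottle cylinder \<and>
    \<not> isospectral_0 klein_bottle moebius_strip \<and>
    \<not> isospectral_0 klein_bottle four_pillow \<and>
    \<not> isospectral_0 cylinder moebius_strip \<and>
    \<not> isospectral_0 cylinder four_pillow \<and>
    \<not> isospectral_0 moebius_strip four_pillow"
proof (intro conjI)
  show "\<not> isospectral_0 moebius_strip four_pillow"
    by (rule not_isospectral_0I[OF second_eigenvalue_moebius_pillow])
qed (rule not_isospectral_0I[where \<mu> = "4 * pi\<^sup>2"], simp add: first_eigenvalue_surfaces)+

lemma flat_orbifolds_not_isospectral:
  fixes m :: nat
  assumes m: "m > 1" and n: "CARD('n::{finite,linorder}) = 2 * m" and t: "CARD('t::finite) = 2 * m - 2"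
  shows "let I = {k::nat. odd k \<and> 1 \<le> k \<and> k \<le> 2 * m - 3};
           Orb = (flat_orbifold :: nat \<Rightarrow> (real, 'n) vec quotient_presentation);
           T = (cubical_torus :: (real ^ 't) quotient_presentation);
           TK = riemannian_product T klein_bottle;
           TC = riemannian_product T cylinder;
           TB = riemannian_product T moebius_strip
       in (\<forall>k\<in>I. \<forall>l\<in>I. k \<noteq> l \<longrightarrow> \<not> isospectral_0 (Orb k) (Orb l)) \<and>
          (\<forall>k\<in>I. \<not> isospectral_0 (Orb k) TK \<and> \<not> isospectral_0 (Orb k) TC
                  \<and> \<not> isospectral_0 (Orb k) TB) \<and>
          \<not> isospectral_0 TK TC \<and> \<not> isospectral_0 TK TB \<and> \<not> isospectral_0 TC TB"
proof -
  let ?Orb = "flat_orbifold :: nat \<Rightarrow> (real, 'n) vec quotient_presentation"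
  let ?T = "cubical_torus :: (real ^ 't) quotient_presentation"
  let ?TK = "riemannian_product ?T klein_bottle"
  let ?TC = "riemannian_product ?T cylinder"
  let ?TB = "riemannian_product ?T moebius_strip"
  let ?M = "4 * pi\<^sup>2"
  have Orb: "multiplicity_0 (?Orb k) ?M = 2 * m + k" if "k \<le> 2 * m - 3" for k
    using first_eigenvalue_flat_orbifold[of k, where ?'n = 'n] that n by simp
  have TK: "multiplicity_0 ?TK ?M = 4 * m - 3" and TC: "multiplicity_0 ?TC ?M = 4 * m - 1"
    and TB: "multiplicity_0 ?TB ?M = 4 * m - 2"
    using first_eigenvalue_products[where ?'t = 't] t m by simp_all
  have "\<not> isospectral_0 (?Orb k) (?Orb l)" if "k \<le> 2 * m - 3" "l \<le> 2 * m - 3" "k \<noteq> l" for k l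
    using that by (intro not_isospectral_0I[where \<mu> = ?M]) (simp add: Orb)
  moreover have "\<not> isospectral_0 (?Orb k) ?TK" if k: "k \<le> 2 * m - 3" for k
  \<comment> \<open>In this case \<open>2 * m + k\<close> equals the first multiplicity
    \<open>4 * m - 3\<close> of \<open>?TK\<close>, and the level r = 2 has to decide.\<close>
  proof (cases "k = 2 * m - 3")
    case True
    then show ?thesis
      using second_eigenvalue_flat_orbifold_klein[where ?'n = 'n and ?'t = 't] n t m
      by (intro not_isospectral_0I[where \<mu> = "4 * pi\<^sup>2 * 2"]) simp
  next
    case False
    then show ?thesis
      using k m by (intro not_isospectral_0I[where \<mu> = ?M]) (simp add: Orb TK)
  qed
  moreover have "\<not> isospectral_0 (?Orb k) ?TC \<and> \<not> isospectral_0 (?Orb k) ?TB" if "k \<le> 2 * m - 3" for k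
    using that m by (intro conjI not_isospectral_0I[where \<mu> = ?M]) (simp_all add: Orb TC TB)
  moreover have "\<not> isospectral_0 ?TK ?TC" "\<not> isospectral_0 ?TK ?TB" "\<not> isospectral_0 ?TC ?TB"
    using m by (intro not_isospectral_0I[where \<mu> = ?M]; simp add: TK TC TB)+
  ultimately show ?thesis by (simp add: Let_def)
qed

text \<open>At the eigenvalue 2m the multiplicities are k for the orbifolds, 0 for the projective
  space and 2m for the hemisphere; the range of k keeps them apart.\<close>

lemma spherical_orbifolds_not_isospectral:
  fixes m :: nat and u :: "(real, 's::{finite,linorder}) vec"
  assumes m: "m > 1" and n: "CARD('s) = 2 * m + 1" and u: "norm u = 1"
  defines "I \<equiv> {k::nat. even k \<and> 2 \<le> k \<and> k \<le> 2 * m - 2}"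
    and "Orb \<equiv> (spherical_orbifold :: nat \<Rightarrow> (real, 's) vec quotient_presentation)"
    and "P \<equiv> (projective_space :: (real, 's) vec quotient_presentation)"
  shows "(\<forall>k\<in>I. \<forall>l\<in>I. k \<noteq> l \<longrightarrow> \<not> isospectral_0 (Orb k) (Orb l)) \<and>
    (\<forall>k\<in>I. \<not> isospectral_0 (Orb k) P \<and> \<not> isospectral_0 (Orb k) (hemisphere u)) \<and>
    \<not> isospectral_0 P (hemisphere u)"
proof -
  let ?M = "real CARD('s) - 1"
  have Orb: "multiplicity_0 (Orb k) ?M = k" if "k \<in> I" for k
    unfolding Orb_def using that n m by (intro multiplicity_spherical_orbifold) (auto simp: I_def)
  have P: "multiplicity_0 P ?M = 0"
    unfolding P_def using n m by (intro multiplicity_projective_space) simp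
  have H: "multiplicity_0 (hemisphere u) ?M = 2 * m"
    using multiplicity_hemisphere[OF _ u] n m by simp
  have "2 \<le> k \<and> k < 2 * m" if "k \<in> I" for k using that m by (auto simp: I_def)
  then show ?thesis
    using Orb P H m by (intro conjI ballI impI; intro not_isospectral_0I[where \<mu> = ?M]) fastforce+
qed

theorem proposition3p5:
  shows
  "(\<not> isospectral_0 klein_bottle cylinder \<and>
    \<not> isospectral_0 klein_bottle moebius_strip \<and>
    \<not> isospectral_0 klein_bottle four_pillow \<and>
    \<not> isospectral_0 cylinder moebius_strip \<and>
    \<not> isospectral_0 cylinder four_pillow \<and>
    \<not> isospectral_0 moebius_strip four_pillow)
   \<and>
   (\<forall>m::nat. m > 1 \<and> CARD('n::{finite,linorder}) = 2 * m \<and> CARD('t::finite) = 2 * m - 2 \<longrightarrow>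
      (let I = {k::nat. odd k \<and> 1 \<le> k \<and> k \<le> 2 * m - 3};
           Orb = (flat_orbifold :: nat \<Rightarrow> (real, 'n) vec quotient_presentation);
           T = (cubical_torus :: (real ^ 't) quotient_presentation);
           TK = riemannian_product T klein_bottle;
           TC = riemannian_product T cylinder;
           TB = riemannian_product T moebius_strip
       in (\<forall>k\<in>I. \<forall>l\<in>I. k \<noteq> l \<longrightarrow> \<not> isospectral_0 (Orb k) (Orb l)) \<and>
          (\<forall>k\<in>I. \<not> isospectral_0 (Orb k) TK \<and> \<not> isospectral_0 (Orb k) TC
                  \<and> \<not> isospectral_0 (Orb k) TB) \<and>
          \<not> isospectral_0 TK TC \<and> \<not> isospectral_0 TK TB \<and> \<not> isospectral_0 TC TB))
   \<and>
   (\<forall>m::nat. m > 1 \<and> CARD('s::{finite,linorder}) = 2 * m + 1 \<longrightarrow>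
      (let I = {k::nat. even k \<and> 2 \<le> k \<and> k \<le> 2 * m - 2};
           Orb = (spherical_orbifold :: nat \<Rightarrow> (real, 's) vec quotient_presentation);
           P = (projective_space :: (real, 's) vec quotient_presentation)
       in \<forall>u::(real, 's) vec. norm u = 1 \<longrightarrow>
            (\<forall>k\<in>I. \<forall>l\<in>I. k \<noteq> l \<longrightarrow> \<not> isospectral_0 (Orb k) (Orb l)) \<and>
            (\<forall>k\<in>I. \<not> isospectral_0 (Orb k) P \<and> \<not> isospectral_0 (Orb k) (hemisphere u)) \<and>
            \<not> isospectral_0 P (hemisphere u)))"
proof (intro conjI[OF surfaces_not_isospectral] conjI allI impI)
  show "let I = {k::nat. odd k \<and> 1 \<le> k \<and> k \<le> 2 * m - 3};
           Orb = (flat_orbifold :: nat \<Rightarrow> (real, 'n) vec quotient_presentation);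
           T = (cubical_torus :: (real ^ 't) quotient_presentation);
           TK = riemannian_product T klein_bottle;
           TC = riemannian_product T cylinder;
           TB = riemannian_product T moebius_strip
       in (\<forall>k\<in>I. \<forall>l\<in>I. k \<noteq> l \<longrightarrow> \<not> isospectral_0 (Orb k) (Orb l)) \<and>
          (\<forall>k\<in>I. \<not> isospectral_0 (Orb k) TK \<and> \<not> isospectral_0 (Orb k) TC
                  \<and> \<not> isospectral_0 (Orb k) TB) \<and>
          \<not> isospectral_0 TK TC \<and> \<not> isospectral_0 TK TB \<and> \<not> isospectral_0 TC TB"
    if "m > 1 \<and> CARD('n) = 2 * m \<and> CARD('t) = 2 * m - 2" for m
    using that by (intro flat_orbifolds_not_isospectral) auto
qed (unfold Let_def, intro allI impI spherical_orbifolds_not_isospectral, auto)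

end
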